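(* The two-dimensional Pinball Wizard problem whose instances use only one-way gates, plane walls, parabolic walls and moving walls can simulate any two-stack pushdown automaton, in such a way that each step of the automaton is represented by a constant number of reflections of the ball. The same holds if the moving walls are replaced by bumpers.
   Context: The Pinball Wizard problem (in two dimensions): a pinball is a point moving in the Euclidean plane; it enters the construction at time $t=0$ with a given rational start position and a given velocity vector, and between collisions it moves in a straight line at constant velocity. It interacts with the following components, all collisions being perfectly elastic (the components are not affected by the ball): - Walls: line segments with endpoints in $\mathbb{Q}^2$; the ball reflects by the law of reflection. - Parabolic walls: arcs $y=ax^2+bx+c$ for $x\in[x_0,x_1]$, with $a,b,c,x_0,x_1\in\mathbb{Q}$; the ball reflects with respect to the tangent at the point of impact. - One-way gates: line segments with rational endpoints, opening clockwise from start point to end point; from one side the ball passes through unchanged, from the other side it is reflected as by a wall. - Moving walls: segments with rational initial endpoints, together with a start time, a time interval $[0,t_1)$ with a movement function given by a quotient of two polynomials in time $t$ with rational coefficients, and a second interval $[t_1,t_2)$ during which the wall moves back; the motion repeats periodically after $t_2$. A collision is computed in the rest frame of the wall at the time of collision (elastic reflection there), then transformed back. - Bumpers: segments with rational endpoints, a start time, a time interval $[0,t_1)$ with an effect function given by a quotient of two polynomials in $t$ with rational coefficients, and an interval $[t_1,t_2)$ during which the bumper rests, repeated periodically; on collision a bumper reverses the direction of the ball and increases or decreases the magnitude of its speed by the current effect value. The decision problem: given the start position and velocity of the ball, a finite set of such components, and a target position (all rational data), decide whether the ball reaches the target. A two-stack pushdown automaton is a deterministic finite-state machine with two unbounded binary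 stacks supporting push and pop; it is equivalent in power to a deterministic Turing machine. "Simulate" means: the configuration (state and contents of both stacks) is encoded in the ball's trajectory (e.g. one stack encoded in the spatial offset and one in the time offset with which the ball crosses designated lines, as binary fractions $0.b_1b_2\dots$ with the top symbol $b_1$ first), and the construction maps the encoding of each configuration to the encoding of its successor configuration. *)

theory Defs
  imports "HOL-Analysis.Analysis" "HOL-Computational_Algebra.Polynomial" "HOL-Library.Real_Mod"
begin

type_synonym rat_point = "rat \<times> rat"

type_synonym rat_fun = "rat poly \<times> rat poly"

definition real_point :: "rat_point \<Rightarrow> real \<times> real" where
  "real_point P = (of_rat (fst P), of_rat (snd P))"

definition rat_fun_eval :: "rat_fun \<Rightarrow> real \<Rightarrow> real" where
  "rat_fun_eval f t = poly (map_poly of_rat (fst f)) t / poly (map_poly of_rat (snd f)) t"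

text \<open>
  The arguments of \<open>Parabolic_Wall\<close> are \<open>a b c x0 x1\<close>.  A moving wall
  \<open>Moving_Wall P Q d t0 f t1 t2\<close> has initial endpoints \<open>P\<close> and \<open>Q\<close> and is translated by
  \<open>f(\<tau>)\<close> times the vector \<open>d\<close> at time \<open>\<tau>\<close> of the current period; periods begin at
  \<open>t0\<close> and have length \<open>t2\<close>.  A bumper \<open>Bumper P Q t0 f t1 t2\<close> has effect function \<open>f\<close>.
\<close>

datatype component =
    is_wall: Wall rat_point rat_point
  | is_parabolic_wall: Parabolic_Wall rat rat rat rat rat
  | is_gate: Gate rat_point rat_point
  | is_moving_wall: Moving_Wall rat_point rat_point rat_point rat rat_fun rat rat
  | is_bumper: Bumper rat_point rat_point rat rat_fun rat rat

fun valid_component :: "component \<Rightarrow> bool" where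
  "valid_component (Wall P Q) \<longleftrightarrow> P \<noteq> Q"
| "valid_component (Parabolic_Wall a b c x0 x1) \<longleftrightarrow> x0 < x1"
| "valid_component (Gate P Q) \<longleftrightarrow> P \<noteq> Q"
| "valid_component (Moving_Wall P Q d t0 f t1 t2) \<longleftrightarrow>
     P \<noteq> Q \<and> 0 \<le> t0 \<and> 0 < t1 \<and> t1 < t2 \<and> rat_fun_eval f 0 = 0 \<and>
     (\<forall>\<tau>\<in>{0..of_rat t1}. poly (map_poly of_rat (snd f)) \<tau> \<noteq> (0::real))"
| "valid_component (Bumper P Q t0 f t1 t2) \<longleftrightarrow>
     P \<noteq> Q \<and> 0 \<le> t0 \<and> 0 < t1 \<and> t1 < t2 \<and>
     (\<forall>\<tau>\<in>{0..<of_rat t1}. poly (map_poly of_rat (snd f)) \<tau> \<noteq> (0::real))"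

definition segment :: "rat_point \<Rightarrow> rat_point \<Rightarrow> (real \<times> real) set" where
  "segment P Q = closed_segment (real_point P) (real_point Q)"

definition cross :: "real \<times> real \<Rightarrow> real \<times> real \<Rightarrow> real" where
  "cross u v = fst u * snd v - snd u * fst v"

definition segment_normal :: "rat_point \<Rightarrow> rat_point \<Rightarrow> real \<times> real" where
  "segment_normal P Q = (let u = real_point Q - real_point P in (- snd u, fst u))"

definition reflect :: "real \<times> real \<Rightarrow> real \<times> real \<Rightarrow> real \<times> real" where
  "reflect n v = v - (2 * (v \<bullet> n) / (n \<bullet> n)) *\<^sub>R n"

text \<open>
  A moving wall is at its initial position before \<open>t0\<close>, follows \<open>f\<close> for \<open>\<tau>\<close> in \<open>[0, t1)\<close>, and
  returns from \<open>f(t1)\<close> to its initial position with constant velocity for \<open>\<tau>\<close> in \<open>[t1, t2)\<close>.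
  At the instants where the motion changes, the velocity is that of the phase just beginning.
\<close>

definition displacement :: "rat \<Rightarrow> rat_fun \<Rightarrow> rat \<Rightarrow> rat \<Rightarrow> real \<Rightarrow> real" where
  "displacement t0 f t1 t2 t =
     (let \<tau> = (t - of_rat t0) rmod of_rat t2 in
      if t < of_rat t0 then 0
      else if \<tau> < of_rat t1 then rat_fun_eval f \<tau>
      else rat_fun_eval f (of_rat t1) * (of_rat t2 - \<tau>) / (of_rat t2 - of_rat t1))"

definition displacement_rate :: "rat \<Rightarrow> rat_fun \<Rightarrow> rat \<Rightarrow> rat \<Rightarrow> real \<Rightarrow> real" where
  "displacement_rate t0 f t1 t2 t =
     (let \<tau> = (t - of_rat t0) rmod of_rat t2 in
      if t < of_rat t0 then 0
      else if \<tau> < of_rat t1 then deriv (rat_fun_eval f) \<tau>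
      else - rat_fun_eval f (of_rat t1) / (of_rat t2 - of_rat t1))"

definition bumper_active :: "rat \<Rightarrow> rat \<Rightarrow> rat \<Rightarrow> real \<Rightarrow> bool" where
  "bumper_active t0 t1 t2 t \<longleftrightarrow>
     of_rat t0 \<le> t \<and> (t - of_rat t0) rmod of_rat t2 < of_rat t1"

record ball =
  time :: real
  pos :: "real \<times> real"
  vel :: "real \<times> real"

definition fly :: "real \<Rightarrow> ball \<Rightarrow> ball" where
  "fly s b = b\<lparr>time := time b + s, pos := pos b + s *\<^sub>R vel b\<rparr>"

text \<open>
  The gate from \<open>P\<close> to \<open>Q\<close> is a door hinged at \<open>P\<close> that swings open clockwise, that is, to the
  right of the direction from \<open>P\<close> to \<open>Q\<close>.  A ball moving towards the left side is reflected; any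
  other ball passes, and such a passage is not a collision.
\<close>

fun collides :: "component \<Rightarrow> ball \<Rightarrow> bool" where
  "collides (Wall P Q) b \<longleftrightarrow> pos b \<in> segment P Q"
| "collides (Parabolic_Wall p q r x0 x1) b \<longleftrightarrow>
     fst (pos b) \<in> {of_rat x0..of_rat x1} \<and>
     snd (pos b) = of_rat p * (fst (pos b))\<^sup>2 + of_rat q * fst (pos b) + of_rat r"
| "collides (Gate P Q) b \<longleftrightarrow>
     pos b \<in> segment P Q \<and> cross (real_point Q - real_point P) (vel b) > 0"
| "collides (Moving_Wall P Q d t0 f t1 t2) b \<longleftrightarrow>
     pos b - displacement t0 f t1 t2 (time b) *\<^sub>R real_point d \<in> segment P Q"
| "collides (Bumper P Q t0 f t1 t2) b \<longleftrightarrow> pos b \<in> segment P Q"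

text \<open>
  An active bumper sends the ball back along its path; its speed changes by the effect value, but
  not below zero.  A resting bumper is a plain wall.  If a resting bumper also sent the ball back
  along its path, the time of a collision could not influence the path of the ball, except that
  the ball might be stopped.
\<close>

fun rebound :: "component \<Rightarrow> ball \<Rightarrow> real \<times> real" where
  "rebound (Wall P Q) b = reflect (segment_normal P Q) (vel b)"
| "rebound (Parabolic_Wall p q r x0 x1) b =
     reflect (- (2 * of_rat p * fst (pos b) + of_rat q), 1) (vel b)"
| "rebound (Gate P Q) b = reflect (segment_normal P Q) (vel b)"
| "rebound (Moving_Wall P Q d t0 f t1 t2) b =
     (let w = displacement_rate t0 f t1 t2 (time b) *\<^sub>R real_point d
      in reflect (segment_normal P Q) (vel b - w) + w)"
| "rebound (Bumper P Q t0 f t1 t2) b =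
     (if bumper_active t0 t1 t2 (time b)
      then - (max 0 (norm (vel b) + rat_fun_eval f ((time b - of_rat t0) rmod of_rat t2))
              / norm (vel b)) *\<^sub>R vel b
      else reflect (segment_normal P Q) (vel b))"

text \<open>A component that the ball touches at time offset 0, as it does after a collision, is ignored.\<close>

definition undisturbed :: "component set \<Rightarrow> ball \<Rightarrow> real \<Rightarrow> bool" where
  "undisturbed C b s \<longleftrightarrow> (\<forall>r\<in>{0<..<s}. \<forall>c\<in>C. \<not> collides c (fly r b))"

text \<open>
  The motion is left undefined from the moment when the ball hits several components at once.
\<close>

definition next_collision :: "component set \<Rightarrow> ball \<Rightarrow> ball \<Rightarrow> bool" where
  "next_collision C b b' \<longleftrightarrow>
     (\<exists>s>0. \<exists>c. undisturbed C b s \<and> {k \<in> C. collides k (fly s b)} = {c} \<and>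
            b' = (fly s b)\<lparr>vel := rebound c (fly s b)\<rparr>)"

text \<open>\<open>travels C n b b'\<close>: the ball gets from \<open>b\<close> to \<open>b'\<close> with exactly \<open>n\<close> collisions.\<close>

inductive travels :: "component set \<Rightarrow> nat \<Rightarrow> ball \<Rightarrow> ball \<Rightarrow> bool" for C where
  start: "travels C 0 b b"
| flight: "travels C 0 b (fly s b)"
    if "s > 0" "undisturbed C b s" "\<forall>c\<in>C. \<not> collides c (fly s b)"
| collision: "travels C (Suc n) b b''"
    if "next_collision C b b'" "travels C n b' b''"

definition reaches :: "component set \<Rightarrow> ball \<Rightarrow> real \<times> real \<Rightarrow> bool" where
  "reaches C b p \<longleftrightarrow>
     (\<exists>n b' s. travels C n b b' \<and> s \<ge> 0 \<and> undisturbed C b' s \<and> pos (fly s b') = p)"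

record pinball_instance =
  start_position :: rat_point
  start_velocity :: rat_point
  components :: "component set"
  target :: rat_point

definition pinball_instance :: "pinball_instance \<Rightarrow> bool" where
  "pinball_instance I \<longleftrightarrow> finite (components I) \<and> (\<forall>c\<in>components I. valid_component c)"

definition entering_ball :: "pinball_instance \<Rightarrow> ball" where
  "entering_ball I =
     \<lparr>time = 0, pos = real_point (start_position I), vel = real_point (start_velocity I)\<rparr>"

definition pinball_wizard :: "pinball_instance \<Rightarrow> bool" where
  "pinball_wizard I \<longleftrightarrow> reaches (components I) (entering_ball I) (real_point (target I))"

datatype stack_action = Keep | Push bool | Pop

text \<open>
  The transition function sees the top symbols, \<open>None\<close> standing for an empty stack.  Where it is
  undefined, the automaton halts.
\<close>

record 'q two_stack_pda =
  initial :: 'q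
  transition :: "'q \<Rightarrow> bool option \<Rightarrow> bool option \<Rightarrow> ('q \<times> stack_action \<times> stack_action) option"

type_synonym 'q configuration = "'q \<times> bool list \<times> bool list"

fun top_symbol :: "bool list \<Rightarrow> bool option" where
  "top_symbol [] = None"
| "top_symbol (x # xs) = Some x"

fun perform :: "stack_action \<Rightarrow> bool list \<Rightarrow> bool list" where
  "perform Keep xs = xs"
| "perform (Push x) xs = x # xs"
| "perform Pop xs = tl xs"

fun successor :: "'q two_stack_pda \<Rightarrow> 'q configuration \<Rightarrow> 'q configuration option" where
  "successor M (q, xs, ys) =
     map_option (\<lambda>(q', a, a'). (q', perform a xs, perform a' ys))
       (transition M q (top_symbol xs) (top_symbol ys))"

definition halts :: "'q two_stack_pda \<Rightarrow> 'q configuration \<Rightarrow> bool" where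
  "halts M c \<longleftrightarrow>
     (\<exists>c'. (c, c') \<in> {(x, y). successor M x = Some y}\<^sup>* \<and> successor M c' = None)"

fun binary_fraction :: "bool list \<Rightarrow> real" where
  "binary_fraction [] = 0"
| "binary_fraction (x # xs) = (of_bool x + binary_fraction xs) / 2"

text \<open>
  A stack with symbols \<open>b1, \<dots>, bn\<close>, top first, is the binary fraction \<open>0.b1 1 b2 1 \<dots> bn 1\<close>.
  The extra digits 1 make the encoding injective; the fractions \<open>0.b1 \<dots> bn\<close> would not distinguish
  an empty stack from a stack of zeros.
\<close>

definition stack_value :: "bool list \<Rightarrow> real" where
  "stack_value xs = binary_fraction (concat (map (\<lambda>x. [x, True]) xs))"

lemma stack_value_Nil [simp]: "stack_value [] = 0"
  by (simp add: stack_value_def)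

lemma stack_value_Cons [simp]:
  "stack_value (x # xs) = (if x then 3/4 else 1/4) + stack_value xs / 4"
  by (simp add: stack_value_def field_simps)

lemma stack_value_bounds: "0 \<le> stack_value xs \<and> stack_value xs < 1"
  by (induction xs) auto

lemma stack_value_inject: "stack_value xs = stack_value ys \<longleftrightarrow> xs = ys"
proof (induction xs arbitrary: ys)
  case Nil
  show ?case
  proof (cases ys)
    case (Cons y ys')
    with stack_value_bounds[of ys'] show ?thesis by (auto split: if_splits)
  qed simp
next
  case (Cons x xs)
  show ?case
  proof (cases ys)
    case Nil
    with stack_value_bounds[of xs] show ?thesis by (auto split: if_splits)
  next
    case (Cons y ys')
    with Cons.IH[of ys'] stack_value_bounds[of xs] stack_value_bounds[of ys']
    show ?thesis by (auto split: if_splits)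
  qed
qed

text \<open>
  Every state owns a line segment, which the ball crosses with a fixed velocity.  The first stack is
  the offset of the crossing point within the segment, the second one is the offset of the crossing
  time within a time window that recurs with a common period.
\<close>

record crossing =
  base_point :: rat_point
  extent :: rat_point
  crossing_velocity :: rat_point
  base_time :: rat
  duration :: rat

definition crossing_segment :: "crossing \<Rightarrow> (real \<times> real) set" where
  "crossing_segment g =
     closed_segment (real_point (base_point g)) (real_point (base_point g) + real_point (extent g))"

definition valid_encoding :: "('q \<Rightarrow> crossing) \<Rightarrow> rat \<Rightarrow> bool" where
  "valid_encoding G T \<longleftrightarrow>
     T > 0 \<and>
     (\<forall>q. cross (real_point (extent (G q))) (real_point (crossing_velocity (G q))) \<noteq> 0 \<and>
          0 \<le> base_time (G q) \<and> 0 < duration (G q) \<and> duration (G q) \<le> T) \<and>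
     (\<forall>q q'. q \<noteq> q' \<longrightarrow> crossing_segment (G q) \<inter> crossing_segment (G q') = {})"

fun encodes :: "('q \<Rightarrow> crossing) \<Rightarrow> rat \<Rightarrow> ball \<Rightarrow> 'q configuration \<Rightarrow> bool" where
  "encodes G T b (q, xs, ys) \<longleftrightarrow>
     pos b = real_point (base_point (G q)) + stack_value xs *\<^sub>R real_point (extent (G q)) \<and>
     vel b = real_point (crossing_velocity (G q)) \<and>
     (\<exists>k::nat. time b = of_rat (base_time (G q)) + stack_value ys * of_rat (duration (G q))
                        + real k * of_rat T)"

lemma encodes_unique:
  assumes "valid_encoding G T" "encodes G T b c" "encodes G T b c'"
  shows "c = c'"
proof -
  obtain q xs ys q' xs' ys' where c: "c = (q, xs, ys)" "c' = (q', xs', ys')"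
    by (metis prod.collapse)
  have seg: "pos b \<in> crossing_segment (G r)" if "encodes G T b (r, us, vs)" for r us vs
    using that stack_value_bounds[of us]
    by (auto simp: crossing_segment_def in_segment scaleR_add_right algebra_simps
             intro!: exI[of _ "stack_value us"])
  have q: "q' = q"
    using assms seg unfolding c valid_encoding_def by blast
  have ext: "real_point (extent (G q)) \<noteq> 0"
    using assms(1) unfolding valid_encoding_def cross_def
    by (metis fst_zero mult_zero_left snd_zero diff_self)
  have "stack_value xs = stack_value xs'"
    using assms(2,3) ext by (auto simp: c q)
  then have xs: "xs = xs'"
    by (simp add: stack_value_inject)
  obtain k k' :: nat where k:
    "stack_value ys * of_rat (duration (G q)) + real k * of_rat T
     = stack_value ys' * of_rat (duration (G q)) + real k' * of_rat T"
    using assms(2,3) by (auto simp: c q)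
  define D where "D = (of_rat (duration (G q)) :: real)"
  define P where "P = (of_rat T :: real)"
  have D: "0 < D" "D \<le> P"
    using assms(1) by (auto simp: valid_encoding_def D_def P_def of_rat_less_eq)
  have eq: "(stack_value ys - stack_value ys') * D = (real k' - real k) * P"
    using k by (simp add: D_def P_def algebra_simps)
  have "\<bar>stack_value ys - stack_value ys'\<bar> < 1"
    using stack_value_bounds[of ys] stack_value_bounds[of ys'] by linarith
  then have "\<bar>stack_value ys - stack_value ys'\<bar> * D < 1 * D"
    using D(1) by (rule mult_strict_right_mono)
  moreover have "\<bar>(stack_value ys - stack_value ys') * D\<bar> = \<bar>stack_value ys - stack_value ys'\<bar> * D"
    using D by (simp add: abs_mult)
  ultimately have "\<bar>(stack_value ys - stack_value ys') * D\<bar> < P"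
    using D by linarith
  then have "\<bar>real k' - real k\<bar> * P < 1 * P"
    using D unfolding eq by (simp add: abs_mult)
  then have "\<bar>real k' - real k\<bar> < 1"
    using D by (simp add: mult_less_cancel_right)
  then have "k = k'" by linarith
  then have "stack_value ys = stack_value ys'"
    using eq D by simp
  then have "ys = ys'"
    by (simp add: stack_value_inject)
  with xs q c show ?thesis by simp
qed

text \<open>
  The components \<open>C\<close>, the target \<open>p\<close>, the encoding and the bound \<open>K\<close> on the number of reflections
  per step depend on the automaton only.  The initial stack contents determine only how the
  ball enters.
\<close>

definition simulates ::
  "component set \<Rightarrow> rat_point \<Rightarrow> ('q \<Rightarrow> crossing) \<Rightarrow> rat \<Rightarrow> nat \<Rightarrow> 'q two_stack_pda \<Rightarrow> bool" where
  "simulates C p G T K M \<longleftrightarrow>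
     valid_encoding G T \<and>
     (\<forall>b c c'. encodes G T b c \<and> successor M c = Some c' \<longrightarrow>
        (\<exists>n\<le>K. \<exists>b'. travels C n b b' \<and> encodes G T b' c')) \<and>
     (\<forall>xs ys. \<exists>I. pinball_instance I \<and> components I = C \<and> target I = p \<and>
        (\<exists>n\<le>K. \<exists>b. travels C n (entering_ball I) b \<and> encodes G T b (initial M, xs, ys)) \<and>
        (pinball_wizard I \<longleftrightarrow> halts M (initial M, xs, ys)))"

end

theory Submission
  imports Defs
begin

text \<open>
  The plane is cut into square tiles of side \<open>512\<close>. A ball of unit speed crosses a tile in exactly one
  period, so that the phase with which it enters a tile does not depend on its route, and a configuration
  is a beam with a spatial offset \<open>x\<close> and a temporal offset \<open>s\<close>. Diagonal walls turn the beam, a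
  diagonal one-way gate lets one beam join another, and a wall that covers only part of the beam reads the
  first stack. Pushing and popping scale \<open>x\<close> by \<open>1/4\<close> and \<open>4\<close>, which two confocal parabolas do without
  changing the travel time.

  With moving walls, the second stack is read by a wall that slides along its own line in and out of the
  beam. A wall of constant velocity reflects the positions that the balls of a beam would have
  at time \<open>0\<close>, whatever their new velocity is; two such walls exchange the roles of \<open>x\<close> and \<open>s\<close>, so that
  \<open>s\<close> can be scaled by parabolas, too. With bumpers, the second stack is read by an active diagonal bumper, which sends the ball back
  instead of sideways, and \<open>s\<close> is scaled by two bumpers, of which the first one gives the ball a speed
  that depends on \<open>s\<close> and the second one undoes this.

  Every state and every pair of top symbols owns a column of tiles. Balls that halt leave all tiles as
  parallel rays, and a large parabola focuses them on the target.
\<close>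

text \<open>Devices can be verified one by one because a run is recorded together with a region that
  contains its path: components that never touch this region cannot disturb it. Those of a tile keep
  distance 1 from its border at all times. The price is that each device has to delay the ball by
  whole periods, up to the intended change of the temporal offset; most focal lengths, bumper
  effects and starting times solve this single equation. A stack occupies a window of length 16 in
  time, but only of length 1 in space. The balls of one beam meet a diagonal at instants that differ
  by up to 1 even for equal \<open>s\<close>, and the gaps of length 4 between the time windows of
  different top symbols have to absorb this. If the automaton never halts, the ball must be shown
  never to reach the target. The motion is deterministic, each step costs at least one collision,
  and the target lies outside the half-plane in which the simulation takes place. So a visit after
  \<open>m\<close> collisions would contradict a simulation with more than \<open>m\<close>
  collisions.\<close>

abbreviation bal :: "real \<Rightarrow> real \<Rightarrow> real \<Rightarrow> real \<Rightarrow> real \<Rightarrow> ball" where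
  "bal t x y u v \<equiv> \<lparr>time = t, pos = (x, y), vel = (u, v)\<rparr>"

section \<open>Runs that stay inside a region\<close>

lemma fly_bal [simp]: "fly s (bal t x y u v) = bal (t + s) (x + s * u) (y + s * v) u v"
  by (simp add: fly_def)

lemma fly_0 [simp]: "fly 0 b = b"
  by (simp add: fly_def)

lemma fly_fly [simp]: "fly r (fly s b) = fly (s + r) b"
  by (simp add: fly_def algebra_simps)

text \<open>\<open>travels\<close> forgets the path, but both locality and the exclusion of the
  target need it; hence the region \<open>A\<close>, in which every intermediate position must
  lie.\<close>

inductive run :: "component set \<Rightarrow> (real \<times> real) set \<Rightarrow> nat \<Rightarrow> ball \<Rightarrow> ball \<Rightarrow> bool" for C A where
  stop: "run C A 0 b b" if "pos b \<in> A"
| flight: "run C A 0 b (fly s b)"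
    if "s > 0" "undisturbed C b s" "\<forall>c\<in>C. \<not> collides c (fly s b)" "\<forall>r\<in>{0..s}. pos (fly r b) \<in> A"
| hit: "run C A (Suc n) b b''"
    if "s > 0" "undisturbed C b s" "{k \<in> C. collides k (fly s b)} = {c}"
      "\<forall>r\<in>{0..s}. pos (fly r b) \<in> A"
      "run C A n ((fly s b)\<lparr>vel := rebound c (fly s b)\<rparr>) b''"

lemma undisturbed_join:
  assumes "undisturbed C b s" "\<forall>c\<in>C. \<not> collides c (fly s b)" "undisturbed C (fly s b) s'"
  shows "undisturbed C b (s + s')"
  unfolding undisturbed_def
proof (intro ballI)
  fix r c assume r: "r \<in> {0<..<s + s'}" and c: "c \<in> C"
  consider "r < s" | "r = s" | "r > s" by linarith
  then show "\<not> collides c (fly r b)"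
  proof cases
    case 1 then show ?thesis using assms(1) r c by (auto simp: undisturbed_def)
  next
    case 2 then show ?thesis using assms(2) c by auto
  next
    case 3
    then have "\<not> collides c (fly (r - s) (fly s b))"
      using assms(3) r c unfolding undisturbed_def
      by (metis add.commute add_less_cancel_left diff_add_cancel diff_gt_0_iff_gt greaterThanLessThan_iff)
    then show ?thesis by simp
  qed
qed

lemma within_join:
  assumes "\<forall>r\<in>{0..s}. pos (fly r b) \<in> A" "\<forall>r\<in>{0..s'}. pos (fly r (fly s b)) \<in> A"
  shows "\<forall>r\<in>{0..s + s'}. pos (fly r b) \<in> A"
proof
  fix r assume r: "r \<in> {0..s + s'}"
  show "pos (fly r b) \<in> A"
  proof (cases "r \<le> s")
    case True then show ?thesis using assms(1) r by auto
  next
    case False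
    then have "r - s \<in> {0..s'}" using r by auto
    then have "pos (fly (r - s) (fly s b)) \<in> A" using assms(2) by blast
    then show ?thesis by simp
  qed
qed

text \<open>A flight can only be the last piece of a run. A flight in front therefore has to be
  merged with the first piece of the rest, which is possible because it ends free of
  contacts.\<close>

lemma run_fly_prefix:
  assumes "run C A n (fly s b) b''" "s > 0" "undisturbed C b s"
    "\<forall>c\<in>C. \<not> collides c (fly s b)" "\<forall>r\<in>{0..s}. pos (fly r b) \<in> A"
  shows "run C A n b b''"
  using assms(1)
proof (cases rule: run.cases)
  case stop
  then show ?thesis using run.flight[OF assms(2-5)] by simp
next
  case (flight s')
  have "run C A 0 b (fly (s + s') b)"
    by (rule run.flight)
       (use flight assms undisturbed_join[OF assms(3,4)] within_join[OF assms(5)] in auto)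
  then show ?thesis using flight by simp
next
  case (hit s' c m)
  then show ?thesis
    using run.hit[of "s + s'" C b c A m b''] assms undisturbed_join[OF assms(3,4)]
      within_join[OF assms(5)] by simp
qed

lemma run_trans:
  assumes "run C A m b b'" "run C A n b' b''"
  shows "run C A (m + n) b b''"
  using assms
proof (induction rule: run.induct)
  case (stop b) then show ?case by simp
next
  case (flight s b) then show ?case using run_fly_prefix[of C A n s b b''] by simp
next
  case (hit s b c n b')
  then show ?case using run.hit[of s C b c A "n + _" b''] by simp
qed

lemma run_imp_travels: "run C A n b b' \<Longrightarrow> travels C n b b'"
proof (induction rule: run.induct)
  case (stop b) then show ?case by (simp add: travels.start)
next
  case (flight s b) then show ?case by (simp add: travels.flight)
next
  case (hit s b c n b'')
  then have "next_collision C b ((fly s b)\<lparr>vel := rebound c (fly s b)\<rparr>)"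
    unfolding next_collision_def by blast
  then show ?case using hit by (blast intro: travels.collision)
qed

lemma run_mono: "run C A n b b' \<Longrightarrow> A \<subseteq> A' \<Longrightarrow> run C A' n b b'"
proof (induction rule: run.induct)
  case (stop b) then show ?case by (auto intro: run.stop)
next
  case (flight s b) then show ?case by (intro run.flight) auto
next
  case (hit s b c n b'') then show ?case by (intro run.hit) auto
qed

text \<open>The quantifier over all balls covers all times and velocities, so that a moving wall
  avoids \<open>A\<close> only if it does so in each of its positions.\<close>

definition avoids :: "component \<Rightarrow> (real \<times> real) set \<Rightarrow> bool" where
  "avoids c A \<longleftrightarrow> (\<forall>b. collides c b \<longrightarrow> pos b \<notin> A)"

text \<open>Locality: components without contact points in \<open>A\<close> change neither
  \<open>undisturbed\<close> nor the set of components that are struck.\<close>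

lemma run_local:
  assumes "run C A n b b'" "C \<subseteq> C'" "\<And>c. c \<in> C' - C \<Longrightarrow> avoids c A"
  shows "run C' A n b b'"
  using assms
proof (induction rule: run.induct)
  case (stop b) then show ?case by (auto intro: run.stop)
next
  case (flight s b)
  have *: "\<not> collides c (fly r b)" if "c \<in> C'" "c \<notin> C" "r \<in> {0..s}" for c r
    using flight that unfolding avoids_def by blast
  show ?case
    by (rule run.flight)
       (use flight * in \<open>auto simp: undisturbed_def less_imp_le dest: \<close>,
        (metis atLeastAtMost_iff greaterThanLessThan_iff less_imp_le order.refl)+)
next
  case (hit s b c n b'')
  have *: "\<not> collides c (fly r b)" if "c \<in> C'" "c \<notin> C" "r \<in> {0..s}" for c r
    using hit that unfolding avoids_def by blast
  have "undisturbed C' b s"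
    using hit(2) * unfolding undisturbed_def
    by (metis atLeastAtMost_iff greaterThanLessThan_iff less_imp_le)
  moreover have "{k \<in> C'. collides k (fly s b)} = {k \<in> C. collides k (fly s b)}"
    using *[of _ s] hit(1) hit.prems(1) by auto
  ultimately show ?case using hit by (intro run.hit) auto
qed

lemma run_local_mono:
  assumes "run C A n b b'" "C \<subseteq> C'" "\<And>c. c \<in> C' - C \<Longrightarrow> avoids c A" "A \<subseteq> A'"
  shows "run C' A' n b b'"
  using run_mono[OF run_local[OF assms(1-3)] assms(4)] by blast

lemma convex_path:
  assumes "convex A" "(x, y) \<in> A" "(x + s * u, y + s * v) \<in> A" "0 \<le> s"
  shows "\<forall>r\<in>{0..s}. pos (fly r (bal t x y u v)) \<in> A"
proof
  fix r assume r: "r \<in> {0..s}"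
  show "pos (fly r (bal t x y u v)) \<in> A"
  proof (cases "s = 0")
    case True then show ?thesis using assms r by simp
  next
    case False
    then have "s > 0" using assms by simp
    then have "(1 - r/s) *\<^sub>R (x, y) + (r/s) *\<^sub>R (x + s * u, y + s * v) \<in> A"
      using assms r by (intro convexD) auto
    moreover have "(1 - r/s) *\<^sub>R (x, y) + (r/s) *\<^sub>R (x + s * u, y + s * v) = (x + r * u, y + r * v)"
      using \<open>s > 0\<close> by (simp add: field_simps)
    ultimately show ?thesis by simp
  qed
qed

lemma run_flyI:
  assumes "0 < s" "convex A" "(x, y) \<in> A" "(x', y') \<in> A"
    "x' = x + s * u" "y' = y + s * v" "t' = t + s"
    "\<And>k r. k \<in> C \<Longrightarrow> 0 < r \<Longrightarrow> r \<le> s \<Longrightarrow> \<not> collides k (bal (t + r) (x + r * u) (y + r * v) u v)"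
  shows "run C A 0 (bal t x y u v) (bal t' x' y' u v)"
  using run.flight[of s C "bal t x y u v" A] convex_path[of A x y s u v t] assms
  by (auto simp: undisturbed_def)

text \<open>The struck component is excluded only before the impact, every other one also at the
  impact, because the motion is undefined after a simultaneous hit.\<close>

lemma run_hitI:
  assumes "c \<in> C" "0 < s" "convex A" "(x, y) \<in> A" "(x', y') \<in> A"
    "x' = x + s * u" "y' = y + s * v" "t' = t + s"
    "collides c (bal t' x' y' u v)"
    "rebound c (bal t' x' y' u v) = (u', v')"
    "\<And>r. 0 < r \<Longrightarrow> r < s \<Longrightarrow> \<not> collides c (bal (t + r) (x + r * u) (y + r * v) u v)"
    "\<And>k r. k \<in> C \<Longrightarrow> k \<noteq> c \<Longrightarrow> 0 < r \<Longrightarrow> r \<le> s \<Longrightarrow> \<not> collides k (bal (t + r) (x + r * u) (y + r * v) u v)"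
  shows "run C A 1 (bal t x y u v) (bal t' x' y' u' v')"
proof -
  have "undisturbed C (bal t x y u v) s"
    unfolding undisturbed_def fly_bal using assms(11,12)
    by (metis greaterThanLessThan_iff less_imp_le)
  moreover have "{k \<in> C. collides k (fly s (bal t x y u v))} = {c}"
    using assms by auto
  moreover have "run C A 0 (bal t' x' y' u' v') (bal t' x' y' u' v')"
    using assms by (intro run.stop) auto
  ultimately have "run C A (Suc 0) (bal t x y u v) (bal t' x' y' u' v')"
    using assms convex_path[of A x y s u v t]
    by (intro run.hit[where s = s and c = c]) auto
  then show ?thesis by simp
qed

subsection \<open>Components in coordinates\<close>

definition rect :: "real \<Rightarrow> real \<Rightarrow> real \<Rightarrow> real \<Rightarrow> (real \<times> real) set" where
  "rect x0 x1 y0 y1 = {x0..x1} \<times> {y0..y1}"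

lemma in_rect [simp]: "(x, y) \<in> rect x0 x1 y0 y1 \<longleftrightarrow> x0 \<le> x \<and> x \<le> x1 \<and> y0 \<le> y \<and> y \<le> y1"
  by (auto simp: rect_def)

lemma convex_rect [simp]: "convex (rect x0 x1 y0 y1)"
  by (simp add: rect_def convex_Times)

lemma rect_mono: "x0' \<le> x0 \<Longrightarrow> x1 \<le> x1' \<Longrightarrow> y0' \<le> y0 \<Longrightarrow> y1 \<le> y1' \<Longrightarrow> rect x0 x1 y0 y1 \<subseteq> rect x0' x1' y0' y1'"
  by (auto simp: rect_def)

lemma closed_segment_iff:
  fixes x :: real
  assumes "x0 < x1"
  shows "(x, y) \<in> closed_segment (x0, y0) (x1, y1) \<longleftrightarrow>
    x0 \<le> x \<and> x \<le> x1 \<and> y - y0 = (y1 - y0) / (x1 - x0) * (x - x0)" (is "?L \<longleftrightarrow> ?R")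
proof
  assume ?L
  then obtain u where u: "0 \<le> u" "u \<le> 1" "x = (1 - u) * x0 + u * x1" "y = (1 - u) * y0 + u * y1"
    by (auto simp: in_segment)
  have d: "x - x0 = u * (x1 - x0)" "y - y0 = u * (y1 - y0)" "x1 - x = (1 - u) * (x1 - x0)"
    using u by (simp_all add: algebra_simps)
  have "x0 \<le> x" "x \<le> x1"
    using d u assms mult_nonneg_nonneg[of u "x1 - x0"] mult_nonneg_nonneg[of "1 - u" "x1 - x0"]
    by linarith+
  moreover have "(y1 - y0) / (x1 - x0) * (x - x0) = u * (y1 - y0)"
    using assms by (simp add: d(1))
  ultimately show ?R using d(2) by simp
next
  assume R: ?R
  define u where "u = (x - x0) / (x1 - x0)"
  have "0 \<le> u" "u \<le> 1" using R assms by (simp_all add: u_def)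
  moreover have "u * (x1 - x0) = x - x0" using assms by (simp add: u_def)
  moreover have "u * (y1 - y0) = y - y0" using R by (simp add: u_def mult.commute)
  ultimately show ?L
    by (auto simp: in_segment algebra_simps intro!: exI[of _ u])
qed

lemma vertical_segment_iff:
  fixes x y :: real
  assumes "y0 < y1"
  shows "(x, y) \<in> closed_segment (x0, y0) (x0, y1) \<longleftrightarrow> x = x0 \<and> y0 \<le> y \<and> y \<le> y1"
proof -
  have "(x, y) \<in> closed_segment (x0, y0) (x0, y1) \<longleftrightarrow> (y, x) \<in> closed_segment (y0, x0) (y1, x0)"
    by (auto simp: in_segment)
  then show ?thesis using closed_segment_iff[OF assms, of y x x0 x0] by auto
qed

lemma real_point_Pair [simp]: "real_point (a, b) = (of_rat a, of_rat b)"
  by (simp add: real_point_def)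

definition pt_slash :: "rat \<Rightarrow> rat \<Rightarrow> rat \<Rightarrow> rat_point" where
  "pt_slash a b l = (a + l, b + l)"
definition pt_bslash :: "rat \<Rightarrow> rat \<Rightarrow> rat \<Rightarrow> rat_point" where
  "pt_bslash a b l = (a + l, b - l)"

lemma segment_slash:
  "l < r \<Longrightarrow> (x, y) \<in> segment (pt_slash a b l) (pt_slash a b r) \<longleftrightarrow>
     of_rat l \<le> x - of_rat a \<and> x - of_rat a \<le> of_rat r \<and> y - of_rat b = x - of_rat a"
  unfolding segment_def pt_slash_def real_point_Pair
  by (subst closed_segment_iff) (auto simp: of_rat_add of_rat_less)

lemma segment_bslash:
  "l < r \<Longrightarrow> (x, y) \<in> segment (pt_bslash a b l) (pt_bslash a b r) \<longleftrightarrow>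
     of_rat l \<le> x - of_rat a \<and> x - of_rat a \<le> of_rat r \<and> y - of_rat b = - (x - of_rat a)"
proof -
  assume "l < r"
  define d where "d = (of_rat r - of_rat l :: real)"
  have d: "d > 0" using \<open>l < r\<close> by (simp add: d_def of_rat_less)
  have "(of_rat b - of_rat r - (of_rat b - of_rat l)) / (of_rat a + of_rat r - (of_rat a + of_rat l)) = - d / d"
    by (simp add: d_def)
  then have e: "(of_rat b - of_rat r - (of_rat b - of_rat l)) / (of_rat a + of_rat r - (of_rat a + of_rat l)) = (-1::real)"
    using d by simp
  show ?thesis
    unfolding segment_def pt_bslash_def real_point_Pair of_rat_add of_rat_diff
    using \<open>l < r\<close> by (subst closed_segment_iff, simp add: of_rat_less, unfold e) auto
qed

lemma segment_commute: "segment P Q = segment Q P"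
  by (simp add: segment_def closed_segment_commute)

lemma segment_hor:
  "l < r \<Longrightarrow> (x, y) \<in> segment (l, b) (r, b) \<longleftrightarrow> of_rat l \<le> x \<and> x \<le> of_rat r \<and> y = of_rat b"
  unfolding segment_def real_point_Pair
  by (subst closed_segment_iff) (auto simp: of_rat_less)

lemma segment_ver:
  "l < r \<Longrightarrow> (x, y) \<in> segment (a, l) (a, r) \<longleftrightarrow> of_rat l \<le> y \<and> y \<le> of_rat r \<and> x = of_rat a"
  unfolding segment_def real_point_Pair
  by (subst vertical_segment_iff) (auto simp: of_rat_less)

lemma reflect_Pair:
  "reflect (a, b) (u, v) =
     (u - 2 * (u * a + v * b) / (a * a + b * b) * a, v - 2 * (u * a + v * b) / (a * a + b * b) * b)"
  by (simp add: reflect_def inner_Pair)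

lemma reflect_slash: "l \<noteq> r \<Longrightarrow> reflect (segment_normal (pt_slash a b l) (pt_slash a b r)) (u, v) = (v, u)"
proof -
  assume "l \<noteq> r"
  define d where "d = (of_rat r - of_rat l :: real)"
  have "d \<noteq> 0" using \<open>l \<noteq> r\<close> by (simp add: d_def)
  moreover have "segment_normal (pt_slash a b l) (pt_slash a b r) = (- d, d)"
    by (simp add: segment_normal_def pt_slash_def of_rat_add d_def)
  ultimately show ?thesis by (simp add: reflect_Pair field_simps)
qed

lemma reflect_bslash: "l \<noteq> r \<Longrightarrow> reflect (segment_normal (pt_bslash a b l) (pt_bslash a b r)) (u, v) = (- v, - u)"
proof -
  assume "l \<noteq> r"
  define d where "d = (of_rat r - of_rat l :: real)"
  have "d \<noteq> 0" using \<open>l \<noteq> r\<close> by (simp add: d_def)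
  moreover have "segment_normal (pt_bslash a b l) (pt_bslash a b r) = (d, d)"
    by (simp add: segment_normal_def pt_bslash_def of_rat_add of_rat_diff d_def)
  ultimately show ?thesis by (simp add: reflect_Pair field_simps)
qed

lemma reflect_vertical: "l \<noteq> r \<Longrightarrow> reflect (segment_normal (a, l) (a, r)) (u, v) = (- u, v)"
proof -
  assume "l \<noteq> r"
  define d where "d = (of_rat r - of_rat l :: real)"
  have "d \<noteq> 0" using \<open>l \<noteq> r\<close> by (simp add: d_def)
  moreover have "segment_normal (a, l) (a, r) = (- d, 0)"
    by (simp add: segment_normal_def d_def)
  ultimately show ?thesis by (simp add: reflect_Pair field_simps)
qed

lemma pt_slash_eq [simp]: "pt_slash a b l = pt_slash a b r \<longleftrightarrow> l = r"
  by (simp add: pt_slash_def)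
lemma pt_bslash_eq [simp]: "pt_bslash a b l = pt_bslash a b r \<longleftrightarrow> l = r"
  by (simp add: pt_bslash_def)

lemma cross_slash: "cross (real_point (pt_slash a b r) - real_point (pt_slash a b l)) (u, v) =
   (of_rat r - of_rat l) * (v - u)"
  by (simp add: cross_def pt_slash_def of_rat_add algebra_simps)

lemma cross_bslash: "cross (real_point (pt_bslash a b r) - real_point (pt_bslash a b l)) (u, v) =
   (of_rat r - of_rat l) * (v + u)"
  by (simp add: cross_def pt_bslash_def of_rat_add of_rat_diff algebra_simps)

definition slash :: "rat \<Rightarrow> rat \<Rightarrow> rat \<Rightarrow> rat \<Rightarrow> component" where
  "slash a b l r = Wall (pt_slash a b l) (pt_slash a b r)"
definition bslash :: "rat \<Rightarrow> rat \<Rightarrow> rat \<Rightarrow> rat \<Rightarrow> component" where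
  "bslash a b l r = Wall (pt_bslash a b l) (pt_bslash a b r)"

lemma collides_slash: "l < r \<Longrightarrow> collides (slash a b l r) (bal t x y u v) \<longleftrightarrow>
     of_rat l \<le> x - of_rat a \<and> x - of_rat a \<le> of_rat r \<and> y - of_rat b = x - of_rat a"
  by (simp add: slash_def segment_slash)
lemma collides_bslash: "l < r \<Longrightarrow> collides (bslash a b l r) (bal t x y u v) \<longleftrightarrow>
     of_rat l \<le> x - of_rat a \<and> x - of_rat a \<le> of_rat r \<and> y - of_rat b = - (x - of_rat a)"
  by (simp add: bslash_def segment_bslash)
lemma rebound_slash: "l < r \<Longrightarrow> rebound (slash a b l r) (bal t x y u v) = (v, u)"
  by (simp add: slash_def reflect_slash)
lemma rebound_bslash: "l < r \<Longrightarrow> rebound (bslash a b l r) (bal t x y u v) = (- v, - u)"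
  by (simp add: bslash_def reflect_bslash)

text \<open>The parabolic wall with axis \<open>x = \<alpha>\<close>, focus at height \<open>\<phi>\<close> and focal length \<open>f\<close>, opening
  downwards for \<open>\<sigma> = 1\<close> and upwards for \<open>\<sigma> = -1\<close>.\<close>

definition parab :: "rat \<Rightarrow> rat \<Rightarrow> rat \<Rightarrow> rat \<Rightarrow> rat \<Rightarrow> rat \<Rightarrow> component" where
  "parab \<alpha> \<phi> \<sigma> f lo hi =
     Parabolic_Wall (- \<sigma> / (4 * f)) (\<sigma> * \<alpha> / (2 * f)) (\<phi> + \<sigma> * f - \<sigma> * \<alpha>\<^sup>2 / (4 * f)) (\<alpha> + lo) (\<alpha> + hi)"

lemma collides_parab: "f \<noteq> 0 \<Longrightarrow> collides (parab \<alpha> \<phi> \<sigma> f lo hi) (bal t x y u v) \<longleftrightarrow>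
     of_rat lo \<le> x - of_rat \<alpha> \<and> x - of_rat \<alpha> \<le> of_rat hi \<and>
     y - of_rat \<phi> = of_rat \<sigma> * (of_rat f - (x - of_rat \<alpha>)\<^sup>2 / (4 * of_rat f))"
proof -
  assume "f \<noteq> 0"
  then have "of_rat (- \<sigma> / (4 * f)) * x\<^sup>2 + of_rat (\<sigma> * \<alpha> / (2 * f)) * x
      + of_rat (\<phi> + \<sigma> * f - \<sigma> * \<alpha>\<^sup>2 / (4 * f))
    = of_rat \<phi> + of_rat \<sigma> * (of_rat f - (x - of_rat \<alpha>)\<^sup>2 / (4 * of_rat f))"
    by (simp add: of_rat_add of_rat_mult of_rat_divide of_rat_minus of_rat_diff power2_eq_square divide_simps)
       (simp add: algebra_simps)
  then show ?thesis
    unfolding parab_def by (auto simp: of_rat_add)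
qed

lemma rebound_parab: "f \<noteq> 0 \<Longrightarrow> rebound (parab \<alpha> \<phi> \<sigma> f lo hi) (bal t x y u v) =
     reflect (of_rat \<sigma> * (x - of_rat \<alpha>) / (2 * of_rat f), 1) (u, v)"
proof -
  assume "f \<noteq> 0"
  then have "- (2 * of_rat (- \<sigma> / (4 * f)) * x + of_rat (\<sigma> * \<alpha> / (2 * f)))
     = of_rat \<sigma> * (x - of_rat \<alpha>) / (2 * of_rat f :: real)"
    by (simp add: of_rat_mult of_rat_divide of_rat_minus field_simps)
  then show ?thesis by (simp add: parab_def)
qed

definition ramp :: rat_fun where "ramp = ([:0, 1:], [:1:])"

lemma eval_ramp [simp]: "rat_fun_eval ramp = (\<lambda>t. t)"
  by (auto simp: rat_fun_eval_def ramp_def map_poly_pCons)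

subsection \<open>Scaling by a pair of confocal parabolas\<close>

text \<open>Relative to the focus, the point of impact is \<open>(u, \<sigma> * V)\<close>, at
  distance \<open>W\<close> since \<open>u\<^sup>2 + V\<^sup>2 = W\<^sup>2\<close>. The new velocity
  is a multiple of this vector: axial rays are reflected along lines through the focus.\<close>

lemma rebound_parab_axial:
  assumes f: "0 < f" and sg: "\<sigma> = 1 \<or> \<sigma> = -1"
    and W: "W = of_rat f + u\<^sup>2 / (4 * of_rat f)" and V: "V = of_rat f - u\<^sup>2 / (4 * of_rat f)"
  shows "rebound (parab \<alpha> \<phi> \<sigma> f lo hi) (bal t (of_rat \<alpha> + u) y 0 e) =
    (- e * of_rat \<sigma> * u / W, - e * V / W)"
proof -
  define F where "F = (of_rat f :: real)"
  define S where "S = (of_rat \<sigma> :: real)"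
  have F: "F > 0" using f by (simp add: F_def)
  have S: "S * S = 1" using sg by (auto simp: S_def of_rat_minus)
  have WF: "W = F + u\<^sup>2 / (4 * F)" "V = 2 * F - W" by (simp_all add: W V F_def)
  have W0: "W > 0" using F by (simp add: WF(1) add_pos_nonneg)
  have n: "(S * u / (2 * F)) * (S * u / (2 * F)) + 1 * 1 = W / F"
    using F S by (simp add: WF(1) field_simps power2_eq_square)
  have "rebound (parab \<alpha> \<phi> \<sigma> f lo hi) (bal t (of_rat \<alpha> + u) y 0 e) = reflect (S * u / (2 * F), 1) (0, e)"
    using f by (subst rebound_parab) (auto simp: S_def F_def)
  also have "\<dots> = (- (2 * e * F / W) * (S * u / (2 * F)), e - 2 * e * F / W)"
    unfolding reflect_Pair n using W0 F by simp
  also have "\<dots> = (- e * S * u / W, - e * V / W)"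
    unfolding WF(2) using F W0 by (simp add: field_simps)
  finally show ?thesis by (simp add: S_def)
qed

text \<open>The second parabola is the image of the first one under the homothety with the focus as
  centre and ratio \<open>sc\<close>. A line through the focus meets both at corresponding points
  with parallel tangents, so the second reflection restores the axial direction, while the distance
  from the axis is multiplied by \<open>sc\<close>. For \<open>e * \<sigma> = 1\<close> the first
  reflection leads towards the focus and the second arc must be the smaller one, otherwise it leads
  away and the second arc must be larger. Disjoint projections keep the axial legs off the wrong
  arc.\<close>

lemma confocal_run:
  fixes \<alpha> \<phi> \<sigma> f sc lo hi :: rat and t u y y' e :: real
  assumes f: "0 < f" and l: "0 < sc" and sg: "\<sigma> = 1 \<or> \<sigma> = -1" and e: "e = 1 \<or> e = -1"
    and K: "0 < e * of_rat \<sigma> * (1 - of_rat sc)"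
    and u: "of_rat lo \<le> u" "u \<le> of_rat hi" and disj: "sc * hi < lo \<or> hi < sc * lo"
    and y1: "y1 = of_rat \<phi> + of_rat \<sigma> * (of_rat f - u\<^sup>2 / (4 * of_rat f))"
    and y2: "y2 = of_rat \<phi> + of_rat \<sigma> * of_rat sc * (of_rat f - u\<^sup>2 / (4 * of_rat f))"
    and y: "0 < e * (y1 - y)" "0 < e * (y' - y2)"
    and R: "convex R" "(of_rat \<alpha> + u, y) \<in> R" "(of_rat \<alpha> + u, y1) \<in> R"
      "(of_rat \<alpha> + of_rat sc * u, y2) \<in> R" "(of_rat \<alpha> + of_rat sc * u, y') \<in> R"
  shows "run {parab \<alpha> \<phi> \<sigma> f lo hi, parab \<alpha> \<phi> \<sigma> (sc * f) (sc * lo) (sc * hi)} R 2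
    (bal t (of_rat \<alpha> + u) y 0 e)
    (bal (t + e * (y' - y) + 2 * of_rat f * (e * of_rat \<sigma> * (1 - of_rat sc)))
       (of_rat \<alpha> + of_rat sc * u) y' 0 e)"
proof -
  define F where "F = (of_rat f :: real)"
  define L where "L = (of_rat sc :: real)"
  define a where "a = (of_rat \<alpha> :: real)"
  define P where "P = (of_rat \<phi> :: real)"
  define S where "S = (of_rat \<sigma> :: real)"
  define W where "W = F + u\<^sup>2 / (4 * F)"
  define V where "V = F - u\<^sup>2 / (4 * F)"
  define k where "k = e * S * (1 - L)"
  let ?P1 = "parab \<alpha> \<phi> \<sigma> f lo hi" and ?P2 = "parab \<alpha> \<phi> \<sigma> (sc * f) (sc * lo) (sc * hi)"
  let ?C = "{?P1, ?P2}"
  have F: "F > 0" using f by (simp add: F_def)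
  have L: "L > 0" using l by (simp add: L_def)
  have S: "S = 1 \<or> S = -1" using sg by (auto simp: S_def of_rat_minus)
  have SS: "S * S = 1" "e * e = 1" using S e by auto
  have W: "W > 0" using F by (simp add: W_def add_pos_nonneg)
  have k: "k > 0" using K by (simp add: k_def S_def L_def)
  have lo: "of_rat lo \<le> u" "u \<le> of_rat hi" by fact+
  have disj': "L * of_rat hi < of_rat lo \<or> of_rat hi < L * of_rat lo"
    using disj unfolding L_def by (metis of_rat_less of_rat_mult)
  have y1': "y1 = P + S * V" and y2': "y2 = P + S * L * V"
    by (simp_all add: y1 y2 P_def S_def L_def V_def F_def)
  have c1: "collides ?P1 (bal t x y u' v') \<longleftrightarrow>
     of_rat lo \<le> x - a \<and> x - a \<le> of_rat hi \<and> y - P = S * (F - (x - a)\<^sup>2 / (4 * F))" for t x y u' v'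
    using f by (subst collides_parab) (auto simp: a_def P_def S_def F_def)
  have c2: "collides ?P2 (bal t x y u' v') \<longleftrightarrow>
     L * of_rat lo \<le> x - a \<and> x - a \<le> L * of_rat hi \<and> y - P = S * (L * F - (x - a)\<^sup>2 / (4 * (L * F)))" for t x y u' v'
    using f l by (subst collides_parab) (auto simp: a_def P_def S_def F_def L_def of_rat_mult)
  have no12: "\<not> (L * of_rat lo \<le> u \<and> u \<le> L * of_rat hi)"
    using lo disj' by linarith
  have no21: "\<not> (of_rat lo \<le> L * u \<and> L * u \<le> of_rat hi)"
    using mult_left_mono[OF lo(1), of L] mult_left_mono[OF lo(2), of L] disj' L by linarith
  have r1: "rebound ?P1 (bal t (a + u) y1 0 e) = (- e * S * u / W, - e * V / W)" for t
    unfolding a_def S_def by (rule rebound_parab_axial[OF f sg]) (simp_all add: W_def V_def F_def)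
  have r2: "rebound ?P2 (bal t (a + L * u) y2 (- e * S * u / W) (- e * V / W)) = (0, e)" for t
  proof -
    have n: "(S * u / (2 * F)) * (S * u / (2 * F)) + 1 * 1 = W / F"
      using F SS by (simp add: W_def field_simps power2_eq_square)
    have vn: "(- e * S * u / W) * (S * u / (2 * F)) + (- e * V / W) * 1 = - e"
    proof -
      have "u\<^sup>2 / (2 * F) + V = W" using F by (simp add: W_def V_def field_simps)
      moreover have "(- e * S * u / W) * (S * u / (2 * F)) + (- e * V / W) * 1
         = - e * (S * S * u\<^sup>2 / (2 * F) + V) / W"
        using W F by (simp add: field_simps power2_eq_square)
      ultimately show ?thesis using W SS by simp
    qed
    have WF: "2 * - e / (W / F) = - 2 * e * F / W" by simp
    have "rebound ?P2 (bal t (a + L * u) y2 (- e * S * u / W) (- e * V / W))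
       = reflect (S * u / (2 * F), 1) (- e * S * u / W, - e * V / W)"
      using f l L by (subst rebound_parab) (auto simp: a_def S_def F_def L_def of_rat_mult)
    also have "\<dots> = (- e * S * u / W - - 2 * e * F / W * (S * u / (2 * F)), - e * V / W - - 2 * e * F / W * 1)"
      unfolding reflect_Pair n vn WF ..
    also have "\<dots> = (0, e)"
    proof -
      have V: "V = 2 * F - W" by (simp add: W_def V_def)
      show ?thesis unfolding V using F W by (simp add: field_simps)
    qed
    finally show ?thesis .
  qed
  have leg1: "run ?C R 1 (bal t (a + u) y 0 e)
      (bal (t + e * (y1 - y)) (a + u) y1 (- e * S * u / W) (- e * V / W))"
  proof (rule run_hitI[where c = ?P1 and s = "e * (y1 - y)"])
    show "y1 = y + e * (y1 - y) * e" using e by auto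
    show "collides ?P1 (bal (t + e * (y1 - y)) (a + u) y1 0 e)"
      using lo unfolding c1 by (simp add: y1' V_def)
    show "rebound ?P1 (bal (t + e * (y1 - y)) (a + u) y1 0 e) = (- e * S * u / W, - e * V / W)"
      by (rule r1)
    show "\<not> collides ?P1 (bal (t + r) (a + u + r * 0) (y + r * e) 0 e)"
      if "0 < r" "r < e * (y1 - y)" for r
    proof -
      have "y + r * e \<noteq> y1" using that e by auto
      then show ?thesis unfolding c1 by (auto simp: y1' V_def)
    qed
    show "\<not> collides c (bal (t + r) (a + u + r * 0) (y + r * e) 0 e)"
      if "c \<in> ?C" "c \<noteq> ?P1" for c r
      using that no12 by (auto simp: c2)
  qed (use y R in \<open>auto simp: a_def\<close>)
  have leg2: "run ?C R 1 (bal (t + e * (y1 - y)) (a + u) y1 (- e * S * u / W) (- e * V / W))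
      (bal (t + e * (y1 - y) + k * W) (a + L * u) y2 0 e)"
  proof (rule run_hitI[where c = ?P2 and s = "k * W"])
    \<comment> \<open>On the middle leg the ball is at the focus plus \<open>m\<close> times
      \<open>(u, S * V)\<close>, where \<open>m\<close> runs from 1 to \<open>L\<close>.\<close>
    have key: "a + u + r * (- e * S * u / W) = a + (1 - e * S * (r / W)) * u"
      "y1 + r * (- e * V / W) = P + S * ((1 - e * S * (r / W)) * V)" for r
    proof -
      have "S * (e * S * (r / W) * V) = (S * S) * (e * (r / W) * V)" by (simp only: ac_simps)
      then show "y1 + r * (- e * V / W) = P + S * ((1 - e * S * (r / W)) * V)"
        by (simp add: y1' SS algebra_simps)
    qed (simp add: algebra_simps)
    have kk: "e * S * k = 1 - L"
    proof -
      have "e * S * k = (e * e) * (S * S) * (1 - L)" unfolding k_def by (simp only: ac_simps)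
      then show ?thesis by (simp add: SS)
    qed
    have mu: "1 - e * S * (k * W / W) = L" using W kk by simp
    show "a + L * u = a + u + k * W * (- e * S * u / W)" "y2 = y1 + k * W * (- e * V / W)"
      unfolding key mu by (simp_all add: y2')
    have pos2: "collides ?P2 (bal t' (a + L * u) y2 u' v')" for t' u' v'
    proof -
      have "(L * u)\<^sup>2 / (4 * (L * F)) = L * (u\<^sup>2 / (4 * F))"
        using L F by (simp add: field_simps power2_eq_square)
      then show ?thesis
        unfolding c2 using lo L
        by (simp add: y2' V_def mult_left_mono) (simp add: algebra_simps)
    qed
    then show "collides ?P2 (bal (t + e * (y1 - y) + k * W) (a + L * u) y2 (- e * S * u / W) (- e * V / W))" .
    show "rebound ?P2 (bal (t + e * (y1 - y) + k * W) (a + L * u) y2 (- e * S * u / W) (- e * V / W)) = (0, e)"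
      by (rule r2)
    have mur: "0 < 1 - e * S * (r / W) \<and> 1 - e * S * (r / W) \<noteq> 1 \<and>
        (r < k * W \<longrightarrow> 1 - e * S * (r / W) \<noteq> L)" if r: "0 < r" "r \<le> k * W" for r
    proof -
      have q: "0 < r / W" "r / W \<le> k" "r < k * W \<longrightarrow> r / W < k" using r W by (simp_all add: field_simps)
      show ?thesis
      proof (cases "e * S = 1")
        case True
        then show ?thesis using q kk L by auto
      next
        case False
        then have "e * S = -1" using S e by auto
        then show ?thesis using q kk L by auto
      qed
    qed
    show "\<not> collides ?P2 (bal (t + e * (y1 - y) + r) (a + u + r * (- e * S * u / W)) (y1 + r * (- e * V / W))
        (- e * S * u / W) (- e * V / W))" if r: "0 < r" "r < k * W" for r
    proof
      define m where "m = 1 - e * S * (r / W)"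
      have m: "m > 0" "m \<noteq> L" using mur[of r] r by (auto simp: m_def)
      assume "collides ?P2 (bal (t + e * (y1 - y) + r) (a + u + r * (- e * S * u / W)) (y1 + r * (- e * V / W))
        (- e * S * u / W) (- e * V / W))"
      then have "S * (m * V) = S * (L * F - (m * u)\<^sup>2 / (4 * (L * F)))"
        unfolding c2 key m_def[symmetric] by simp
      then have "m * V = L * F - (m * u)\<^sup>2 / (4 * (L * F))" using S by auto
      \<comment> \<open>Along the ray the equation of the parabola factors, and the second factor is
        positive for \<open>m > 0\<close>; so \<open>m = L\<close> is the only contact.\<close>
      moreover have "L * F - (m * u)\<^sup>2 / (4 * (L * F)) - m * V = (L - m) * (F + m * u\<^sup>2 / (4 * (L * F)))"
        using L F by (simp add: V_def field_simps power2_eq_square)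
      moreover have "F + m * u\<^sup>2 / (4 * (L * F)) > 0"
        using F L m by (intro add_pos_nonneg) auto
      ultimately show False using m by auto
    qed
    show "\<not> collides c (bal (t + e * (y1 - y) + r) (a + u + r * (- e * S * u / W)) (y1 + r * (- e * V / W))
        (- e * S * u / W) (- e * V / W))" if c: "c \<in> ?C" "c \<noteq> ?P2" and r: "0 < r" "r \<le> k * W" for c r
    proof
      define m where "m = 1 - e * S * (r / W)"
      have m: "m > 0" "m \<noteq> 1" using mur[of r] r by (auto simp: m_def)
      assume "collides c (bal (t + e * (y1 - y) + r) (a + u + r * (- e * S * u / W)) (y1 + r * (- e * V / W))
        (- e * S * u / W) (- e * V / W))"
      then have "S * (m * V) = S * (F - (m * u)\<^sup>2 / (4 * F))"
        using c unfolding key m_def[symmetric] by (simp add: c1)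
      then have "m * V = F - (m * u)\<^sup>2 / (4 * F)" using S by auto
      moreover have "F - (m * u)\<^sup>2 / (4 * F) - m * V = (1 - m) * (F + m * u\<^sup>2 / (4 * F))"
        using F by (simp add: V_def field_simps power2_eq_square)
      moreover have "F + m * u\<^sup>2 / (4 * F) > 0"
        using F m by (intro add_pos_nonneg) auto
      ultimately show False using m by auto
    qed
    show "0 < k * W" using k W by simp
  qed (use R in \<open>auto simp: a_def L_def\<close>)
  have leg3: "run ?C R 0 (bal (t + e * (y1 - y) + k * W) (a + L * u) y2 0 e)
      (bal (t + e * (y1 - y) + k * W + e * (y' - y2)) (a + L * u) y' 0 e)"
  proof (rule run_flyI[where s = "e * (y' - y2)"])
    show "y' = y2 + e * (y' - y2) * e" using e by auto
    show "\<not> collides c (bal (t + e * (y1 - y) + k * W + r) (a + L * u + r * 0) (y2 + r * e) 0 e)"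
      if "c \<in> ?C" "0 < r" for c r
    proof -
      have "y2 + r * e \<noteq> y2" using that e by auto
      moreover have "(L * u)\<^sup>2 / (4 * (L * F)) = L * (u\<^sup>2 / (4 * F))"
        using L F by (simp add: field_simps power2_eq_square)
      ultimately have "\<not> collides ?P2 (bal (t + e * (y1 - y) + k * W + r) (a + L * u + r * 0) (y2 + r * e) 0 e)"
        unfolding c2 by (auto simp: y2' V_def algebra_simps)
      then show ?thesis using that no21 by (auto simp: c1)
    qed
  qed (use y R in \<open>auto simp: a_def L_def\<close>)
  \<comment> \<open>The middle leg has length \<open>k * W\<close>, and the difference of the two
    impact heights contributes \<open>k * V\<close>. Since \<open>W + V = 2 * F\<close>, the
    dependence on \<open>u\<close> cancels.\<close>
  have time: "t + e * (y1 - y) + k * W + e * (y' - y2) = t + e * (y' - y) + 2 * F * k"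
  proof -
    have "e * (y1 - y2) = k * V" by (simp add: y1' y2' k_def algebra_simps)
    moreover have "k * W + k * V = 2 * F * k" by (simp add: W_def V_def algebra_simps)
    ultimately show ?thesis by (simp add: algebra_simps)
  qed
  have "run ?C R (1 + (1 + 0)) (bal t (a + u) y 0 e)
      (bal (t + e * (y1 - y) + k * W + e * (y' - y2)) (a + L * u) y' 0 e)"
    using leg1 leg2 leg3 by (blast intro: run_trans)
  then show ?thesis
    unfolding time by (simp add: a_def L_def k_def S_def F_def numeral_2_eq_2)
qed

text \<open>A periscope: two parallel mirrors translate the beam and delay every ball by the same
  \<open>d\<close>. The bound \<open>3 \<le> d\<close> keeps the vertical legs clear of the other
  mirror, which extends from -1 to 2 around its centre.\<close>

lemma shift_run:
  fixes a d b :: rat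
  assumes x: "0 \<le> x" "x \<le> 1" and d: "3 \<le> d" and y: "y < of_rat b" "of_rat b + 1 < y'"
    and R: "convex R" "(of_rat a + x, y) \<in> R" "(of_rat a + x, of_rat b + x) \<in> R"
      "(of_rat a + of_rat d + x, of_rat b + x) \<in> R" "(of_rat a + of_rat d + x, y') \<in> R"
  shows "run {slash a b (-1) 2, slash (a + d) b (-1) 2} R 2
    (bal t (of_rat a + x) y 0 1) (bal (t + of_rat d + (y' - y)) (of_rat a + of_rat d + x) y' 0 1)"
proof -
  let ?C = "{slash a b (-1) 2, slash (a + d) b (-1) 2}"
  have d': "(3::real) \<le> of_rat d" "0 < d" using d by (metis of_rat_less_eq of_rat_numeral_eq) (use d in simp)
  note cs = collides_slash rebound_slash of_rat_add of_rat_minus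
  have leg1: "run ?C R 1 (bal t (of_rat a + x) y 0 1)
      (bal (t + (of_rat b + x - y)) (of_rat a + x) (of_rat b + x) 1 0)"
    by (rule run_hitI[where c = "slash a b (-1) 2" and s = "of_rat b + x - y"])
       (use x d' y R in \<open>auto simp: cs\<close>)
  have leg2: "run ?C R 1 (bal (t + (of_rat b + x - y)) (of_rat a + x) (of_rat b + x) 1 0)
      (bal (t + (of_rat b + x - y) + of_rat d) (of_rat a + of_rat d + x) (of_rat b + x) 0 1)"
    by (rule run_hitI[where c = "slash (a + d) b (-1) 2" and s = "of_rat d"])
       (use x d' y R in \<open>auto simp: cs\<close>)
  have leg3: "run ?C R 0 (bal (t + (of_rat b + x - y) + of_rat d) (of_rat a + of_rat d + x) (of_rat b + x) 0 1)
      (bal (t + of_rat d + (y' - y)) (of_rat a + of_rat d + x) y' 0 1)"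
    by (rule run_flyI[where s = "y' - (of_rat b + x)"])
       (use x d' y R in \<open>auto simp: cs\<close>)
  have "run ?C R (1 + (1 + 0)) (bal t (of_rat a + x) y 0 1)
     (bal (t + of_rat d + (y' - y)) (of_rat a + of_rat d + x) y' 0 1)"
    using leg1 leg2 leg3 by (blast intro: run_trans)
  then show ?thesis by (simp add: numeral_2_eq_2)
qed

subsection \<open>Moving walls\<close>

lemma rmod_period: "0 \<le> \<tau> \<Longrightarrow> \<tau> < T \<Longrightarrow> (\<tau> + real k * T) rmod T = (\<tau>::real)"
  by (rule rmod_unique[where n = "int k"]) auto

lemma displacement_ramp:
  assumes "0 \<le> \<tau>" "\<tau> < 512"
  shows "displacement t0 ramp t1 512 (of_rat t0 + \<tau> + real k * 512) =
     (if \<tau> < of_rat t1 then \<tau> else of_rat t1 * (512 - \<tau>) / (512 - of_rat t1))"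
  using rmod_period[of \<tau> 512 k] assms by (simp add: displacement_def Let_def add.assoc)

lemma displacement_rate_ramp:
  assumes "0 \<le> \<tau>" "\<tau> < 512" "\<tau> < of_rat t1"
  shows "displacement_rate t0 ramp t1 512 (of_rat t0 + \<tau> + real k * 512) = 1"
  using rmod_period[of \<tau> 512 k] assms by (simp add: displacement_rate_def Let_def add.assoc)

lemma displacement_ramp_bounds:
  assumes "0 < t1" "t1 < 512"
  shows "0 \<le> displacement t0 ramp t1 512 t" "displacement t0 ramp t1 512 t \<le> of_rat t1"
proof -
  define \<tau> where "\<tau> = (t - of_rat t0) rmod 512"
  have \<tau>: "0 \<le> \<tau>" "\<tau> < 512" by (auto simp: \<tau>_def rmod_nonneg rmod_less)
  have t1: "0 < (of_rat t1 :: real)" "of_rat t1 < (512 :: real)"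
    using assms by (simp, metis of_rat_less of_rat_numeral_eq)
  have "of_rat t1 * (512 - \<tau>) \<le> of_rat t1 * (512 - of_rat t1)" if "of_rat t1 \<le> \<tau>"
    using that t1 by (intro mult_left_mono) auto
  then have "of_rat t1 * (512 - \<tau>) / (512 - of_rat t1) \<le> of_rat t1" if "of_rat t1 \<le> \<tau>"
    using that t1 by (simp add: divide_simps)
  then show "0 \<le> displacement t0 ramp t1 512 t" "displacement t0 ramp t1 512 t \<le> of_rat t1"
    using \<tau> t1 by (auto simp: displacement_def Let_def \<tau>_def[symmetric] less_imp_le)
qed

lemma snd_ramp: "snd ramp = [:1:]"
  by (simp add: ramp_def)

lemma valid_moving_ramp:
  "P \<noteq> Q \<Longrightarrow> 0 \<le> t0 \<Longrightarrow> 0 < t1 \<Longrightarrow> t1 < t2 \<Longrightarrow> valid_component (Moving_Wall P Q d t0 ramp t1 t2)"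
  by (simp add: snd_ramp map_poly_pCons)

subsection \<open>Exchanging the spatial and the temporal offset\<close>

definition diag :: "rat \<Rightarrow> rat \<Rightarrow> rat \<Rightarrow> rat \<Rightarrow> rat_point" where
  "diag e a b l = (a + l, b + e * l)"

lemma segment_diag:
  "e = 1 \<or> e = -1 \<Longrightarrow> l < r \<Longrightarrow> (x, y) \<in> segment (diag e a b l) (diag e a b r) \<longleftrightarrow>
     of_rat l \<le> x - of_rat a \<and> x - of_rat a \<le> of_rat r \<and> y - of_rat b = of_rat e * (x - of_rat a)"
  using segment_slash[of l r x y a b] segment_bslash[of l r x y a b]
  by (auto simp: diag_def pt_slash_def pt_bslash_def of_rat_minus)

lemma reflect_diag:
  "e = 1 \<or> e = -1 \<Longrightarrow> l < r \<Longrightarrow>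
     reflect (segment_normal (diag e a b l) (diag e a b r)) (u, v) = (of_rat e * v, of_rat e * u)"
  using reflect_slash[of l r a b u v] reflect_bslash[of l r a b u v]
  by (auto simp: diag_def pt_slash_def pt_bslash_def of_rat_minus)

lemma segment_ver':
  "e = 1 \<or> e = -1 \<Longrightarrow> l < r \<Longrightarrow> (x, y) \<in> segment (a, b + e * l) (a, b + e * r) \<longleftrightarrow>
     of_rat l \<le> of_rat e * (y - of_rat b) \<and> of_rat e * (y - of_rat b) \<le> of_rat r \<and> x = of_rat a"
proof -
  assume e: "e = 1 \<or> e = -1" and "l < r"
  show ?thesis
  proof (cases "e = 1")
    case True
    have "(x, y) \<in> segment (a, b + e * l) (a, b + e * r) \<longleftrightarrow>
        of_rat b + of_rat l \<le> y \<and> y \<le> of_rat b + of_rat r \<and> x = of_rat a"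
      using segment_ver[of "b + l" "b + r" x y a] \<open>l < r\<close> by (simp add: of_rat_add True)
    moreover have "of_rat b + of_rat l \<le> y \<longleftrightarrow> of_rat l \<le> y - of_rat b"
      "y \<le> of_rat b + of_rat r \<longleftrightarrow> y - of_rat b \<le> of_rat r" by linarith+
    ultimately show ?thesis by (simp only: True of_rat_1 mult_1)
  next
    case False
    then have e: "e = -1" using e by simp
    have "segment (a, b + e * l) (a, b + e * r) = segment (a, b - r) (a, b - l)"
      unfolding e using segment_commute[of "(a, b - l)" "(a, b - r)"] by simp
    moreover have "b - r < b - l" using \<open>l < r\<close> by simp
    ultimately have "(x, y) \<in> segment (a, b + e * l) (a, b + e * r) \<longleftrightarrow>
        of_rat b - of_rat r \<le> y \<and> y \<le> of_rat b - of_rat l \<and> x = of_rat a"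
      by (simp only: segment_ver of_rat_diff)
    moreover have "(of_rat e :: real) = -1" by (simp add: e of_rat_minus)
    moreover have "of_rat b - of_rat r \<le> y \<longleftrightarrow> -1 * (y - of_rat b) \<le> of_rat r"
      "y \<le> of_rat b - of_rat l \<longleftrightarrow> of_rat l \<le> -1 * (y - of_rat b)" by (auto simp: algebra_simps)
    ultimately show ?thesis by (simp only:) blast
  qed
qed

text \<open>The impact happens at phase \<open>w + 1 - x\<close>, at height
  \<open>w + 1 - x - s\<close> above or below \<open>b\<close>. This determines the extent from 1 to
  \<open>w + 1\<close>, and a motion that lasts until \<open>w + 2\<close> is still going
  on.\<close>

definition swap_wall1 :: "rat \<Rightarrow> rat \<Rightarrow> rat \<Rightarrow> rat \<Rightarrow> rat \<Rightarrow> component" where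
  "swap_wall1 e a b w t0 =
     Moving_Wall (a + w + 1, b + e * 1) (a + w + 1, b + e * (w + 1)) (-1, 0) t0 ramp (w + 2) 512"

text \<open>The impact happens at phase at most \<open>2 * w + 2\<close>, at the horizontal offset
  \<open>(w - x - s) / 2\<close> along the wall.\<close>

definition swap_wall2 :: "rat \<Rightarrow> rat \<Rightarrow> rat \<Rightarrow> rat \<Rightarrow> rat \<Rightarrow> component" where
  "swap_wall2 e a b w t0 =
     Moving_Wall (diag e a (b + e * (w + 2)) 0) (diag e a (b + e * (w + 2)) (w / 2)) (-1, 0) t0 ramp (2 * w + 3) 512"

text \<open>The rest frame of either wall agrees with the fixed frame at phase 0. Extrapolated to
  this phase, a ball of the beam is at \<open>(x, - e * s)\<close> relative to
  \<open>(a, b)\<close>. Mirroring this point at the vertical line with offset \<open>w + 1\<close>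
  and then at the diagonal gives \<open>(- (w + 2) - s, e * (3 * w + 4 - x))\<close>, while the
  velocity changes to \<open>(-2, e)\<close> and then to \<open>(0, - e)\<close>. Hence the ball is
  back at height \<open>b\<close> at phase \<open>3 * w + 4 - x\<close>. Both offsets come out
  exchanged and negated, so a second exchange restores their signs.\<close>

lemma swap_run:
  fixes a b w t0 e :: rat and x s t :: real and k :: nat
  assumes e: "e = 1 \<or> e = -1" and w: "0 < w" "w \<le> 100"
    and x: "0 \<le> x" and s: "0 \<le> s" and xs: "x + s \<le> of_rat w"
    and t: "t = of_rat t0 + real k * 512"
    and R: "convex R" "(of_rat a + x, of_rat b) \<in> R"
      "(of_rat a + x, of_rat b + of_rat e * (of_rat w + 1 - x - s)) \<in> R"
      "(of_rat a - (of_rat w + 2) - s, of_rat b + of_rat e * (of_rat w + 1 + (of_rat w + 2 - x - s) / 2)) \<in> R"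
      "(of_rat a - (of_rat w + 2) - s, of_rat b) \<in> R"
  shows "run {swap_wall1 e a b w t0, swap_wall2 e a b w t0} R 2
    (bal (t + s) (of_rat a + x) (of_rat b) 0 (of_rat e))
    (bal (t + 3 * of_rat w + 4 - x) (of_rat a - (of_rat w + 2) - s) (of_rat b) 0 (- of_rat e))"
proof -
  define A where "A = (of_rat a :: real)"
  define B where "B = (of_rat b :: real)"
  define E where "E = (of_rat e :: real)"
  define W where "W = (of_rat w :: real)"
  let ?w1 = "swap_wall1 e a b w t0" and ?w2 = "swap_wall2 e a b w t0"
  let ?C = "{?w1, ?w2}"
  define \<delta>1 where "\<delta>1 = displacement t0 ramp (w + 2) 512"
  define \<delta>2 where "\<delta>2 = displacement t0 ramp (2 * w + 3) 512"
  have E: "E = 1 \<or> E = -1" using e by (auto simp: E_def of_rat_minus)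
  have EE: "E * E = 1" "E * (E * z) = z" "E * (z * E) = z" for z using E by auto
  have W: "0 < W" "W \<le> 100" using w by (simp_all add: W_def) (metis of_rat_less_eq of_rat_numeral_eq)
  have xsW: "x + s \<le> W" using xs by (simp add: W_def)
  have c1: "collides ?w1 (bal t' x' y' u v) \<longleftrightarrow>
      1 \<le> E * (y' - B) \<and> E * (y' - B) \<le> W + 1 \<and> x' = A + W + 1 - \<delta>1 t'" for t' x' y' u v
    using segment_ver'[OF e, of 1 "w + 1" "x' + \<delta>1 t'" y' "a + w + 1" b] w
    by (auto simp: swap_wall1_def A_def B_def E_def W_def \<delta>1_def of_rat_add of_rat_minus)
  have c2: "collides ?w2 (bal t' x' y' u v) \<longleftrightarrow>
      0 \<le> x' + \<delta>2 t' - A \<and> x' + \<delta>2 t' - A \<le> W / 2 \<and> E * (y' - B) - (W + 2) = x' + \<delta>2 t' - A" for t' x' y' u v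
    using segment_diag[OF e, of 0 "w / 2" "x' + \<delta>2 t'" y' a "b + e * (w + 2)"] w E
    by (auto simp: swap_wall2_def A_def B_def E_def W_def \<delta>2_def of_rat_add of_rat_minus of_rat_mult of_rat_divide)
  have d1: "\<delta>1 (t + \<tau>) = \<tau>" if "0 \<le> \<tau>" "\<tau> < W + 2" for \<tau>
    using displacement_ramp[of \<tau> t0 "w + 2" k] that W
    by (simp add: \<delta>1_def t W_def of_rat_add algebra_simps)
  have d1b: "\<delta>1 z \<le> W + 2" for z
    using displacement_ramp_bounds(2)[of "w + 2" t0 z] w by (simp add: \<delta>1_def W_def of_rat_add)
  have d2: "\<delta>2 (t + \<tau>) = \<tau>" if "0 \<le> \<tau>" "\<tau> < 2 * W + 3" for \<tau>
    using displacement_ramp[of \<tau> t0 "2 * w + 3" k] that W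
    by (simp add: \<delta>2_def t W_def of_rat_add of_rat_mult algebra_simps)
  have tt: "t + \<tau> = of_rat t0 + \<tau> + real k * 512" for \<tau> by (simp add: t)
  have r1: "rebound ?w1 (bal (t + \<tau>) x' y' u v) = (- 2 - u, v)" if "0 \<le> \<tau>" "\<tau> < W + 2" for \<tau> x' y' u v
  proof -
    have "displacement_rate t0 ramp (w + 2) 512 (t + \<tau>) = 1"
      unfolding tt by (rule displacement_rate_ramp) (use that W in \<open>auto simp: W_def of_rat_add\<close>)
    moreover have "b + e * 1 \<noteq> b + e * (w + 1)" using e w by auto
    ultimately show ?thesis
      unfolding swap_wall1_def rebound.simps Let_def by (simp add: reflect_vertical of_rat_minus)
  qed
  have r2: "rebound ?w2 (bal (t + \<tau>) x' y' (-2) E) = (0, - E)" if "0 \<le> \<tau>" "\<tau> < 2 * W + 3" for \<tau> x' y'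
  proof -
    have "displacement_rate t0 ramp (2 * w + 3) 512 (t + \<tau>) = 1"
      unfolding tt by (rule displacement_rate_ramp) (use that W in \<open>auto simp: W_def of_rat_add of_rat_mult\<close>)
    moreover have "0 < w / 2" using w by simp
    ultimately show ?thesis
      unfolding swap_wall2_def rebound.simps Let_def
      by (simp add: reflect_diag[OF e] of_rat_minus E_def[symmetric] EE)
  qed
  define \<tau>2 where "\<tau>2 = W + 1 + (W + 2 + s - x) / 2"
  define y2 where "y2 = B + E * (W + 1 + (W + 2 - x - s) / 2)"
  have R': "(A + x, B) \<in> R" "(A + x, B + E * (W + 1 - x - s)) \<in> R"
     "(A - (W + 2) - s, y2) \<in> R" "(A - (W + 2) - s, B) \<in> R"
    using R(2-) by (simp_all only: A_def B_def E_def W_def y2_def)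
  have leg1: "run ?C R 1 (bal (t + s) (A + x) B 0 E) (bal (t + (W + 1 - x)) (A + x) (B + E * (W + 1 - x - s)) (-2) E)"
  proof (rule run_hitI[where c = ?w1 and s = "W + 1 - x - s"])
    show "collides ?w1 (bal (t + (W + 1 - x)) (A + x) (B + E * (W + 1 - x - s)) 0 E)"
      unfolding c1 using x s xsW d1[of "W + 1 - x"] by (simp add: EE)
    show "rebound ?w1 (bal (t + (W + 1 - x)) (A + x) (B + E * (W + 1 - x - s)) 0 E) = (-2, E)"
      using r1[of "W + 1 - x"] x s xsW by simp
    show "\<not> collides ?w1 (bal (t + s + r) (A + x + r * 0) (B + r * E) 0 E)"
      if "0 < r" "r < W + 1 - x - s" for r
      unfolding c1 using d1[of "s + r"] that x s xsW by (auto simp: add.assoc)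
    show "\<not> collides c (bal (t + s + r) (A + x + r * 0) (B + r * E) 0 E)"
      if "c \<in> ?C" "c \<noteq> ?w1" "0 < r" "r \<le> W + 1 - x - s" for c r
      using that x s by (auto simp: c2 EE)
  qed (use x s xsW R(1) R' in auto)
  have leg2: "run ?C R 1 (bal (t + (W + 1 - x)) (A + x) (B + E * (W + 1 - x - s)) (-2) E)
      (bal (t + \<tau>2) (A - (W + 2) - s) y2 0 (- E))"
  proof (rule run_hitI[where c = ?w2 and s = "(W + 2 + x + s) / 2"])
    show "t + \<tau>2 = t + (W + 1 - x) + (W + 2 + x + s) / 2" "A - (W + 2) - s = A + x + (W + 2 + x + s) / 2 * -2"
      by (simp_all add: \<tau>2_def field_simps)
    have eq: "E * (B + E * z + r * E - B) = z + r" for z r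
      using E by auto
    show "y2 = B + E * (W + 1 - x - s) + (W + 2 + x + s) / 2 * E"
      using E by (auto simp: y2_def field_simps)
    show "collides ?w2 (bal (t + \<tau>2) (A - (W + 2) - s) y2 (-2) E)"
      unfolding c2 using x s xsW W d2[of \<tau>2] by (simp add: y2_def EE \<tau>2_def) (simp add: field_simps)
    show "rebound ?w2 (bal (t + \<tau>2) (A - (W + 2) - s) y2 (-2) E) = (0, - E)"
      using x s xsW W by (intro r2) (auto simp: \<tau>2_def field_simps)
    show "\<not> collides ?w2 (bal (t + (W + 1 - x) + r) (A + x + r * -2) (B + E * (W + 1 - x - s) + r * E) (-2) E)"
      if "0 < r" "r < (W + 2 + x + s) / 2" for r
      unfolding c2 eq using that x s xsW W d2[of "W + 1 - x + r"] by (auto simp: add.assoc)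
    show "\<not> collides c (bal (t + (W + 1 - x) + r) (A + x + r * -2) (B + E * (W + 1 - x - s) + r * E) (-2) E)"
      if "c \<in> ?C" "c \<noteq> ?w2" "0 < r" "r \<le> (W + 2 + x + s) / 2" for c r
    proof -
      \<comment> \<open>While the wall moves left it has half the horizontal speed of the ball and
        falls behind; after phase \<open>W + 2\<close> the bound on its displacement
        suffices.\<close>
      have "A + x + r * -2 < A + W + 1 - \<delta>1 (t + (W + 1 - x + r))"
        using that x s xsW W d1[of "W + 1 - x + r"] d1b[of "t + (W + 1 - x + r)"]
        by (cases "W + 1 - x + r < W + 2") auto
      then show ?thesis using that by (auto simp: c1 add.assoc)
    qed
  qed (use x s xsW W R(1) R' in auto)
  have leg3: "run ?C R 0 (bal (t + \<tau>2) (A - (W + 2) - s) y2 0 (- E))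
     (bal (t + 3 * W + 4 - x) (A - (W + 2) - s) B 0 (- E))"
  proof (rule run_flyI[where s = "W + 1 + (W + 2 - x - s) / 2"])
    show "t + 3 * W + 4 - x = t + \<tau>2 + (W + 1 + (W + 2 - x - s) / 2)"
      by (simp add: \<tau>2_def field_simps)
    have "0 \<le> (W + 2 - x - s) / 2" using xsW by simp
    then show "0 < W + 1 + (W + 2 - x - s) / 2" using W by linarith
    show "B = y2 + (W + 1 + (W + 2 - x - s) / 2) * - E"
      by (simp add: y2_def)
    show "\<not> collides c (bal (t + \<tau>2 + r) (A - (W + 2) - s + r * 0) (y2 + r * - E) 0 (- E))"
      if "c \<in> ?C" "0 < r" for c r
    proof -
      have eq: "E * (y2 + r * - E - B) = W + 1 + (W + 2 - x - s) / 2 - r"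
        using E by (auto simp: y2_def)
      have "A - (W + 2) - s + r * 0 < A + W + 1 - \<delta>1 (t + \<tau>2 + r)"
        using d1b[of "t + \<tau>2 + r"] s W by simp
      then have 1: "\<not> collides ?w1 (bal (t + \<tau>2 + r) (A - (W + 2) - s + r * 0) (y2 + r * - E) 0 (- E))"
        by (simp add: c1)
      have 2: "\<not> collides ?w2 (bal (t + \<tau>2 + r) (A - (W + 2) - s + r * 0) (y2 + r * - E) 0 (- E))"
      proof
        assume "collides ?w2 (bal (t + \<tau>2 + r) (A - (W + 2) - s + r * 0) (y2 + r * - E) 0 (- E))"
        then have c: "0 \<le> A - (W + 2) - s + \<delta>2 (t + (\<tau>2 + r)) - A"
          "W + 1 + (W + 2 - x - s) / 2 - r - (W + 2) = A - (W + 2) - s + \<delta>2 (t + (\<tau>2 + r)) - A"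
          unfolding c2 eq by (auto simp: add.assoc)
        \<comment> \<open>A renewed contact would have to occur so early that the wall still has
          unit speed, and then its equation holds only at \<open>r = 0\<close>.\<close>
        then have "r \<le> (W - x - s) / 2" by (simp add: field_simps)
        then have "\<delta>2 (t + (\<tau>2 + r)) = \<tau>2 + r"
          using x s xsW W that by (intro d2) (auto simp: \<tau>2_def field_simps)
        then show False using c that by (simp add: \<tau>2_def field_simps)
      qed
      show ?thesis using 1 2 that by auto
    qed
  qed (use x s xsW W R(1) R' in auto)
  have "run ?C R (1 + (1 + 0)) (bal (t + s) (A + x) B 0 E) (bal (t + 3 * W + 4 - x) (A - (W + 2) - s) B 0 (- E))"
    using leg1 leg2 leg3 by (blast intro: run_trans)
  then show ?thesis by (simp add: numeral_2_eq_2 A_def B_def E_def W_def)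
qed

abbreviation grid :: "int \<Rightarrow> real" where "grid c \<equiv> 512 * of_int c"

subsection \<open>Confinement\<close>

definition confined :: "component \<Rightarrow> (real \<times> real) set \<Rightarrow> bool" where
  "confined c A \<longleftrightarrow> (\<forall>b. collides c b \<longrightarrow> pos b \<in> A)"

lemma confined_mono: "confined c A \<Longrightarrow> A \<subseteq> B \<Longrightarrow> confined c B"
  by (auto simp: confined_def)

lemma confined_avoids: "confined c A \<Longrightarrow> A \<inter> B = {} \<Longrightarrow> avoids c B"
  by (auto simp: confined_def avoids_def)

lemma avoids_rect:
  "confined c (rect x0 x1 y0 y1) \<Longrightarrow> x1 < x0' \<or> x1' < x0 \<or> y1 < y0' \<or> y1' < y0 \<Longrightarrow>
     avoids c (rect x0' x1' y0' y1')"
  by (erule confined_avoids) (auto simp: rect_def)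

lemma segment_subset: "convex A \<Longrightarrow> real_point P \<in> A \<Longrightarrow> real_point Q \<in> A \<Longrightarrow> segment P Q \<subseteq> A"
  unfolding segment_def by (rule closed_segment_subset)

lemma confined_static:
  assumes "convex A" "real_point P \<in> A" "real_point Q \<in> A"
  shows "confined (Wall P Q) A" "confined (Gate P Q) A" "confined (Bumper P Q t0 f t1 t2) A"
  using segment_subset[OF assms] by (auto simp: confined_def)

lemma confined_slash:
  "x0 \<le> of_rat a + of_rat l \<Longrightarrow> of_rat a + of_rat r \<le> x1 \<Longrightarrow> y0 \<le> of_rat b + of_rat l \<Longrightarrow>
   of_rat b + of_rat r \<le> y1 \<Longrightarrow> l \<le> r \<Longrightarrow> confined (slash a b l r) (rect x0 x1 y0 y1)"
  unfolding slash_def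
  by (rule confined_static) (auto simp: pt_slash_def of_rat_add intro: order_trans add_mono simp: of_rat_less_eq elim: order_trans[rotated])

lemma confined_bslash:
  "x0 \<le> of_rat a + of_rat l \<Longrightarrow> of_rat a + of_rat r \<le> x1 \<Longrightarrow> y0 \<le> of_rat b - of_rat r \<Longrightarrow>
   of_rat b - of_rat l \<le> y1 \<Longrightarrow> l \<le> r \<Longrightarrow> confined (bslash a b l r) (rect x0 x1 y0 y1)"
proof -
  assume *: "x0 \<le> of_rat a + of_rat l" "of_rat a + of_rat r \<le> x1" "y0 \<le> of_rat b - of_rat r"
    "of_rat b - of_rat l \<le> y1" "l \<le> r"
  then have "(of_rat l :: real) \<le> of_rat r" by (simp add: of_rat_less_eq)
  with * show ?thesis
    unfolding bslash_def
    by (intro confined_static) (auto simp: pt_bslash_def of_rat_add of_rat_diff)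
qed

text \<open>Here \<open>m\<close> bounds the distance from the axis and \<open>d\<close> the
  resulting deviation from the vertex height, which is at most
  \<open>m\<^sup>2 / (4 * f)\<close>.\<close>

lemma confined_parab:
  fixes m d :: real
  assumes "0 < f" "sg = 1 \<or> sg = -1" "-m \<le> of_rat lo" "of_rat hi \<le> m" "m\<^sup>2 \<le> 4 * of_rat f * d"
    "x0 \<le> of_rat \<alpha> + of_rat lo" "of_rat \<alpha> + of_rat hi \<le> x1"
    "y0 \<le> of_rat \<phi> + of_rat sg * of_rat f - (if sg = 1 then d else 0)"
    "of_rat \<phi> + of_rat sg * of_rat f + (if sg = 1 then 0 else d) \<le> y1"
  shows "confined (parab \<alpha> \<phi> sg f lo hi) (rect x0 x1 y0 y1)"
  unfolding confined_def
proof (intro allI impI)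
  fix b assume c: "collides (parab \<alpha> \<phi> sg f lo hi) b"
  obtain t x y u v where b: "b = bal t x y u v"
    by (cases b) (metis prod.collapse)
  define F where "F = (of_rat f :: real)"
  define z where "z = (x - of_rat \<alpha>)\<^sup>2 / (4 * F)"
  have F: "F > 0" using assms by (simp add: F_def)
  have h: "of_rat lo \<le> x - of_rat \<alpha>" "x - of_rat \<alpha> \<le> of_rat hi"
    "y - of_rat \<phi> = of_rat sg * (F - z)"
    using c assms(1) unfolding b by (auto simp: collides_parab F_def z_def)
  have "\<bar>x - of_rat \<alpha>\<bar> \<le> m" using h assms(3,4) by linarith
  then have "(x - of_rat \<alpha>)\<^sup>2 \<le> m\<^sup>2" by (metis abs_ge_zero power2_abs power_mono)
  also have "\<dots> \<le> 4 * F * d" using assms by (simp add: F_def)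
  finally have "z \<le> d" "0 \<le> z" using F by (simp_all add: z_def field_simps)
  then show "pos b \<in> rect x0 x1 y0 y1"
    using h assms unfolding b by (auto simp: F_def of_rat_minus)
qed

lemma run_strip:
  assumes "0 < s" "\<And>c. c \<in> C \<Longrightarrow> avoids c A" "convex A" "(x, y) \<in> A" "(x', y') \<in> A"
    "x' = x + s * u" "y' = y + s * v" "t' = t + s"
  shows "run C A 0 (bal t x y u v) (bal t' x' y' u v)"
  using run_local[OF run_flyI[OF assms(1,3-8), of "{}"], of C] assms(2) by auto

subsection \<open>Tiles and beams\<close>

text \<open>Columns are centred at multiples of 512 and rows begin there, so that a vertical beam
  near \<open>grid c\<close> and a horizontal one near half height meet in the middle of the
  tile.\<close>

definition tile :: "int \<Rightarrow> int \<Rightarrow> (real \<times> real) set" where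
  "tile c r = rect (grid c - 256) (grid c + 256) (grid r) (grid r + 512)"

definition inner_tile :: "int \<Rightarrow> int \<Rightarrow> (real \<times> real) set" where
  "inner_tile c r = rect (grid c - 255) (grid c + 255) (grid r + 1) (grid r + 511)"

lemma convex_tile [simp]: "convex (tile c r)"
  by (simp add: tile_def)

lemma inner_tile_disjoint: "(c, r) \<noteq> (c', r') \<Longrightarrow> inner_tile c r \<inter> tile c' r' = {}"
proof -
  assume "(c, r) \<noteq> (c', r')"
  then consider "c + 1 \<le> c'" | "c' + 1 \<le> c" | "r + 1 \<le> r'" | "r' + 1 \<le> r" by fastforce
  then show ?thesis
  proof cases
    case 1
    then have "real_of_int c + 1 \<le> of_int c'" by linarith
    then show ?thesis by (auto simp: inner_tile_def tile_def rect_def)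
  next
    case 2
    then have "real_of_int c' + 1 \<le> of_int c" by linarith
    then show ?thesis by (auto simp: inner_tile_def tile_def rect_def)
  next
    case 3
    then have "real_of_int r + 1 \<le> of_int r'" by linarith
    then show ?thesis by (auto simp: inner_tile_def tile_def rect_def)
  next
    case 4
    then have "real_of_int r' + 1 \<le> of_int r" by linarith
    then show ?thesis by (auto simp: inner_tile_def tile_def rect_def)
  qed
qed

text \<open>The signs of \<open>x\<close> in the four kinds of beams are dictated by the mirrors in
  the middle of a tile: one of slope 1 keeps the sign, one of slope -1 changes it. The directions
  right and up carry \<open>x\<close>, down and left carry \<open>-x\<close>, so that a full circuit
  does not invert the stack.\<close>

definition beam_up :: "int \<Rightarrow> int \<Rightarrow> real \<Rightarrow> real \<Rightarrow> ball \<Rightarrow> bool" where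
  "beam_up c r x s b \<longleftrightarrow> (\<exists>k::nat. b = bal (1 + s + 512 * real k) (grid c + x) (grid r) 0 1)"

definition beam_right :: "int \<Rightarrow> int \<Rightarrow> real \<Rightarrow> real \<Rightarrow> ball \<Rightarrow> bool" where
  "beam_right c r x s b \<longleftrightarrow> (\<exists>k::nat. b = bal (1 + s + 512 * real k) (grid c - 256) (grid r + 256 + x) 1 0)"

definition beam_down :: "int \<Rightarrow> int \<Rightarrow> real \<Rightarrow> real \<Rightarrow> ball \<Rightarrow> bool" where
  "beam_down c r x s b \<longleftrightarrow> (\<exists>k::nat. b = bal (1 + s + 512 * real k) (grid c - x) (grid r + 512) 0 (-1))"

definition beam_left :: "int \<Rightarrow> int \<Rightarrow> real \<Rightarrow> real \<Rightarrow> ball \<Rightarrow> bool" where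
  "beam_left c r x s b \<longleftrightarrow> (\<exists>k::nat. b = bal (1 + s + 512 * real k) (grid c + 256) (grid r + 256 - x) (-1) 0)"

definition col :: "int \<Rightarrow> rat" where "col c = 512 * of_int c"

lemma of_rat_col [simp]: "of_rat (col c) = grid c"
  by (simp add: col_def of_rat_mult)

definition tslash :: "rat \<Rightarrow> int \<Rightarrow> int \<Rightarrow> component" where
  "tslash l c r = slash (col c) (col r + 256) l 2"

definition tbslash :: "int \<Rightarrow> int \<Rightarrow> component" where
  "tbslash c r = bslash (col c) (col r + 256) (-2) 2"

definition tgate :: "int \<Rightarrow> int \<Rightarrow> component" where
  "tgate c r = Gate (pt_slash (col c) (col r + 256) (-2)) (pt_slash (col c) (col r + 256) 2)"

lemma collides_tslash: "l < 2 \<Longrightarrow> collides (tslash l c r) (bal t x y u v) \<longleftrightarrow>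
   of_rat l \<le> x - grid c \<and> x - grid c \<le> 2 \<and> y - grid r - 256 = x - grid c"
  by (auto simp: tslash_def collides_slash of_rat_add)
lemma rebound_tslash: "l < 2 \<Longrightarrow> rebound (tslash l c r) (bal t x y u v) = (v, u)"
  by (simp add: tslash_def rebound_slash)
lemma collides_tbslash: "collides (tbslash c r) (bal t x y u v) \<longleftrightarrow>
   -2 \<le> x - grid c \<and> x - grid c \<le> 2 \<and> y - grid r - 256 = - (x - grid c)"
  by (auto simp: tbslash_def collides_bslash of_rat_add of_rat_minus)
lemma rebound_tbslash: "rebound (tbslash c r) (bal t x y u v) = (- v, - u)"
  by (simp add: tbslash_def rebound_bslash)
lemma collides_tgate: "collides (tgate c r) (bal t x y u v) \<longleftrightarrow>
   -2 \<le> x - grid c \<and> x - grid c \<le> 2 \<and> y - grid r - 256 = x - grid c \<and> u < v"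
  by (auto simp: tgate_def segment_slash cross_slash of_rat_add of_rat_minus)
lemma rebound_tgate: "rebound (tgate c r) (bal t x y u v) = (v, u)"
  by (simp add: tgate_def reflect_slash)

lemma confined_tslash: "-2 \<le> l \<Longrightarrow> l < 2 \<Longrightarrow> confined (tslash l c r) (inner_tile c r)"
proof -
  assume l: "-2 \<le> l" "l < 2"
  then have "(-2::real) \<le> of_rat l" by (metis of_rat_less_eq of_rat_minus of_rat_numeral_eq)
  then show ?thesis
    unfolding tslash_def inner_tile_def using l by (intro confined_slash) (auto simp: of_rat_add)
qed

lemma confined_tbslash: "confined (tbslash c r) (inner_tile c r)"
  unfolding tbslash_def inner_tile_def by (rule confined_bslash) (auto simp: of_rat_add of_rat_minus)

lemma confined_tgate: "confined (tgate c r) (inner_tile c r)"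
  unfolding tgate_def inner_tile_def
  by (rule confined_static) (auto simp: pt_slash_def of_rat_add of_rat_diff)

lemma beam_bal:
  "beam_up c r x s (bal (1 + s + 512 * real k) (grid c + x) (grid r) 0 1)"
  "beam_right c r x s (bal (1 + s + 512 * real k) (grid c - 256) (grid r + 256 + x) 1 0)"
  "beam_down c r x s (bal (1 + s + 512 * real k) (grid c - x) (grid r + 512) 0 (-1))"
  "beam_left c r x s (bal (1 + s + 512 * real k) (grid c + 256) (grid r + 256 - x) (-1) 0)"
  unfolding beam_up_def beam_right_def beam_down_def beam_left_def by blast+

lemma ex_run: "run C A n b b' \<Longrightarrow> P b' \<Longrightarrow> \<exists>b'. run C A n b b' \<and> P b'"
  by blast

lemma ex_run_trans: "run C A m b b' \<Longrightarrow> run C A 0 b' b'' \<Longrightarrow> P b'' \<Longrightarrow> \<exists>b'. run C A m b b' \<and> P b'"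
  using run_trans by fastforce

section \<open>Routing a beam through one tile\<close>

lemma up_pass:
  assumes "beam_up c r x s b" "0 \<le> x" "x \<le> 1"
  shows "\<exists>b'. run {} (tile c r) 0 b b' \<and> beam_up c (r + 1) x s b'"
proof -
  obtain k :: nat where b: "b = bal (1 + s + 512 * real k) (grid c + x) (grid r) 0 1"
    using assms by (auto simp: beam_up_def)
  show ?thesis
    unfolding b
    by (rule ex_run, rule_tac [2] beam_bal(1)[where k = "k + 1"], rule run_strip[where s = 512])
       (use assms in \<open>auto simp: tile_def\<close>)
qed

lemma right_pass:
  assumes "beam_right c r x s b" "0 \<le> x" "x \<le> 1" "C \<subseteq> {tgate c r}"
  shows "\<exists>b'. run C (tile c r) 0 b b' \<and> beam_right (c + 1) r x s b'"
proof -
  obtain k :: nat where b: "b = bal (1 + s + 512 * real k) (grid c - 256) (grid r + 256 + x) 1 0"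
    using assms by (auto simp: beam_right_def)
  show ?thesis
    unfolding b
    by (rule ex_run, rule_tac [2] beam_bal(2)[where k = "k + 1"], rule run_flyI[where s = 512])
       (use assms in \<open>auto simp: tile_def collides_tgate\<close>)
qed

lemma down_pass:
  assumes "beam_down c r x s b" "0 \<le> x" "x \<le> 1"
  shows "\<exists>b'. run {} (tile c r) 0 b b' \<and> beam_down c (r - 1) x s b'"
proof -
  obtain k :: nat where b: "b = bal (1 + s + 512 * real k) (grid c - x) (grid r + 512) 0 (-1)"
    using assms by (auto simp: beam_down_def)
  show ?thesis
    unfolding b
    by (rule ex_run, rule_tac [2] beam_bal(3)[where k = "k + 1"], rule run_strip[where s = 512])
       (use assms in \<open>auto simp: tile_def\<close>)
qed

lemma left_pass:
  assumes "beam_left c r x s b" "0 \<le> x" "x \<le> 1"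
  shows "\<exists>b'. run {} (tile c r) 0 b b' \<and> beam_left (c - 1) r x s b'"
proof -
  obtain k :: nat where b: "b = bal (1 + s + 512 * real k) (grid c + 256) (grid r + 256 - x) (-1) 0"
    using assms by (auto simp: beam_left_def)
  show ?thesis
    unfolding b
    by (rule ex_run, rule_tac [2] beam_bal(4)[where k = "k + 1"], rule run_strip[where s = 512])
       (use assms in \<open>auto simp: tile_def\<close>)
qed

lemma tile_bounce:
  assumes "0 < s1" "0 < s2" "(x, y) \<in> tile c r" "(x1, y1) \<in> tile c r" "(x2, y2) \<in> tile c r"
    "x1 = x + s1 * u" "y1 = y + s1 * v" "x2 = x1 + s2 * u'" "y2 = y1 + s2 * v'" "t' = t + s1 + s2"
    "collides k (bal (t + s1) x1 y1 u v)" "rebound k (bal (t + s1) x1 y1 u v) = (u', v')"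
    "\<And>d. 0 < d \<Longrightarrow> d < s1 \<Longrightarrow> \<not> collides k (bal (t + d) (x + d * u) (y + d * v) u v)"
    "\<And>d. 0 < d \<Longrightarrow> d \<le> s2 \<Longrightarrow> \<not> collides k (bal (t + s1 + d) (x1 + d * u') (y1 + d * v') u' v')"
  shows "run {k} (tile c r) 1 (bal t x y u v) (bal t' x2 y2 u' v')"
proof -
  have "run {k} (tile c r) 1 (bal t x y u v) (bal (t + s1) x1 y1 u' v')"
    by (rule run_hitI[where c = k and s = s1]) (use assms in auto)
  moreover have "run {k} (tile c r) 0 (bal (t + s1) x1 y1 u' v') (bal t' x2 y2 u' v')"
    by (rule run_flyI[where s = s2]) (use assms in auto)
  ultimately have "run {k} (tile c r) (1 + 0) (bal t x y u v) (bal t' x2 y2 u' v')" by (rule run_trans)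
  then show ?thesis by simp
qed

text \<open>The legs before and after a diagonal through the middle have lengths
  \<open>256 + x\<close> and \<open>256 - x\<close>, so that a turn takes one period for every ball.
  The other turns work alike.\<close>

lemma up_turn_right:
  assumes "beam_up c r x s b" "of_rat l \<le> x" "0 \<le> x" "x \<le> 1" "l < 2"
  shows "\<exists>b'. run {tslash l c r} (tile c r) 1 b b' \<and> beam_right (c + 1) r x s b'"
proof -
  obtain k :: nat where b: "b = bal (1 + s + 512 * real k) (grid c + x) (grid r) 0 1"
    using assms by (auto simp: beam_up_def)
  show ?thesis
    unfolding b
    by (rule ex_run, rule_tac [2] beam_bal(2)[where k = "k + 1"],
        rule tile_bounce[where ?s1.0 = "256 + x" and ?s2.0 = "256 - x" and ?x1.0 = "grid c + x" and ?y1.0 = "grid r + 256 + x"])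
       (use assms in \<open>auto simp: tile_def collides_tslash rebound_tslash\<close>)
qed

lemma up_join_right:
  assumes "beam_up c r x s b" "0 \<le> x" "x \<le> 1"
  shows "\<exists>b'. run {tgate c r} (tile c r) 1 b b' \<and> beam_right (c + 1) r x s b'"
proof -
  obtain k :: nat where b: "b = bal (1 + s + 512 * real k) (grid c + x) (grid r) 0 1"
    using assms by (auto simp: beam_up_def)
  show ?thesis
    unfolding b
    by (rule ex_run, rule_tac [2] beam_bal(2)[where k = "k + 1"],
        rule tile_bounce[where ?s1.0 = "256 + x" and ?s2.0 = "256 - x" and ?x1.0 = "grid c + x" and ?y1.0 = "grid r + 256 + x"])
       (use assms in \<open>auto simp: tile_def collides_tgate rebound_tgate\<close>)
qed

lemma up_miss:
  assumes "beam_up c r x s b" "x < of_rat l" "0 \<le> x" "x \<le> 1" "l < 2"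
  shows "\<exists>b'. run {tslash l c r} (tile c r) 0 b b' \<and> beam_up c (r + 1) x s b'"
proof -
  obtain k :: nat where b: "b = bal (1 + s + 512 * real k) (grid c + x) (grid r) 0 1"
    using assms by (auto simp: beam_up_def)
  show ?thesis
    unfolding b
    by (rule ex_run, rule_tac [2] beam_bal(1)[where k = "k + 1"], rule run_flyI[where s = 512])
       (use assms in \<open>auto simp: tile_def collides_tslash\<close>)
qed

lemma right_turn_up:
  assumes "beam_right c r x s b" "0 \<le> x" "x \<le> 1"
  shows "\<exists>b'. run {tslash (-2) c r} (tile c r) 1 b b' \<and> beam_up c (r + 1) x s b'"
proof -
  obtain k :: nat where b: "b = bal (1 + s + 512 * real k) (grid c - 256) (grid r + 256 + x) 1 0"
    using assms by (auto simp: beam_right_def)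
  show ?thesis
    unfolding b
    by (rule ex_run, rule_tac [2] beam_bal(1)[where k = "k + 1"],
        rule tile_bounce[where ?s1.0 = "256 + x" and ?s2.0 = "256 - x" and ?x1.0 = "grid c + x" and ?y1.0 = "grid r + 256 + x"])
       (use assms in \<open>auto simp: tile_def collides_tslash rebound_tslash of_rat_minus\<close>)
qed

lemma right_turn_down:
  assumes "beam_right c r x s b" "0 \<le> x" "x \<le> 1"
  shows "\<exists>b'. run {tbslash c r} (tile c r) 1 b b' \<and> beam_down c (r - 1) x s b'"
proof -
  obtain k :: nat where b: "b = bal (1 + s + 512 * real k) (grid c - 256) (grid r + 256 + x) 1 0"
    using assms by (auto simp: beam_right_def)
  show ?thesis
    unfolding b
    by (rule ex_run, rule_tac [2] beam_bal(3)[where k = "k + 1"],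
        rule tile_bounce[where ?s1.0 = "256 - x" and ?s2.0 = "256 + x" and ?x1.0 = "grid c - x" and ?y1.0 = "grid r + 256 + x"])
       (use assms in \<open>auto simp: tile_def collides_tbslash rebound_tbslash\<close>)
qed

lemma down_turn_left:
  assumes "beam_down c r x s b" "0 \<le> x" "x \<le> 1"
  shows "\<exists>b'. run {tslash (-2) c r} (tile c r) 1 b b' \<and> beam_left (c - 1) r x s b'"
proof -
  obtain k :: nat where b: "b = bal (1 + s + 512 * real k) (grid c - x) (grid r + 512) 0 (-1)"
    using assms by (auto simp: beam_down_def)
  show ?thesis
    unfolding b
    by (rule ex_run, rule_tac [2] beam_bal(4)[where k = "k + 1"],
        rule tile_bounce[where ?s1.0 = "256 + x" and ?s2.0 = "256 - x" and ?x1.0 = "grid c - x" and ?y1.0 = "grid r + 256 - x"])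
       (use assms in \<open>auto simp: tile_def collides_tslash rebound_tslash of_rat_minus\<close>)
qed

lemma left_turn_up:
  assumes "beam_left c r x s b" "0 \<le> x" "x \<le> 1"
  shows "\<exists>b'. run {tbslash c r} (tile c r) 1 b b' \<and> beam_up c (r + 1) x s b'"
proof -
  obtain k :: nat where b: "b = bal (1 + s + 512 * real k) (grid c + 256) (grid r + 256 - x) (-1) 0"
    using assms by (auto simp: beam_left_def)
  show ?thesis
    unfolding b
    by (rule ex_run, rule_tac [2] beam_bal(1)[where k = "k + 1"],
        rule tile_bounce[where ?s1.0 = "256 - x" and ?s2.0 = "256 + x" and ?x1.0 = "grid c + x" and ?y1.0 = "grid r + 256 - x"])
       (use assms in \<open>auto simp: tile_def collides_tbslash rebound_tbslash\<close>)
qed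

subsection \<open>Stack operations on offsets\<close>

text \<open>For \<open>p = True\<close> the symbol \<open>b\<close> is pushed, otherwise it is popped: the offset
  \<open>op_in p b + z\<close> with \<open>0 \<le> z \<le> op_width p\<close> becomes \<open>op_out p b + op_scale p * z\<close>.\<close>

definition op_scale :: "bool \<Rightarrow> rat" where "op_scale p = (if p then 1/4 else 4)"
definition op_width :: "bool \<Rightarrow> rat" where "op_width p = (if p then 1 else 1/4)"
definition op_in :: "bool \<Rightarrow> bool \<Rightarrow> rat" where "op_in p b = (if p then 0 else if b then 3/4 else 1/4)"
definition op_out :: "bool \<Rightarrow> bool \<Rightarrow> rat" where "op_out p b = (if p then if b then 3/4 else 1/4 else 0)"

lemmas op_defs = op_scale_def op_width_def op_in_def op_out_def

text \<open>How far the scaled beam lies too far to the left. Relative to the column, pushing gives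
  \<open>-4 + (z + 4) / 4 = z / 4 - 3\<close> and popping gives
  \<open>4 + 4 * (op_in p b + z - 4)\<close>.\<close>

definition xscale_shift :: "bool \<Rightarrow> bool \<Rightarrow> rat" where
  "xscale_shift p b = (if p then 3 + op_out p b else 12 - 4 * op_in p b)"

text \<open>The two parabolas cause a delay of twice the focal length times 3/4 or 3. This focal
  length makes that delay and the shift add up to one extra period.\<close>

definition xscale_focal :: "bool \<Rightarrow> bool \<Rightarrow> rat" where
  "xscale_focal p b = (512 - xscale_shift p b) / (if p then 3/2 else 6)"

text \<open>The axis lies beside the beam, which makes the projections of the two arcs disjoint.
  Pushing uses the concave side of the first parabola, popping the convex side.\<close>

definition xscale_parabs :: "bool \<Rightarrow> bool \<Rightarrow> int \<Rightarrow> int \<Rightarrow> component set" where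
  "xscale_parabs p b c r =
    (let \<alpha> = if p then -4 else 4; \<phi> = if p then 0 else 430; \<sigma> = if p then 1 else -1;
         f = xscale_focal p b; lo = op_in p b - \<alpha>; hi = op_in p b + op_width p - \<alpha>; q = op_scale p
     in {parab (col c + \<alpha>) (col r + \<phi>) \<sigma> f lo hi,
         parab (col c + \<alpha>) (col r + \<phi>) \<sigma> (q * f) (q * lo) (q * hi)})"

definition xscale_slashes :: "bool \<Rightarrow> bool \<Rightarrow> int \<Rightarrow> int \<Rightarrow> component set" where
  "xscale_slashes p b c r =
    (let d = xscale_shift p b; a = col c + op_out p b - d
     in {slash a (col r + 440) (-1) 2, slash (a + d) (col r + 440) (-1) 2})"

definition xscale :: "bool \<Rightarrow> bool \<Rightarrow> int \<Rightarrow> int \<Rightarrow> component set" where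
  "xscale p b c r = xscale_parabs p b c r \<union> xscale_slashes p b c r"

lemma xscale_parabs_confined:
  assumes "k \<in> xscale_parabs p b c r"
  shows "confined k (rect (grid c - 20) (grid c + 5) (grid r + 2) (grid r + 430))"
proof -
  note defs = xscale_parabs_def Let_def xscale_focal_def xscale_shift_def op_defs
  show ?thesis
    using assms unfolding defs
    apply (cases p; cases b; simp)
    apply (erule disjE; simp; rule confined_parab[where m = 16 and d = 10]; simp add: of_rat_add of_rat_divide of_rat_minus of_rat_diff of_rat_mult)+
    done
qed

lemma xscale_slashes_confined:
  assumes "k \<in> xscale_slashes p b c r"
  shows "confined k (rect (grid c - 20) (grid c + 5) (grid r + 438) (grid r + 443))"
proof -
  note defs = xscale_slashes_def Let_def xscale_shift_def op_defs
  show ?thesis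
    using assms unfolding defs
    apply (cases p; cases b; simp)
    apply (erule disjE; simp; rule confined_slash; simp add: of_rat_add of_rat_divide of_rat_minus of_rat_diff of_rat_mult)+
    done
qed

lemma xscale_parabs_run:
  assumes z: "0 \<le> z" "z \<le> of_rat (op_width p)"
  shows "run (xscale_parabs p b c r) (rect (grid c - 20) (grid c + 5) (grid r) (grid r + 435)) 2
    (bal t (grid c + (of_rat (op_in p b) + z)) (grid r) 0 1)
    (bal (t + 435 + (512 - of_rat (xscale_shift p b)))
       (grid c + of_rat (op_out p b) - of_rat (xscale_shift p b) + of_rat (op_scale p) * z) (grid r + 435) 0 1)"
proof -
  define \<alpha> :: rat where "\<alpha> = (if p then -4 else 4)"
  define \<phi> :: rat where "\<phi> = (if p then 0 else 430)"
  define \<sigma> :: rat where "\<sigma> = (if p then 1 else -1)"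
  define f where "f = xscale_focal p b"
  define q where "q = op_scale p"
  define lo where "lo = op_in p b - \<alpha>"
  define hi where "hi = op_in p b + op_width p - \<alpha>"
  define u where "u = of_rat (op_in p b) + z - of_rat \<alpha>"
  define F where "F = (of_rat f :: real)"
  define V where "V = F - u\<^sup>2 / (4 * F)"
  define y1 where "y1 = of_rat (col r + \<phi>) + of_rat \<sigma> * V"
  define y2 where "y2 = of_rat (col r + \<phi>) + of_rat \<sigma> * of_rat q * V"
  note defs = \<alpha>_def \<phi>_def \<sigma>_def f_def q_def lo_def hi_def u_def xscale_focal_def xscale_shift_def op_defs
    of_rat_add of_rat_diff of_rat_minus of_rat_mult of_rat_divide
  have F: "if p then 330 \<le> F \<and> F \<le> 342 else 80 \<le> F \<and> F \<le> 86"
    by (auto simp: F_def defs)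
  have u: "-5 \<le> u" "u \<le> 5" using z by (auto simp: defs split: if_splits)
  have "u\<^sup>2 \<le> 5\<^sup>2" using u by (intro abs_le_square_iff[THEN iffD1]) auto
  then have "0 \<le> u\<^sup>2 / (4 * F)" "u\<^sup>2 / (4 * F) \<le> 1" using F by (auto simp: divide_simps split: if_splits)
  then have uF: "F - 1 \<le> V" "V \<le> F" by (simp_all add: V_def)
  have C: "xscale_parabs p b c r = {parab (col c + \<alpha>) (col r + \<phi>) \<sigma> f lo hi,
         parab (col c + \<alpha>) (col r + \<phi>) \<sigma> (q * f) (q * lo) (q * hi)}"
    by (simp add: xscale_parabs_def Let_def \<alpha>_def \<phi>_def \<sigma>_def f_def q_def lo_def hi_def)
  have y1: "grid r < y1" "y1 \<le> grid r + 435"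
    using F uF by (auto simp: y1_def \<phi>_def \<sigma>_def of_rat_add of_rat_minus split: if_splits)
  have y2: "grid r \<le> y2" "y2 < grid r + 435"
    using F uF by (auto simp: y2_def \<phi>_def \<sigma>_def q_def op_scale_def of_rat_add of_rat_minus of_rat_divide split: if_splits)
  let ?R = "rect (grid c - 20) (grid c + 5) (grid r) (grid r + 435)"
  have X: "of_rat (col c + \<alpha>) + u = grid c + (of_rat (op_in p b) + z)"
    "of_rat (col c + \<alpha>) + of_rat q * u
       = grid c + of_rat (op_out p b) - of_rat (xscale_shift p b) + of_rat (op_scale p) * z"
    by (auto simp: defs)
  have T: "2 * F * (1 * of_rat \<sigma> * (1 - of_rat q)) = 512 - of_rat (xscale_shift p b)"
    by (auto simp: F_def defs)
  have "run (xscale_parabs p b c r) ?R 2 (bal t (of_rat (col c + \<alpha>) + u) (grid r) 0 1)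
    (bal (t + 1 * (grid r + 435 - grid r) + 2 * of_rat f * (1 * of_rat \<sigma> * (1 - of_rat q)))
       (of_rat (col c + \<alpha>) + of_rat q * u) (grid r + 435) 0 1)"
    unfolding C
  proof (rule confocal_run)
    show "0 < f" by (auto simp: defs)
    show "0 < q" "\<sigma> = 1 \<or> \<sigma> = - 1" "0 < 1 * of_rat \<sigma> * (1 - of_rat q :: real)"
      "q * hi < lo \<or> hi < q * lo" by (auto simp: defs)
    show "of_rat lo \<le> u" "u \<le> of_rat hi" using z by (auto simp: defs)
    show "y1 = of_rat (col r + \<phi>) + of_rat \<sigma> * (of_rat f - u\<^sup>2 / (4 * of_rat f))"
      "y2 = of_rat (col r + \<phi>) + of_rat \<sigma> * of_rat q * (of_rat f - u\<^sup>2 / (4 * of_rat f))"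
      by (simp_all add: y1_def y2_def F_def V_def)
    show "(of_rat (col c + \<alpha>) + u, grid r) \<in> ?R" "(of_rat (col c + \<alpha>) + u, y1) \<in> ?R"
      "(of_rat (col c + \<alpha>) + of_rat q * u, y2) \<in> ?R"
      "(of_rat (col c + \<alpha>) + of_rat q * u, grid r + 435) \<in> ?R"
      unfolding X using y1 y2 z by (auto simp: defs split: if_splits)
  qed (use y1 y2 in auto)
  then show ?thesis
    unfolding X T[unfolded F_def] by simp
qed

lemma xscale_run:
  assumes b: "beam_up c r (of_rat (op_in p b) + z) s b0" and z: "0 \<le> z" "z \<le> of_rat (op_width p)"
  shows "\<exists>b'. run (xscale p b c r) (tile c r) 4 b0 b' \<and>
    beam_up c (r + 1) (of_rat (op_out p b) + of_rat (op_scale p) * z) s b'"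
proof -
  obtain k :: nat where b0: "b0 = bal (1 + s + 512 * real k) (grid c + (of_rat (op_in p b) + z)) (grid r) 0 1"
    using b by (auto simp: beam_up_def)
  define d where "d = xscale_shift p b"
  define x where "x = of_rat (op_scale p) * z"
  define a where "a = col c + op_out p b - d"
  define o' where "o' = (of_rat (op_out p b) :: real)"
  have x: "0 \<le> x" "x \<le> 1" using z by (auto simp: x_def op_defs of_rat_divide split: if_splits)
  have d: "3 \<le> d" "(of_rat d :: real) \<le> 12" "0 < (of_rat d :: real)" and o: "0 \<le> o'" "o' + x \<le> 1"
    using z by (auto simp: o'_def d_def xscale_shift_def x_def op_defs of_rat_divide of_rat_diff of_rat_add split: if_splits)
  define D where "D = (of_rat d :: real)"
  have D: "3 \<le> D" "D \<le> 12" using d(2) of_rat_less_eq[of 3 d, where ?'a = real] d(1) by (auto simp: D_def)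
  have A: "of_rat a = grid c + o' - (of_rat d :: real)"
    by (simp add: a_def o'_def of_rat_add of_rat_diff)
  \<comment> \<open>Height 435 separates the parabolas, which end at 430, from the slashes, which
    begin above 438.\<close>
  let ?m = "bal (1 + s + 512 * real k + 435 + (512 - of_rat d)) (of_rat a + x) (grid r + 435) 0 1"
  have 1: "run (xscale p b c r) (tile c r) 2 b0 ?m"
    unfolding b0
  proof (rule run_local_mono)
    show "run (xscale_parabs p b c r) (rect (grid c - 20) (grid c + 5) (grid r) (grid r + 435)) 2
      (bal (1 + s + 512 * real k) (grid c + (of_rat (op_in p b) + z)) (grid r) 0 1) ?m"
      using xscale_parabs_run[OF z, of b c r "1 + s + 512 * real k"] by (simp add: A d_def x_def o'_def)
    show "avoids k (rect (grid c - 20) (grid c + 5) (grid r) (grid r + 435))"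
      if "k \<in> xscale p b c r - xscale_parabs p b c r" for k
      by (rule avoids_rect[OF xscale_slashes_confined[of k p b c r]]) (use that in \<open>auto simp: xscale_def\<close>)
  qed (auto simp: xscale_def tile_def intro!: rect_mono)
  have 2: "run (xscale p b c r) (tile c r) 2 ?m
     (bal (1 + s + 512 * real k + 435 + (512 - of_rat d) + of_rat d + (grid r + 512 - (grid r + 435)))
       (of_rat a + of_rat d + x) (grid r + 512) 0 1)"
  proof (rule run_local_mono)
    show "run (xscale_slashes p b c r) (rect (grid c - 20) (grid c + 5) (grid r + 435) (grid r + 512)) 2
      ?m (bal (1 + s + 512 * real k + 435 + (512 - of_rat d) + of_rat d + (grid r + 512 - (grid r + 435)))
       (of_rat a + of_rat d + x) (grid r + 512) 0 1)"
      unfolding xscale_slashes_def Let_def d_def[symmetric] a_def[symmetric]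
      by (rule shift_run) (use x d(1) D o in \<open>auto simp: A of_rat_add D_def[symmetric]\<close>)
    show "avoids k (rect (grid c - 20) (grid c + 5) (grid r + 435) (grid r + 512))"
      if "k \<in> xscale p b c r - xscale_slashes p b c r" for k
      by (rule avoids_rect[OF xscale_parabs_confined[of k p b c r]]) (use that in \<open>auto simp: xscale_def\<close>)
  qed (auto simp: xscale_def tile_def intro!: rect_mono)
  have e: "bal (1 + s + 512 * real k + 435 + (512 - of_rat d) + of_rat d + (grid r + 512 - (grid r + 435)))
       (of_rat a + of_rat d + x) (grid r + 512) 0 1
     = bal (1 + s + 512 * real (k + 2)) (grid c + (of_rat (op_out p b) + of_rat (op_scale p) * z)) (grid (r + 1)) 0 1"
    by (simp add: A x_def o'_def)
  have "run (xscale p b c r) (tile c r) 4 b0 (bal (1 + s + 512 * real (k + 2))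
     (grid c + (of_rat (op_out p b) + of_rat (op_scale p) * z)) (grid (r + 1)) 0 1)"
    using run_trans[OF 1 2] unfolding e by simp
  then show ?thesis
    by (rule ex_run) (rule beam_bal(1))
qed

subsection \<open>Tiles with moving walls\<close>

text \<open>The wall slides along its own line, so that it reflects like a wall at rest, and uncovers the
  beam between two of the time windows.\<close>

definition shutter :: "nat \<Rightarrow> int \<Rightarrow> int \<Rightarrow> component" where
  "shutter j c r =
     Moving_Wall (pt_slash (col c) (col r + 256) (if j = 0 then -2 else -10)) (pt_slash (col c) (col r + 256) 2)
       (1, 1) 257 ramp 20 512"

text \<open>With \<open>s\<close> equal to 16 times the stack value, an empty stack has
  \<open>s = 0\<close>, top \<open>False\<close> lies in the window from 4 to 8 and top
  \<open>True\<close> in that from 12 to 16. Test 0 detects the empty stack, test 1 distinguishes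
  the symbols.\<close>

definition low :: "nat \<Rightarrow> real \<Rightarrow> bool" where
  "low j s \<longleftrightarrow> (if j = 0 then s = 0 else 4 \<le> s \<and> s \<le> 8)"

definition high :: "nat \<Rightarrow> real \<Rightarrow> bool" where
  "high j s \<longleftrightarrow> (if j = 0 then 4 \<le> s else 12 \<le> s) \<and> s \<le> 16"

lemma valid_shutter: "valid_component (shutter j c r)"
  unfolding shutter_def by (rule valid_moving_ramp) auto

lemma collides_shutter: "collides (shutter j c r) (bal t x y u v) \<longleftrightarrow>
   (if j = 0 then -2 else -10) \<le> x - displacement 257 ramp 20 512 t - grid c \<and>
   x - displacement 257 ramp 20 512 t - grid c \<le> 2 \<and> y - grid r - 256 = x - grid c"
  by (auto simp: shutter_def segment_slash of_rat_add of_rat_minus)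

lemma rebound_shutter: "rebound (shutter j c r) (bal t x y u v) = (v, u)"
  by (auto simp: shutter_def reflect_slash Let_def)

text \<open>The displacement stays between 0 and \<open>t1\<close>, so every point of the wall is a
  convex combination of the four extreme positions of the endpoints.\<close>

lemma confined_moving_ramp:
  assumes "0 < t1" "t1 < 512" "convex A" "real_point P \<in> A" "real_point Q \<in> A"
    "real_point P + of_rat t1 *\<^sub>R real_point d \<in> A" "real_point Q + of_rat t1 *\<^sub>R real_point d \<in> A"
  shows "confined (Moving_Wall P Q d t0 ramp t1 512) A"
  unfolding confined_def
proof (intro allI impI)
  fix b assume c: "collides (Moving_Wall P Q d t0 ramp t1 512) b"
  define h where "h = displacement t0 ramp t1 512 (time b) / of_rat t1"
  have t1: "0 < (of_rat t1 :: real)" using assms by simp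
  have h: "0 \<le> h" "h \<le> 1" "h * of_rat t1 = displacement t0 ramp t1 512 (time b)"
    using displacement_ramp_bounds[OF assms(1,2), of t0 "time b"] t1 by (auto simp: h_def)
  obtain w where w: "0 \<le> w" "w \<le> 1"
    "pos b - displacement t0 ramp t1 512 (time b) *\<^sub>R real_point d = (1 - w) *\<^sub>R real_point P + w *\<^sub>R real_point Q"
    using c by (auto simp: segment_def in_segment)
  have 1: "(1 - h) *\<^sub>R real_point P + h *\<^sub>R (real_point P + of_rat t1 *\<^sub>R real_point d) \<in> A"
    "(1 - h) *\<^sub>R real_point Q + h *\<^sub>R (real_point Q + of_rat t1 *\<^sub>R real_point d) \<in> A"
    using h assms by (auto intro!: convexD)
  have "(1 - w) *\<^sub>R ((1 - h) *\<^sub>R real_point P + h *\<^sub>R (real_point P + of_rat t1 *\<^sub>R real_point d))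
    + w *\<^sub>R ((1 - h) *\<^sub>R real_point Q + h *\<^sub>R (real_point Q + of_rat t1 *\<^sub>R real_point d)) \<in> A"
    using w by (intro convexD[OF assms(3) 1]) auto
  moreover have "(1 - w) *\<^sub>R ((1 - h) *\<^sub>R real_point P + h *\<^sub>R (real_point P + of_rat t1 *\<^sub>R real_point d))
    + w *\<^sub>R ((1 - h) *\<^sub>R real_point Q + h *\<^sub>R (real_point Q + of_rat t1 *\<^sub>R real_point d))
    = ((1 - w) *\<^sub>R real_point P + w *\<^sub>R real_point Q) + (h * of_rat t1) *\<^sub>R real_point d"
    by (simp add: algebra_simps)
  ultimately show "pos b \<in> A" unfolding h(3) w(3)[symmetric] by simp
qed

lemma confined_shutter: "confined (shutter j c r) (inner_tile c r)"
  unfolding shutter_def inner_tile_def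
  by (rule confined_moving_ramp) (auto simp: pt_slash_def of_rat_add of_rat_diff)

text \<open>The ball meets the diagonal when the wall has slid by \<open>s + x\<close>. Relative to
  the wall its offset is then \<open>-s\<close>: the spatial offset cancels, and the left ends -2
  and -10 turn into the thresholds 2 and 10 for \<open>s\<close>.\<close>

lemma shutter_displacement:
  assumes "t = 1 + s + 512 * real k + 256 + x" "0 \<le> s" "s \<le> 16" "0 \<le> x" "x \<le> 1"
  shows "displacement 257 ramp 20 512 t = s + x"
  using displacement_ramp[of "s + x" 257 20 k] assms by (simp add: algebra_simps)

lemma shutter_low:
  assumes b: "beam_up c r x s b" and x: "0 \<le> x" "x \<le> 1" and j: "low j s"
  shows "\<exists>b'. run {shutter j c r} (tile c r) 1 b b' \<and> beam_right (c + 1) r x s b'"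
proof -
  let ?C = "{shutter j c r}"
  obtain k :: nat where b: "b = bal (1 + s + 512 * real k) (grid c + x) (grid r) 0 1"
    using assms by (auto simp: beam_up_def)
  have s: "0 \<le> s" "s \<le> 16" using j by (auto simp: low_def split: if_splits)
  note cs = tile_def collides_shutter rebound_shutter
  have "run ?C (tile c r) 1 b (bal (1 + s + 512 * real k + 256 + x) (grid c + x) (grid r + 256 + x) 1 0)"
    unfolding b
  proof (rule run_hitI[where c = "shutter j c r" and s = "256 + x"])
    show "collides (shutter j c r) (bal (1 + s + 512 * real k + 256 + x) (grid c + x) (grid r + 256 + x) 0 1)"
      unfolding collides_shutter shutter_displacement[OF refl s x] using x j by (auto simp: low_def)
  qed (use x in \<open>auto simp: cs\<close>)
  moreover have "run ?C (tile c r) 0 (bal (1 + s + 512 * real k + 256 + x) (grid c + x) (grid r + 256 + x) 1 0)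
     (bal (1 + s + 512 * real (k + 1)) (grid (c + 1) - 256) (grid r + 256 + x) 1 0)"
    by (rule run_flyI[where s = "256 - x"]) (use x in \<open>auto simp: cs\<close>)
  ultimately show ?thesis
    by (rule ex_run_trans) (rule beam_bal(2))
qed

lemma shutter_high:
  assumes b: "beam_up c r x s b" and x: "0 \<le> x" "x \<le> 1" and j: "high j s"
  shows "\<exists>b'. run {shutter j c r} (tile c r) 0 b b' \<and> beam_up c (r + 1) x s b'"
proof -
  obtain k :: nat where b: "b = bal (1 + s + 512 * real k) (grid c + x) (grid r) 0 1"
    using assms by (auto simp: beam_up_def)
  have s: "0 \<le> s" "s \<le> 16" using j by (auto simp: high_def split: if_splits)
  have "\<not> collides (shutter j c r) (bal (1 + s + 512 * real k + d) (grid c + x + d * 0) (grid r + d * 1) 0 1)"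
    for d
  proof
    assume *: "collides (shutter j c r) (bal (1 + s + 512 * real k + d) (grid c + x + d * 0) (grid r + d * 1) 0 1)"
    then have "d = 256 + x" by (simp add: collides_shutter)
    then show False using * j s x shutter_displacement[of "1 + s + 512 * real k + d" s k x]
      by (auto simp: collides_shutter high_def add.assoc split: if_splits)
  qed
  then show ?thesis
    unfolding b
    by (intro exI conjI, rule_tac [2] beam_bal(1)[where k = "k + 1"], intro run_flyI[where s = 512])
       (use assms in \<open>auto simp: tile_def\<close>)
qed

text \<open>To scale the temporal offset, it is exchanged with the spatial one, scaled by a pair of
  parabolas and exchanged back.\<close>

definition ts_pos :: "bool \<Rightarrow> bool \<Rightarrow> rat" where
  "ts_pos p b = (if p then -41 else -47 - 16 * op_in p b)"
text \<open>The second exchange receives a spatial offset of at most 4 after a push and 16 after a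
  pop, and a temporal offset of at most 1.\<close>

definition ts_width :: "bool \<Rightarrow> rat" where
  "ts_width p = (if p then 5 else 17)"
text \<open>The delay of the parabolas between the two exchanges. It solves the time balance
  \<open>765 + D + 3 * w + 4 - q * wd + 345 + d + 77 = 1 + out + 512 * 3\<close>, that is, the
  passage takes three periods apart from the new temporal offset.\<close>

definition ts_delay :: "bool \<Rightarrow> bool \<Rightarrow> rat" where
  "ts_delay p b = (if p then 286 + 16 * op_out p b else 244 - 16 * op_in p b)"
definition ts_shift :: "bool \<Rightarrow> bool \<Rightarrow> rat" where
  "ts_shift p b = ts_width p + 3 - ts_pos p b"

text \<open>Phase 1 plus a flight of length 400 gives 401; the width 17 bounds the sum of a spatial
  offset up to 1 and a temporal offset up to 16.\<close>

definition ts_swap1 :: "int \<Rightarrow> int \<Rightarrow> component set" where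
  "ts_swap1 c r = {swap_wall1 1 (col c) (col r + 400) 17 401, swap_wall2 1 (col c) (col r + 400) 17 401}"

text \<open>The ball arrives at \<open>401 + 55 - x + 310\<close> plus the delay, where
  \<open>55 = 3 * 17 + 4\<close> stems from the first exchange. Starting at 765 plus the delay makes
  \<open>1 - x\<close> the nonnegative temporal offset.\<close>

definition ts_swap2 :: "bool \<Rightarrow> bool \<Rightarrow> int \<Rightarrow> int \<Rightarrow> component set" where
  "ts_swap2 p b c r =
    {swap_wall1 (-1) (col c + ts_pos p b) (col r + 90) (ts_width p) (765 + ts_delay p b),
     swap_wall2 (-1) (col c + ts_pos p b) (col r + 90) (ts_width p) (765 + ts_delay p b)}"

text \<open>The ranges cover the beam behind the first exchange, whose balls fall at the horizontal
  offset \<open>-19 - s\<close>. The divisors 3/2 and 6 convert the desired delay into a focal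
  length.\<close>

definition ts_parabs :: "bool \<Rightarrow> bool \<Rightarrow> int \<Rightarrow> int \<Rightarrow> component set" where
  "ts_parabs p b c r =
    (let \<alpha> = if p then -43 else -15 - 16 * op_in p b; \<phi> = if p then 330 else 100; \<sigma> = if p then -1 else 1;
         f = ts_delay p b / (if p then 3/2 else 6); lo = if p then 8 else -8; hi = if p then 24 else -4; q = op_scale p
     in {parab (col c + \<alpha>) (col r + \<phi>) \<sigma> f lo hi,
         parab (col c + \<alpha>) (col r + \<phi>) \<sigma> (q * f) (q * lo) (q * hi)})"

definition ts_slashes :: "bool \<Rightarrow> bool \<Rightarrow> int \<Rightarrow> int \<Rightarrow> component set" where
  "ts_slashes p b c r =
    (let d = ts_shift p b; a = col c - d
     in {slash a (col r + 440) (-1) 2, slash (a + d) (col r + 440) (-1) 2})"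

definition moving_tscale :: "bool \<Rightarrow> bool \<Rightarrow> int \<Rightarrow> int \<Rightarrow> component set" where
  "moving_tscale p b c r = ts_swap1 c r \<union> ts_parabs p b c r \<union> ts_swap2 p b c r \<union> ts_slashes p b c r"

lemmas ts_defs = ts_pos_def ts_width_def ts_delay_def ts_shift_def op_defs
lemmas of_rat_simps = of_rat_add of_rat_diff of_rat_minus of_rat_mult of_rat_divide

lemma ts_swap1_confined:
  assumes "k \<in> ts_swap1 c r"
  shows "confined k (rect (grid c - 40) (grid c + 20) (grid r + 401) (grid r + 430))"
  using assms unfolding ts_swap1_def swap_wall1_def swap_wall2_def diag_def
  apply simp
  apply (erule disjE; simp; rule confined_moving_ramp; simp add: of_rat_simps)
  done

lemma ts_swap2_confined:
  assumes "k \<in> ts_swap2 p b c r"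
  shows "confined k (rect (grid c - 100) (grid c - 12) (grid r + 60) (grid r + 89))"
  using assms unfolding ts_swap2_def swap_wall1_def swap_wall2_def diag_def ts_defs
  apply (cases p; cases b; simp)
  apply (erule disjE; simp; rule confined_moving_ramp; simp add: of_rat_simps)+
  done

lemma ts_parabs_confined:
  assumes "k \<in> ts_parabs p b c r"
  shows "confined k (rect (grid c + of_rat (ts_pos p b) - 4) (grid c - 15) (grid r + 91) (grid r + 399))"
  using assms unfolding ts_parabs_def Let_def ts_defs
  apply (cases p; cases b; simp)
  apply (erule disjE; simp; rule confined_parab[where m = 32 and d = 10]; simp add: of_rat_simps)+
  done

lemma ts_slashes_confined:
  assumes "k \<in> ts_slashes p b c r"
  shows "confined k (rect (grid c - 90) (grid c + 5) (grid r + 438) (grid r + 443))"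
  using assms unfolding ts_slashes_def Let_def ts_defs
  apply (cases p; cases b; simp)
  apply (erule disjE; simp; rule confined_slash; simp add: of_rat_simps)+
  done

lemma ts_parabs_run:
  assumes z: "0 \<le> z" "z \<le> 16 * of_rat (op_width p)"
  shows "run (ts_parabs p b c r) (rect (grid c + of_rat (ts_pos p b) - 4) (grid c - 15) (grid r + 90) (grid r + 400)) 2
    (bal t (grid c - 19 - (16 * of_rat (op_in p b) + z)) (grid r + 400) 0 (-1))
    (bal (t + 310 + of_rat (ts_delay p b))
       (grid c + of_rat (ts_pos p b) + of_rat (op_scale p) * (16 * of_rat (op_width p) - z)) (grid r + 90) 0 (-1))"
proof -
  define \<alpha> :: rat where "\<alpha> = (if p then -43 else -15 - 16 * op_in p b)"
  define \<phi> :: rat where "\<phi> = (if p then 330 else 100)"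
  define \<sigma> :: rat where "\<sigma> = (if p then -1 else 1)"
  define f where "f = ts_delay p b / (if p then 3/2 else 6)"
  define q where "q = op_scale p"
  define lo :: rat where "lo = (if p then 8 else -8)"
  define hi :: rat where "hi = (if p then 24 else -4)"
  define u :: real where "u = (if p then 24 - z else -4 - z)"
  define F where "F = (of_rat f :: real)"
  define V where "V = F - u\<^sup>2 / (4 * F)"
  define y1 where "y1 = of_rat (col r + \<phi>) + of_rat \<sigma> * V"
  define y2 where "y2 = of_rat (col r + \<phi>) + of_rat \<sigma> * of_rat q * V"
  note defs = \<alpha>_def \<phi>_def \<sigma>_def f_def q_def lo_def hi_def u_def ts_defs of_rat_simps
  have F: "if p then 193 \<le> F \<and> F \<le> 199 else 38 \<le> F \<and> F \<le> 40"
    by (auto simp: F_def defs)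
  have u: "if p then 0 \<le> u \<and> u \<le> 24 else -8 \<le> u \<and> u \<le> 0" using z by (auto simp: defs split: if_splits)
  have "u\<^sup>2 \<le> (if p then 24 else 8)\<^sup>2" using u by (intro abs_le_square_iff[THEN iffD1]) (auto split: if_splits)
  then have "0 \<le> u\<^sup>2 / (4 * F)" "u\<^sup>2 / (4 * F) \<le> 1" using F by (auto simp: divide_simps split: if_splits)
  then have uF: "F - 1 \<le> V" "V \<le> F" by (simp_all add: V_def)
  have C: "ts_parabs p b c r = {parab (col c + \<alpha>) (col r + \<phi>) \<sigma> f lo hi,
         parab (col c + \<alpha>) (col r + \<phi>) \<sigma> (q * f) (q * lo) (q * hi)}"
    by (simp add: ts_parabs_def Let_def \<alpha>_def \<phi>_def \<sigma>_def f_def q_def lo_def hi_def)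
  have y1: "grid r + 90 \<le> y1" "y1 < grid r + 400"
    using F uF by (auto simp: y1_def \<phi>_def \<sigma>_def of_rat_simps split: if_splits)
  have y2: "grid r + 90 < y2" "y2 \<le> grid r + 400"
    using F uF by (auto simp: y2_def \<phi>_def \<sigma>_def q_def op_scale_def of_rat_simps split: if_splits)
  let ?R = "rect (grid c + of_rat (ts_pos p b) - 4) (grid c - 15) (grid r + 90) (grid r + 400)"
  have X: "of_rat (col c + \<alpha>) + u = grid c - 19 - (16 * of_rat (op_in p b) + z)"
    "of_rat (col c + \<alpha>) + of_rat q * u
       = grid c + of_rat (ts_pos p b) + of_rat (op_scale p) * (16 * of_rat (op_width p) - z)"
    by (auto simp: defs)
  have T: "2 * F * (-1 * of_rat \<sigma> * (1 - of_rat q)) = of_rat (ts_delay p b)"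
    by (auto simp: F_def defs)
  have "run (ts_parabs p b c r) ?R 2 (bal t (of_rat (col c + \<alpha>) + u) (grid r + 400) 0 (-1))
    (bal (t + -1 * (grid r + 90 - (grid r + 400)) + 2 * of_rat f * (-1 * of_rat \<sigma> * (1 - of_rat q)))
       (of_rat (col c + \<alpha>) + of_rat q * u) (grid r + 90) 0 (-1))"
    unfolding C
  proof (rule confocal_run)
    show "0 < f" by (auto simp: defs)
    show "0 < q" "\<sigma> = 1 \<or> \<sigma> = - 1" "0 < -1 * of_rat \<sigma> * (1 - of_rat q :: real)"
      "q * hi < lo \<or> hi < q * lo" by (auto simp: defs)
    show "of_rat lo \<le> u" "u \<le> of_rat hi" using z by (auto simp: defs split: if_splits)
    show "y1 = of_rat (col r + \<phi>) + of_rat \<sigma> * (of_rat f - u\<^sup>2 / (4 * of_rat f))"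
      "y2 = of_rat (col r + \<phi>) + of_rat \<sigma> * of_rat q * (of_rat f - u\<^sup>2 / (4 * of_rat f))"
      by (simp_all add: y1_def y2_def F_def V_def)
    show "(of_rat (col c + \<alpha>) + u, grid r + 400) \<in> ?R" "(of_rat (col c + \<alpha>) + u, y1) \<in> ?R"
      "(of_rat (col c + \<alpha>) + of_rat q * u, y2) \<in> ?R"
      "(of_rat (col c + \<alpha>) + of_rat q * u, grid r + 90) \<in> ?R"
      unfolding X using y1 y2 z by (auto simp: defs split: if_splits)
  qed (use y1 y2 in auto)
  then show ?thesis
    unfolding X T[unfolded F_def] by simp
qed

text \<open>With \<open>i\<close>, \<open>q\<close> and \<open>wd\<close> as defined in the proof,
  the pair of spatial and temporal offset develops from \<open>(x, i + z)\<close> to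
  \<open>(- (i + z), - x)\<close> by the first exchange. The parabolas and a new choice of origins
  turn it into \<open>(q * (wd - z), 1 - x)\<close>, and the second exchange into
  \<open>(x - 1, q * (z - wd))\<close>, which equals \<open>(x, q * z)\<close> up to
  constants.\<close>

lemma moving_tscale_run:
  assumes b0: "beam_up c r x (16 * of_rat (op_in p b) + z) b0" and x: "0 \<le> x" "x \<le> 1"
    and z: "0 \<le> z" "z \<le> 16 * of_rat (op_width p)"
  shows "\<exists>b'. run (moving_tscale p b c r) (tile c r) 8 b0 b' \<and>
    beam_up c (r + 1) x (16 * of_rat (op_out p b) + of_rat (op_scale p) * z) b'"
proof -
  define C where "C = (grid c :: real)"
  define Y where "Y = (grid r :: real)"
  define i where "i = (16 * of_rat (op_in p b) :: real)"
  define out where "out = (16 * of_rat (op_out p b) :: real)"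
  define q where "q = (of_rat (op_scale p) :: real)"
  define wd where "wd = (16 * of_rat (op_width p) :: real)"
  define X where "X = (of_rat (ts_pos p b) :: real)"
  define w where "w = (of_rat (ts_width p) :: real)"
  define D where "D = (of_rat (ts_delay p b) :: real)"
  define d where "d = (of_rat (ts_shift p b) :: real)"
  note defs = i_def out_def q_def wd_def X_def w_def D_def d_def ts_defs of_rat_simps
  obtain k :: nat where b0': "b0 = bal (1 + (i + z) + 512 * real k) (C + x) Y 0 1"
    using b0 by (auto simp: beam_up_def i_def C_def Y_def)
  let ?G = "moving_tscale p b c r"
  let ?A = "ts_swap1 c r" and ?B = "ts_parabs p b c r" and ?S = "ts_swap2 p b c r" and ?H = "ts_slashes p b c r"
  have conf: "k \<in> ?A \<Longrightarrow> confined k (rect (C - 40) (C + 20) (Y + 401) (Y + 430))"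
    "k \<in> ?B \<Longrightarrow> confined k (rect (C + X - 4) (C - 15) (Y + 91) (Y + 399))"
    "k \<in> ?S \<Longrightarrow> confined k (rect (C - 100) (C - 12) (Y + 60) (Y + 89))"
    "k \<in> ?H \<Longrightarrow> confined k (rect (C - 90) (C + 5) (Y + 438) (Y + 443))" for k
    using ts_swap1_confined ts_parabs_confined ts_swap2_confined ts_slashes_confined
    unfolding C_def Y_def X_def by blast+
  have num: "0 \<le> i" "i + wd \<le> 16" "d = w + 3 - X" "49 \<le> d" "d \<le> 79" "- 59 \<le> X" "5 \<le> w"
    "q * wd + 1 = w" "765 + D + 3 * w + 4 - q * wd + 345 + d + 77 = 1 + out + 512 * 3" "0 \<le> q"
    by (auto simp: defs)
  have z': "z \<le> wd" using z by (simp add: wd_def)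
  have zs: "0 \<le> i + z" "x + (i + z) \<le> 17" "0 \<le> q * (wd - z)" "q * (wd - z) + (1 - x) \<le> w" "q * z \<le> q * wd" "0 \<le> q * z"
    using num x z z' mult_left_mono[OF z' num(10)] by (auto simp: algebra_simps)
  have sub: "?G = ?A \<union> ?B \<union> ?S \<union> ?H" by (simp add: moving_tscale_def)
  have tl: "rect x0 x1 y0 y1 \<subseteq> tile c r" if "C - 256 \<le> x0" "x1 \<le> C + 256" "Y \<le> y0" "y1 \<le> Y + 512" for x0 x1 y0 y1
    using that unfolding tile_def C_def Y_def by (intro rect_mono) auto
  have gap: "1 - d < X - 4" "49 \<le> d" "d \<le> 79" using num(3-5,7) by linarith+
  let ?b1 = "bal (401 + 512 * real k + (i + z)) (C + x) (Y + 400) 0 1"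
  let ?b2 = "bal (401 + 512 * real k + 55 - x) (C - 19 - (i + z)) (Y + 400) 0 (-1)"
  let ?b3 = "bal (401 + 512 * real k + 55 - x + 310 + D) (C + X + q * (wd - z)) (Y + 90) 0 (-1)"
  let ?b4 = "bal (765 + D + 512 * real k + 3 * w + 4 - q * (wd - z)) (C - d + x) (Y + 90) 0 1"
  let ?b5 = "bal (765 + D + 512 * real k + 3 * w + 4 - q * (wd - z) + 345) (C - d + x) (Y + 435) 0 1"
  let ?b6 = "bal (765 + D + 512 * real k + 3 * w + 4 - q * (wd - z) + 345 + d + 77) (C + x) (Y + 512) 0 1"
  have 0: "run ?G (tile c r) 0 b0 ?b1"
  proof (rule run_mono)
    show "run ?G (rect C (C + 1) Y (Y + 400)) 0 b0 ?b1"
      unfolding b0'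
    proof (rule run_strip[where s = 400])
      show "avoids k (rect C (C + 1) Y (Y + 400))" if "k \<in> ?G" for k
        using that unfolding sub by (elim UnE; intro avoids_rect[OF conf(1)] avoids_rect[OF conf(2)]
            avoids_rect[OF conf(3)] avoids_rect[OF conf(4)]) auto
    qed (use x in auto)
  qed (rule tl; simp)
  have 1: "run ?G (tile c r) 2 ?b1 ?b2"
  proof (rule run_local_mono)
    have "run ?A (rect (C - 40) (C + 20) (Y + 400) (Y + 430)) 2
       (bal (401 + real k * 512 + (i + z)) (of_rat (col c) + x) (of_rat (col r + 400)) 0 (of_rat 1))
       (bal (401 + real k * 512 + 3 * of_rat 17 + 4 - x) (of_rat (col c) - (of_rat 17 + 2) - (i + z)) (of_rat (col r + 400)) 0 (- of_rat 1))"
      unfolding ts_swap1_def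
      by (rule swap_run) (use x zs num in \<open>auto simp: of_rat_add C_def Y_def\<close>)
    then show "run ?A (rect (C - 40) (C + 20) (Y + 400) (Y + 430)) 2 ?b1 ?b2"
      by (simp add: of_rat_add C_def Y_def algebra_simps)
    show "avoids k (rect (C - 40) (C + 20) (Y + 400) (Y + 430))" if "k \<in> ?G - ?A" for k
      using that unfolding sub by (elim UnE DiffE; (intro avoids_rect[OF conf(2)]
            avoids_rect[OF conf(3)] avoids_rect[OF conf(4)])?) auto
  qed ((rule tl; simp) | (simp add: sub; blast))+
  have 2: "run ?G (tile c r) 2 ?b2 ?b3"
  proof (rule run_local_mono)
    show "run ?B (rect (C + X - 4) (C - 15) (Y + 90) (Y + 400)) 2 ?b2 ?b3"
      using ts_parabs_run[OF z, of b c r "401 + 512 * real k + 55 - x"]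
      by (simp add: C_def Y_def X_def D_def i_def q_def wd_def)
    show "avoids k (rect (C + X - 4) (C - 15) (Y + 90) (Y + 400))" if "k \<in> ?G - ?B" for k
      using that unfolding sub by (elim UnE DiffE; (intro avoids_rect[OF conf(1)]
            avoids_rect[OF conf(3)] avoids_rect[OF conf(4)])?) auto
  qed (insert num, ((rule tl; simp) | (simp add: sub; blast))+)
  have 3: "run ?G (tile c r) 2 ?b3 ?b4"
  proof (rule run_local_mono)
    have W: "of_rat (col c + ts_pos p b) = C + X" "of_rat (col r + 90) = Y + 90" "of_rat (ts_width p) = w" "(of_rat (-1) :: real) = -1"
      by (simp_all add: of_rat_simps C_def Y_def X_def w_def)
    have e3: "C + X - (w + 2) - (1 - x) = C - d + x" using num(3) by simp
    have t3: "765 + D + real k * 512 + (1 - x) = 401 + 512 * real k + 55 - x + 310 + D"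
      "765 + D + real k * 512 + 3 * w + 4 - q * (wd - z) = 765 + D + 512 * real k + 3 * w + 4 - q * (wd - z)"
      by simp_all
    have "run ?S (rect (C - 100) (C - 12) (Y + 60) (Y + 90)) 2
       (bal (765 + D + real k * 512 + (1 - x)) (of_rat (col c + ts_pos p b) + q * (wd - z)) (of_rat (col r + 90)) 0 (of_rat (-1)))
       (bal (765 + D + real k * 512 + 3 * of_rat (ts_width p) + 4 - q * (wd - z))
          (of_rat (col c + ts_pos p b) - (of_rat (ts_width p) + 2) - (1 - x)) (of_rat (col r + 90)) 0 (- of_rat (-1)))"
      unfolding ts_swap2_def
    proof (rule swap_run)
      define v where "v = q * (wd - z)"
      have v: "0 \<le> v" "v + (1 - x) \<le> w" using zs(3,4) by (simp_all add: v_def)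
      have w: "w \<le> 17" "X + w \<le> -30" by (auto simp: defs)
      show "(of_rat (col c + ts_pos p b) + q * (wd - z), of_rat (col r + 90)) \<in> rect (C - 100) (C - 12) (Y + 60) (Y + 90)"
        "(of_rat (col c + ts_pos p b) + q * (wd - z), of_rat (col r + 90) + of_rat (- 1) * (of_rat (ts_width p) + 1 - q * (wd - z) - (1 - x)))
          \<in> rect (C - 100) (C - 12) (Y + 60) (Y + 90)"
        "(of_rat (col c + ts_pos p b) - (of_rat (ts_width p) + 2) - (1 - x), of_rat (col r + 90)) \<in> rect (C - 100) (C - 12) (Y + 60) (Y + 90)"
        unfolding W in_rect v_def[symmetric] using v num(6,7) w x by auto
      define h where "h = (w + 2 - q * (wd - z) - (1 - x)) / 2"
      have "0 \<le> h" "h \<le> 10"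
        unfolding h_def v_def[symmetric] using v w x by simp_all
      then have h: "0 \<le> h" "h \<le> 10" .
      show "(of_rat (col c + ts_pos p b) - (of_rat (ts_width p) + 2) - (1 - x),
          of_rat (col r + 90) + of_rat (- 1) * (of_rat (ts_width p) + 1 + (of_rat (ts_width p) + 2 - q * (wd - z) - (1 - x)) / 2))
          \<in> rect (C - 100) (C - 12) (Y + 60) (Y + 90)"
        unfolding W h_def[symmetric] in_rect using h num(6,7) w x by auto
      show "q * (wd - z) + (1 - x) \<le> of_rat (ts_width p)" using zs(4) by (simp add: w_def)
    qed (use x zs(3) in \<open>auto simp: of_rat_add D_def ts_width_def\<close>)
    then show "run ?S (rect (C - 100) (C - 12) (Y + 60) (Y + 90)) 2 ?b3 ?b4"
      unfolding W e3 t3 minus_minus .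
    show "avoids k (rect (C - 100) (C - 12) (Y + 60) (Y + 90))" if "k \<in> ?G - ?S" for k
      using that unfolding sub by (elim UnE DiffE; (intro avoids_rect[OF conf(1)]
            avoids_rect[OF conf(2)] avoids_rect[OF conf(4)])?) auto
  qed ((rule tl; simp) | (simp add: sub; blast))+
  have 4: "run ?G (tile c r) 0 ?b4 ?b5"
  proof (rule run_mono)
    show "run ?G (rect (C - d) (C - d + 1) (Y + 90) (Y + 435)) 0 ?b4 ?b5"
    proof (rule run_strip[where s = 345])
      show "avoids k (rect (C - d) (C - d + 1) (Y + 90) (Y + 435))" if "k \<in> ?G" for k
        using that gap unfolding sub by (elim UnE; intro avoids_rect[OF conf(1)] avoids_rect[OF conf(2)]
            avoids_rect[OF conf(3)] avoids_rect[OF conf(4)]) auto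
    qed (use x in auto)
  qed (insert gap, rule tl; simp)
  have 5: "run ?G (tile c r) 2 ?b5 ?b6"
  proof (rule run_local_mono)
    have a: "of_rat (col c - ts_shift p b) = C - d" by (simp add: of_rat_diff C_def d_def)
    have "run ?H (rect (C - 90) (C + 5) (Y + 435) (Y + 512)) 2
       (bal (765 + D + 512 * real k + 3 * w + 4 - q * (wd - z) + 345) (of_rat (col c - ts_shift p b) + x) (Y + 435) 0 1)
       (bal (765 + D + 512 * real k + 3 * w + 4 - q * (wd - z) + 345 + of_rat (ts_shift p b) + (Y + 512 - (Y + 435)))
         (of_rat (col c - ts_shift p b) + of_rat (ts_shift p b) + x) (Y + 512) 0 1)"
      unfolding ts_slashes_def Let_def
    proof (rule shift_run)
      show "3 \<le> ts_shift p b" by (auto simp: ts_defs)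
    qed (use x gap in \<open>auto simp: a d_def[symmetric] of_rat_add Y_def\<close>)
    then show "run ?H (rect (C - 90) (C + 5) (Y + 435) (Y + 512)) 2 ?b5 ?b6"
      by (simp add: a d_def[symmetric])
    show "avoids k (rect (C - 90) (C + 5) (Y + 435) (Y + 512))" if "k \<in> ?G - ?H" for k
      using that unfolding sub by (elim UnE DiffE; (intro avoids_rect[OF conf(1)]
            avoids_rect[OF conf(2)] avoids_rect[OF conf(3)])?) auto
  qed ((rule tl; simp) | (simp add: sub; blast))+
  have "765 + D + 512 * real k + 3 * w + 4 - q * (wd - z) + 345 + d + 77 = 1 + (out + q * z) + 512 * real (k + 3)"
    using num(9) by (simp add: algebra_simps)
  then have e: "?b6 = bal (1 + (out + q * z) + 512 * real (k + 3)) (grid c + x) (grid (r + 1)) 0 1"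
    by (simp add: C_def Y_def)
  have "run ?G (tile c r) (0 + (2 + (2 + (2 + (0 + 2))))) b0 ?b6"
    using 0 1 2 3 4 5 by (blast intro: run_trans)
  then have "run ?G (tile c r) 8 b0 (bal (1 + (out + q * z) + 512 * real (k + 3)) (grid c + x) (grid (r + 1)) 0 1)"
    unfolding e by simp
  then show ?thesis
    unfolding out_def q_def by (rule ex_run) (rule beam_bal(1))
qed

subsection \<open>Tiles with bumpers\<close>

lemma bumper_active_in:
  "0 \<le> \<tau> \<Longrightarrow> \<tau> < of_rat t1 \<Longrightarrow> \<tau> < 512 \<Longrightarrow> bumper_active t0 t1 512 (of_rat t0 + \<tau> + real k * 512)"
  using rmod_period[of \<tau> 512 k] by (simp add: bumper_active_def add.assoc)

text \<open>A negative phase belongs to the end of the previous period, or, in the case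
  \<open>k = 0\<close>, to the time before the bumper starts.\<close>

lemma bumper_resting:
  assumes "- 512 < \<tau>" "\<tau> < 0" "of_rat t1 \<le> \<tau> + 512"
  shows "\<not> bumper_active t0 t1 512 (of_rat t0 + \<tau> + real k * 512)"
proof (cases k)
  case 0 then show ?thesis using assms by (simp add: bumper_active_def)
next
  case (Suc l)
  have "(\<tau> + real k * 512) rmod 512 = \<tau> + 512"
    using rmod_period[of "\<tau> + 512" 512 l] assms by (simp add: Suc algebra_simps)
  then show ?thesis using assms by (simp add: bumper_active_def add.assoc)
qed

definition still :: rat_fun where "still = ([:0:], [:1:])"

lemma eval_still [simp]: "rat_fun_eval still t = 0"
  by (simp add: rat_fun_eval_def still_def)

text \<open>With this order of the endpoints a rising or leftward ball passes, while a falling or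
  rightward one is reflected. The gate can thus stand across a beam and catch only what a bumper has
  sent back.\<close>

definition back_gate :: "rat \<Rightarrow> rat \<Rightarrow> component" where
  "back_gate a b = Gate (pt_slash a b 2) (pt_slash a b (-2))"
definition back_bgate :: "rat \<Rightarrow> rat \<Rightarrow> component" where
  "back_bgate a b = Gate (pt_bslash a b 2) (pt_bslash a b (-2))"

lemma collides_back_gate: "collides (back_gate a b) (bal t x y u v) \<longleftrightarrow>
   -2 \<le> x - of_rat a \<and> x - of_rat a \<le> 2 \<and> y - of_rat b = x - of_rat a \<and> v < u"
  using segment_commute[of "pt_slash a b 2" "pt_slash a b (-2)"]
  by (auto simp: back_gate_def segment_slash cross_slash of_rat_minus)
lemma collides_back_bgate: "collides (back_bgate a b) (bal t x y u v) \<longleftrightarrow>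
   -2 \<le> x - of_rat a \<and> x - of_rat a \<le> 2 \<and> y - of_rat b = - (x - of_rat a) \<and> u + v < 0"
  using segment_commute[of "pt_bslash a b 2" "pt_bslash a b (-2)"]
  by (auto simp: back_bgate_def segment_bslash cross_bslash of_rat_minus)
lemma rebound_back_gate: "rebound (back_gate a b) (bal t x y u v) = (v, u)"
  by (simp add: back_gate_def reflect_slash)
lemma rebound_back_bgate: "rebound (back_bgate a b) (bal t x y u v) = (- v, - u)"
  by (simp add: back_bgate_def reflect_bslash)

definition diag_bumper :: "rat \<Rightarrow> rat \<Rightarrow> rat \<Rightarrow> component" where
  "diag_bumper a b t0 = Bumper (pt_slash a b (-2)) (pt_slash a b 2) t0 still 18 512"

lemma collides_diag_bumper: "collides (diag_bumper a b t0) (bal t x y u v) \<longleftrightarrow>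
   -2 \<le> x - of_rat a \<and> x - of_rat a \<le> 2 \<and> y - of_rat b = x - of_rat a"
  by (auto simp: diag_bumper_def segment_slash of_rat_minus)
lemma rebound_diag_bumper_active:
  assumes "0 \<le> \<tau>" "\<tau> < 18" "t = of_rat t0 + \<tau> + real k * 512" "u \<noteq> 0 \<or> v \<noteq> 0"
  shows "rebound (diag_bumper a b t0) (bal t x y u v) = (- u, - v)"
proof -
  have "norm (u, v) > 0" using assms(4) by (auto simp: zero_less_norm_iff zero_prod_def)
  then show ?thesis
    using bumper_active_in[of \<tau> 18 t0 k] assms(1-3) by (simp add: diag_bumper_def)
qed
lemma rebound_diag_bumper_resting:
  assumes "-494 \<le> \<tau>" "\<tau> < 0" "t = of_rat t0 + \<tau> + real k * 512"
  shows "rebound (diag_bumper a b t0) (bal t x y u v) = (v, u)"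
  using bumper_resting[of \<tau> 18 t0 k] assms by (simp add: diag_bumper_def reflect_slash)

text \<open>An active bumper across the beam delays the ball by twice its spatial offset. Sending the ball back
  a second time, with the offset mirrored, removes this delay.\<close>

definition bumper_test :: "nat \<Rightarrow> int \<Rightarrow> int \<Rightarrow> component set" where
  "bumper_test j c r =
    {diag_bumper (col c) (col r + 256) (if j = 0 then 259 else 267), back_gate (col c) (col r + 192),
     bslash (col c - 128) (col r + 192) (-2) 2, back_bgate (col c - 128) (col r + 320),
     diag_bumper (col c - 128) (col r + 384) 641, slash (col c) (col r + 320) (-2) 2}"

lemma bumper_test_ok:
  assumes "k \<in> bumper_test j c r"
  shows "valid_component k" "confined k (inner_tile c r)" "is_gate k \<or> is_wall k \<or> is_bumper k"
proof -
  show "valid_component k"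
    using assms by (auto simp: bumper_test_def diag_bumper_def back_gate_def back_bgate_def bslash_def slash_def still_def map_poly_pCons)
  show "confined k (inner_tile c r)"
    using assms unfolding inner_tile_def bumper_test_def
    by (auto simp: diag_bumper_def back_gate_def back_bgate_def bslash_def slash_def pt_slash_def pt_bslash_def
        of_rat_add of_rat_diff of_rat_minus intro!: confined_static)
  show "is_gate k \<or> is_wall k \<or> is_bumper k"
    using assms by (auto simp: bumper_test_def diag_bumper_def back_gate_def back_bgate_def bslash_def slash_def)
qed

text \<open>The ball meets the bumper at phase \<open>257 + s + x\<close>. Unlike for a shutter,
  \<open>x\<close> does not cancel; but the sum \<open>s + x\<close> is at most 1 or at least 4 in
  test 0, and at most 9 or at least 12 in test 1, so that activation after 2 or 10 separates the
  cases. At rest the bumper is a mirror.\<close>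

lemma bumper_test_low:
  assumes b: "beam_up c r x s b" and x: "0 \<le> x" "x \<le> 1" and j: "low j s"
  shows "\<exists>b'. run (bumper_test j c r) (tile c r) 1 b b' \<and> beam_right (c + 1) r x s b'"
proof -
  let ?C = "bumper_test j c r"
  obtain k :: nat where b: "b = bal (1 + s + 512 * real k) (grid c + x) (grid r) 0 1"
    using assms by (auto simp: beam_up_def)
  note cs = bumper_test_def tile_def collides_diag_bumper collides_back_gate collides_back_bgate collides_slash
    collides_bslash of_rat_add of_rat_diff of_rat_minus
  let ?b1 = "diag_bumper (col c) (col r + 256) (if j = 0 then 259 else 267)"
  have "run ?C (tile c r) 1 b (bal (1 + s + 512 * real k + 256 + x) (grid c + x) (grid r + 256 + x) 1 0)"
    unfolding b
  proof (rule run_hitI[where c = ?b1 and s = "256 + x"])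
    show "rebound ?b1 (bal (1 + s + 512 * real k + 256 + x) (grid c + x) (grid r + 256 + x) 0 1) = (1, 0)"
      by (rule rebound_diag_bumper_resting[where \<tau> = "s + x - (if j = 0 then 2 else 10)" and k = k])
         (use x j in \<open>auto simp: low_def\<close>)
  qed (use x in \<open>auto simp: cs\<close>)
  moreover have "run ?C (tile c r) 0 (bal (1 + s + 512 * real k + 256 + x) (grid c + x) (grid r + 256 + x) 1 0)
     (bal (1 + s + 512 * real (k + 1)) (grid (c + 1) - 256) (grid r + 256 + x) 1 0)"
    by (rule run_flyI[where s = "256 - x"]) (use x in \<open>auto simp: cs\<close>)
  ultimately show ?thesis
    by (rule ex_run_trans) (rule beam_bal(2))
qed

lemma bumper_test_high:
  assumes b: "beam_up c r x s b" and x: "0 \<le> x" "x \<le> 1" and j: "high j s"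
  shows "\<exists>b'. run (bumper_test j c r) (tile c r) 6 b b' \<and> beam_up c (r + 1) x s b'"
proof -
  let ?C = "bumper_test j c r"
  obtain k :: nat where b: "b = bal (1 + s + 512 * real k) (grid c + x) (grid r) 0 1"
    using assms by (auto simp: beam_up_def)
  define X where "X = (grid c :: real)"
  define Y where "Y = (grid r :: real)"
  define t where "t = 1 + s + 512 * real k"
  note cs = bumper_test_def tile_def collides_diag_bumper collides_back_gate collides_back_bgate collides_slash
    collides_bslash of_rat_add of_rat_diff of_rat_minus rebound_back_gate rebound_back_bgate rebound_slash rebound_bslash
  let ?b1 = "diag_bumper (col c) (col r + 256) (if j = 0 then 259 else 267)"
  have 1: "run ?C (tile c r) 1 (bal t (X + x) Y 0 1) (bal (t + 256 + x) (X + x) (Y + 256 + x) 0 (-1))"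
  proof (rule run_hitI[where c = ?b1 and s = "256 + x"])
    have "rebound ?b1 (bal (t + 256 + x) (X + x) (Y + 256 + x) 0 1) = (- 0, - 1)"
      by (rule rebound_diag_bumper_active[where \<tau> = "s + x - (if j = 0 then 2 else 10)" and k = k])
         (use x j in \<open>auto simp: high_def t_def split: if_splits\<close>)
    then show "rebound ?b1 (bal (t + 256 + x) (X + x) (Y + 256 + x) 0 1) = (0, - 1)" by simp
  qed (use x in \<open>auto simp: cs X_def Y_def\<close>)
  have 2: "run ?C (tile c r) 1 (bal (t + 256 + x) (X + x) (Y + 256 + x) 0 (-1)) (bal (t + 320 + x) (X + x) (Y + 192 + x) (-1) 0)"
    by (rule run_hitI[where c = "back_gate (col c) (col r + 192)" and s = 64])
       (use x in \<open>auto simp: cs X_def Y_def\<close>)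
  have 3: "run ?C (tile c r) 1 (bal (t + 320 + x) (X + x) (Y + 192 + x) (-1) 0) (bal (t + 448 + 3 * x) (X - 128 - x) (Y + 192 + x) 0 1)"
    by (rule run_hitI[where c = "bslash (col c - 128) (col r + 192) (-2) 2" and s = "128 + 2 * x"])
       (use x in \<open>auto simp: cs X_def Y_def\<close>)
  \<comment> \<open>The wall of slope -1 has changed the spatial offset to \<open>-x\<close>, so
    this bumper is met at height \<open>384 - x\<close>. It is active from 641 on, the phase at
    which a ball with \<open>s = x = 0\<close> arrives.\<close>
  have 4: "run ?C (tile c r) 1 (bal (t + 448 + 3 * x) (X - 128 - x) (Y + 192 + x) 0 1) (bal (t + 640 + x) (X - 128 - x) (Y + 384 - x) 0 (-1))"
  proof (rule run_hitI[where c = "diag_bumper (col c - 128) (col r + 384) 641" and s = "192 - 2 * x"])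
    have "rebound (diag_bumper (col c - 128) (col r + 384) 641) (bal (t + 640 + x) (X - 128 - x) (Y + 384 - x) 0 1) = (- 0, - 1)"
      by (rule rebound_diag_bumper_active[where \<tau> = "s + x" and k = k])
         (use x j in \<open>auto simp: high_def t_def split: if_splits\<close>)
    then show "rebound (diag_bumper (col c - 128) (col r + 384) 641) (bal (t + 640 + x) (X - 128 - x) (Y + 384 - x) 0 1) = (0, - 1)"
      by simp
  qed (use x in \<open>auto simp: cs X_def Y_def\<close>)
  have 5: "run ?C (tile c r) 1 (bal (t + 640 + x) (X - 128 - x) (Y + 384 - x) 0 (-1)) (bal (t + 704 - x) (X - 128 - x) (Y + 320 + x) 1 0)"
    by (rule run_hitI[where c = "back_bgate (col c - 128) (col r + 320)" and s = "64 - 2 * x"])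
       (use x in \<open>auto simp: cs X_def Y_def\<close>)
  have 6: "run ?C (tile c r) 1 (bal (t + 704 - x) (X - 128 - x) (Y + 320 + x) 1 0) (bal (t + 832 + x) (X + x) (Y + 320 + x) 0 1)"
    by (rule run_hitI[where c = "slash (col c) (col r + 320) (-2) 2" and s = "128 + 2 * x"])
       (use x in \<open>auto simp: cs X_def Y_def\<close>)
  have 7: "run ?C (tile c r) 0 (bal (t + 832 + x) (X + x) (Y + 320 + x) 0 1) (bal (t + 1024) (X + x) (Y + 512) 0 1)"
    by (rule run_flyI[where s = "192 - x"]) (use x in \<open>auto simp: cs X_def Y_def\<close>)
  have "run ?C (tile c r) (1 + (1 + (1 + (1 + (1 + (1 + 0)))))) (bal t (X + x) Y 0 1) (bal (t + 1024) (X + x) (Y + 512) 0 1)"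
    using 1 2 3 4 5 6 7 by (blast intro: run_trans)
  moreover have "bal (t + 1024) (X + x) (Y + 512) 0 1
    = bal (1 + s + 512 * real (k + 2)) (grid c + x) (grid (r + 1)) 0 1"
    by (simp add: t_def X_def Y_def)
  ultimately have "run ?C (tile c r) 6 b (bal (1 + s + 512 * real (k + 2)) (grid c + x) (grid (r + 1)) 0 1)"
    by (simp add: b t_def X_def Y_def eval_nat_numeral)
  then show ?thesis
    by (rule ex_run) (rule beam_bal(1))
qed

text \<open>The first bumper gives the ball the speed at which it needs the time \<open>h - (1 - q) z\<close> for the
  distance \<open>228\<close> to the second bumper, which restores unit speed.\<close>

definition bs_delay :: "bool \<Rightarrow> bool \<Rightarrow> rat" where
  "bs_delay p b = 284 + 16 * op_out p b - 16 * op_in p b"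

text \<open>If \<open>g = bs_delay p b - (1 - q) * z\<close> is the desired flight time, with
  \<open>q = op_scale p\<close>, then this is \<open>228 / g - 1\<close>, which is added to the
  speed 1.\<close>

definition bs_effect1 :: "bool \<Rightarrow> bool \<Rightarrow> rat_fun" where
  "bs_effect1 p b = ([:228 - bs_delay p b, 1 - op_scale p:], [:bs_delay p b, op_scale p - 1:])"
text \<open>The argument is the new offset \<open>q * z\<close>, in terms of which
  \<open>g = bs_delay p b + (1 - 1 / q) * (q * z)\<close>. The value is
  \<open>1 - 228 / g\<close>.\<close>

definition bs_effect2 :: "bool \<Rightarrow> bool \<Rightarrow> rat_fun" where
  "bs_effect2 p b = ([:bs_delay p b - 228, 1 - 1 / op_scale p:], [:bs_delay p b, 1 - 1 / op_scale p:])"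

text \<open>Phase 1 plus a flight of length 200 gives 201. The additional 1 in the length of the
  active interval, which is half-open, admits the largest offset.\<close>

definition bs_bumper1 :: "bool \<Rightarrow> bool \<Rightarrow> int \<Rightarrow> int \<Rightarrow> component" where
  "bs_bumper1 p b c r = Bumper (col c - 1, col r + 200) (col c + 2, col r + 200)
     (201 + 16 * op_in p b) (bs_effect1 p b) (16 * op_width p + 1) 512"
definition bs_bumper2 :: "bool \<Rightarrow> bool \<Rightarrow> int \<Rightarrow> int \<Rightarrow> component" where
  "bs_bumper2 p b c r = Bumper (col c - 128, col r + 99) (col c - 128, col r + 102)
     (201 + 16 * op_in p b + bs_delay p b) (bs_effect2 p b) (16 * op_scale p * op_width p + 1) 512"

definition bs_core :: "bool \<Rightarrow> bool \<Rightarrow> int \<Rightarrow> int \<Rightarrow> component set" where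
  "bs_core p b c r = {bs_bumper1 p b c r, back_gate (col c) (col r + 100),
     back_gate (col c - 64) (col r + 100), bs_bumper2 p b c r}"
definition bs_slashes :: "int \<Rightarrow> int \<Rightarrow> component set" where
  "bs_slashes c r = {slash (col c - 64) (col r + 300) (-1) 2, slash (col c - 64 + 64) (col r + 300) (-1) 2}"
definition bumper_tscale :: "bool \<Rightarrow> bool \<Rightarrow> int \<Rightarrow> int \<Rightarrow> component set" where
  "bumper_tscale p b c r = bs_core p b c r \<union> bs_slashes c r"

lemma eval_effect1: "rat_fun_eval (bs_effect1 p b) z =
   (228 - of_rat (bs_delay p b) + (1 - of_rat (op_scale p)) * z) / (of_rat (bs_delay p b) - (1 - of_rat (op_scale p)) * z)"
  by (simp add: rat_fun_eval_def bs_effect1_def map_poly_pCons of_rat_diff algebra_simps)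
lemma eval_effect2: "rat_fun_eval (bs_effect2 p b) z =
   (of_rat (bs_delay p b) - 228 + (1 - 1 / of_rat (op_scale p)) * z) / (of_rat (bs_delay p b) + (1 - 1 / of_rat (op_scale p)) * z)"
  by (simp add: rat_fun_eval_def bs_effect2_def map_poly_pCons of_rat_diff of_rat_divide algebra_simps)

lemma bs_bumper_valid: "valid_component (bs_bumper1 p b c r)" "valid_component (bs_bumper2 p b c r)"
  by (cases p; cases b;
    auto simp: bs_bumper1_def bs_bumper2_def bs_effect1_def bs_effect2_def bs_delay_def op_defs map_poly_pCons
      of_rat_add of_rat_diff of_rat_divide of_rat_minus)+

lemma bs_core_confined:
  "k \<in> bs_core p b c r \<Longrightarrow> confined k (rect (grid c - 130) (grid c + 5) (grid r + 90) (grid r + 210))"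
  unfolding bs_core_def
  by (auto simp: bs_bumper1_def bs_bumper2_def back_gate_def pt_slash_def of_rat_add of_rat_diff of_rat_minus intro!: confined_static)

lemma bs_slashes_confined:
  "k \<in> bs_slashes c r \<Longrightarrow> confined k (rect (grid c - 90) (grid c + 5) (grid r + 298) (grid r + 303))"
  unfolding bs_slashes_def
  by (auto simp: of_rat_add of_rat_diff of_rat_minus intro!: confined_slash)

lemma bumper_tscale_ok:
  assumes "k \<in> bumper_tscale p b c r"
  shows "valid_component k" "confined k (inner_tile c r)" "is_gate k \<or> is_wall k \<or> is_bumper k"
proof -
  show "valid_component k"
    using assms bs_bumper_valid
    by (auto simp: bumper_tscale_def bs_core_def bs_slashes_def back_gate_def slash_def)
  show "confined k (inner_tile c r)"
    using assms unfolding bumper_tscale_def inner_tile_def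
    by (elim UnE; intro confined_mono[OF bs_core_confined[of k p b c r]] confined_mono[OF bs_slashes_confined[of k c r]] rect_mono) auto
  show "is_gate k \<or> is_wall k \<or> is_bumper k"
    using assms by (auto simp: bumper_tscale_def bs_core_def bs_slashes_def back_gate_def slash_def bs_bumper1_def bs_bumper2_def)
qed

lemma collides_bs_bumper1: "collides (bs_bumper1 p b c r) (bal t x y u v) \<longleftrightarrow>
   grid c - 1 \<le> x \<and> x \<le> grid c + 2 \<and> y = grid r + 200"
  by (auto simp: bs_bumper1_def segment_hor of_rat_add of_rat_diff)
lemma collides_bs_bumper2: "collides (bs_bumper2 p b c r) (bal t x y u v) \<longleftrightarrow>
   grid r + 99 \<le> y \<and> y \<le> grid r + 102 \<and> x = grid c - 128"
  by (auto simp: bs_bumper2_def segment_ver of_rat_add of_rat_diff)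

lemma bs_speed:
  assumes z: "0 \<le> z" "z \<le> 16 * of_rat (op_width p)"
  shows "0 < of_rat (bs_delay p b) - (1 - of_rat (op_scale p)) * (z :: real)"
  using z by (cases p; cases b; auto simp: bs_delay_def op_defs of_rat_add of_rat_diff of_rat_divide)

lemma rebound_bs_bumper1:
  assumes z: "0 \<le> z" "z \<le> 16 * of_rat (op_width p)"
  shows "rebound (bs_bumper1 p b c r) (bal (201 + 16 * of_rat (op_in p b) + z + real k * 512) x y 0 1)
    = (0, - (228 / (of_rat (bs_delay p b) - (1 - of_rat (op_scale p)) * z)))"
proof -
  define g where "g = of_rat (bs_delay p b) - (1 - of_rat (op_scale p)) * z"
  have g: "g > 0" using bs_speed[OF z] by (simp add: g_def)
  have w: "z \<le> 16" using z by (auto simp: op_width_def of_rat_divide split: if_splits)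
  have t0: "201 + 16 * of_rat (op_in p b) + z + real k * 512 = of_rat (201 + 16 * op_in p b) + z + real k * 512"
    by (simp add: of_rat_add of_rat_mult)
  have act: "bumper_active (201 + 16 * op_in p b) (16 * op_width p + 1) 512 (of_rat (201 + 16 * op_in p b) + z + real k * 512)"
    by (rule bumper_active_in) (use z w in \<open>auto simp: of_rat_add of_rat_mult\<close>)
  have m: "(of_rat (201 + 16 * op_in p b) + z + real k * 512 - of_rat (201 + 16 * op_in p b)) rmod of_rat 512 = z"
    using rmod_period[of z 512 k] z w by (simp add: algebra_simps)
  have "228 - of_rat (bs_delay p b) + (1 - of_rat (op_scale p)) * z = 228 - g" by (simp add: g_def)
  then have "rat_fun_eval (bs_effect1 p b) z = (228 - g) / g"
    by (simp only: eval_effect1 g_def[symmetric])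
  then have "rat_fun_eval (bs_effect1 p b) z = 228 / g - 1"
    using g by (simp add: diff_divide_distrib)
  then show ?thesis
    unfolding bs_bumper1_def t0 using act m g by (simp add: g_def[symmetric] norm_Pair)
qed

lemma rebound_bs_bumper2:
  assumes z: "0 \<le> z" "z \<le> 16 * of_rat (op_width p)"
    and g: "g = of_rat (bs_delay p b) - (1 - of_rat (op_scale p)) * z"
  shows "rebound (bs_bumper2 p b c r)
     (bal (201 + 16 * of_rat (op_in p b) + z + g + real k * 512) x y (- (228 / g)) 0) = (1, 0)"
proof -
  have gp: "g > 0" using bs_speed[OF z] by (simp add: g)
  define q where "q = (of_rat (op_scale p) :: real)"
  have q: "q > 0" by (auto simp: q_def op_scale_def of_rat_divide)
  have w: "q * (16 * of_rat (op_width p)) \<le> 16" by (auto simp: q_def op_defs of_rat_divide)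
  have qz: "0 \<le> q * z" "q * z \<le> q * (16 * of_rat (op_width p))" using z q by (auto intro: mult_left_mono)
  define t0 where "t0 = 201 + 16 * op_in p b + bs_delay p b"
  have t: "201 + 16 * of_rat (op_in p b) + z + g + real k * 512 = of_rat t0 + q * z + real k * 512"
    by (simp add: t0_def g q_def of_rat_add of_rat_mult algebra_simps)
  have act: "bumper_active t0 (16 * op_scale p * op_width p + 1) 512 (of_rat t0 + q * z + real k * 512)"
    by (rule bumper_active_in) (use qz w in \<open>auto simp: of_rat_add of_rat_mult q_def\<close>)
  have m: "(of_rat t0 + q * z + real k * 512 - of_rat t0) rmod of_rat 512 = q * z"
    using rmod_period[of "q * z" 512 k] qz w by (simp add: algebra_simps)
  have "of_rat (bs_delay p b) + (1 - 1 / of_rat (op_scale p)) * (q * z) = g"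
    using q by (simp add: g q_def[symmetric] field_simps)
  then have "rat_fun_eval (bs_effect2 p b) (q * z) = (g - 228) / g"
    unfolding eval_effect2 by (simp add: diff_add_eq[symmetric])
  then have e: "rat_fun_eval (bs_effect2 p b) (q * z) = 1 - 228 / g"
    using gp by (simp add: diff_divide_distrib)
  have n: "norm (- (228 / g), 0::real) = 228 / g" using gp by (simp add: norm_Pair)
  show ?thesis
    unfolding bs_bumper2_def t t0_def[symmetric] rebound.simps ball.select_convs m e n using act gp by simp
qed

lemma bumper_tscale_run:
  assumes b0: "beam_up c r x (16 * of_rat (op_in p b) + z) b0" and x: "0 \<le> x" "x \<le> 1"
    and z: "0 \<le> z" "z \<le> 16 * of_rat (op_width p)"
  shows "\<exists>b'. run (bumper_tscale p b c r) (tile c r) 6 b0 b' \<and>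
    beam_up c (r + 1) x (16 * of_rat (op_out p b) + of_rat (op_scale p) * z) b'"
proof -
  define X where "X = (grid c :: real)"
  define Y where "Y = (grid r :: real)"
  define i where "i = (16 * of_rat (op_in p b) :: real)"
  define g where "g = of_rat (bs_delay p b) - (1 - of_rat (op_scale p)) * z"
  define u where "u = 228 / g"
  have g: "g > 0" using bs_speed[OF z] by (simp add: g_def)
  have u: "u > 0" "228 / u = g" using g by (simp_all add: u_def)
  obtain k :: nat where b0': "b0 = bal (1 + (i + z) + 512 * real k) (X + x) Y 0 1"
    using b0 by (auto simp: beam_up_def i_def X_def Y_def)
  define t where "t = 1 + (i + z) + 512 * real k"
  let ?G = "bumper_tscale p b c r" and ?C = "bs_core p b c r" and ?H = "bs_slashes c r"
  let ?R = "rect (X - 130) (X + 5) Y (Y + 250)"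
  note cs = bs_core_def collides_bs_bumper1 collides_bs_bumper2 collides_back_gate rebound_back_gate
    X_def Y_def of_rat_add of_rat_diff of_rat_minus
  have 1: "run ?C ?R 1 (bal t (X + x) Y 0 1) (bal (t + 200) (X + x) (Y + 200) 0 (- u))"
  proof (rule run_hitI[where c = "bs_bumper1 p b c r" and s = 200])
    have e: "t + 200 = 201 + 16 * of_rat (op_in p b) + z + real k * 512" by (simp add: t_def i_def)
    show "rebound (bs_bumper1 p b c r) (bal (t + 200) (X + x) (Y + 200) 0 1) = (0, - u)"
      unfolding e u_def g_def by (rule rebound_bs_bumper1[OF z])
  qed (use x in \<open>auto simp: cs\<close>)
  have 2: "run ?C ?R 1 (bal (t + 200) (X + x) (Y + 200) 0 (- u)) (bal (t + 200 + (100 - x) / u) (X + x) (Y + 100 + x) (- u) 0)"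
    by (rule run_hitI[where c = "back_gate (col c) (col r + 100)" and s = "(100 - x) / u"])
       (use x u in \<open>auto simp: cs field_simps\<close>)
  have 3: "run ?C ?R 1 (bal (t + 200 + (100 - x) / u) (X + x) (Y + 100 + x) (- u) 0) (bal (t + 200 + g) (X - 128) (Y + 100 + x) 1 0)"
  proof (rule run_hitI[where c = "bs_bumper2 p b c r" and s = "(128 + x) / u"])
    have e: "t + 200 + g = 201 + 16 * of_rat (op_in p b) + z + g + real k * 512" by (simp add: t_def i_def)
    show "rebound (bs_bumper2 p b c r) (bal (t + 200 + g) (X - 128) (Y + 100 + x) (- u) 0) = (1, 0)"
      unfolding e u_def by (rule rebound_bs_bumper2[OF z g_def])
    have "(100 - x) / u + (128 + x) / u = 228 / u" by (simp add: add_divide_distrib[symmetric])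
    then show "t + 200 + g = t + 200 + (100 - x) / u + (128 + x) / u" using u by simp
    show "\<not> collides c' (bal (t + 200 + (100 - x) / u + r') (X + x + r' * - u) (Y + 100 + x + r' * 0) (- u) 0)"
      if "c' \<in> ?C" "c' \<noteq> bs_bumper2 p b c r" for c' r'
      using that x u by (auto simp: cs)
    show "\<not> collides (bs_bumper2 p b c r) (bal (t + 200 + (100 - x) / u + r') (X + x + r' * - u) (Y + 100 + x + r' * 0) (- u) 0)"
      if "0 < r'" "r' < (128 + x) / u" for r'
    proof -
      have "r' * u < 128 + x" using that u by (simp add: field_simps)
      then show ?thesis by (auto simp: cs)
    qed
  qed (use x u in \<open>auto simp: cs\<close>)
  \<comment> \<open>The same gate was passed on the way to the left; now the ball comes from the
    other side.\<close>
  have 4: "run ?C ?R 1 (bal (t + 200 + g) (X - 128) (Y + 100 + x) 1 0) (bal (t + 264 + g + x) (X - 64 + x) (Y + 100 + x) 0 1)"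
    by (rule run_hitI[where c = "back_gate (col c - 64) (col r + 100)" and s = "64 + x"])
       (use x in \<open>auto simp: cs\<close>)
  have 5: "run ?C ?R 0 (bal (t + 264 + g + x) (X - 64 + x) (Y + 100 + x) 0 1) (bal (t + 414 + g) (X - 64 + x) (Y + 250) 0 1)"
    by (rule run_flyI[where s = "150 - x"]) (use x in \<open>auto simp: cs\<close>)
  have r: "run ?C ?R (1 + (1 + (1 + (1 + 0)))) (bal t (X + x) Y 0 1) (bal (t + 414 + g) (X - 64 + x) (Y + 250) 0 1)"
    using 1 2 3 4 5 by (blast intro: run_trans)
  have A: "run ?G (tile c r) (1 + (1 + (1 + (1 + 0)))) (bal t (X + x) Y 0 1) (bal (t + 414 + g) (X - 64 + x) (Y + 250) 0 1)"
  proof (rule run_local_mono[OF r])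
    show "avoids k ?R" if "k \<in> ?G - ?C" for k
      by (rule avoids_rect[OF bs_slashes_confined[of k c r]]) (use that in \<open>auto simp: bumper_tscale_def Y_def\<close>)
    show "?R \<subseteq> tile c r" unfolding tile_def X_def Y_def by (rule rect_mono) auto
  qed (auto simp: bumper_tscale_def)
  have B: "run ?G (tile c r) 2 (bal (t + 414 + g) (X - 64 + x) (Y + 250) 0 1) (bal (t + 740 + g) (X + x) (Y + 512) 0 1)"
  proof (rule run_local_mono)
    have a: "of_rat (col c - 64) = X - 64" by (simp add: X_def of_rat_diff)
    have "run ?H (rect (X - 90) (X + 5) (Y + 250) (Y + 512)) 2
      (bal (t + 414 + g) (of_rat (col c - 64) + x) (Y + 250) 0 1)
      (bal (t + 414 + g + of_rat 64 + (Y + 512 - (Y + 250))) (of_rat (col c - 64) + of_rat 64 + x) (Y + 512) 0 1)"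
      unfolding bs_slashes_def by (rule shift_run) (use x in \<open>auto simp: a of_rat_add Y_def\<close>)
    moreover have "t + 414 + g + of_rat 64 + (Y + 512 - (Y + 250)) = t + 740 + g" by simp
    ultimately show "run ?H (rect (X - 90) (X + 5) (Y + 250) (Y + 512)) 2
      (bal (t + 414 + g) (X - 64 + x) (Y + 250) 0 1) (bal (t + 740 + g) (X + x) (Y + 512) 0 1)"
      by (simp only: a) simp
    show "avoids k (rect (X - 90) (X + 5) (Y + 250) (Y + 512))" if "k \<in> ?G - ?H" for k
      by (rule avoids_rect[OF bs_core_confined[of k p b c r]]) (use that in \<open>auto simp: bumper_tscale_def Y_def\<close>)
    show "rect (X - 90) (X + 5) (Y + 250) (Y + 512) \<subseteq> tile c r" unfolding tile_def X_def Y_def by (rule rect_mono) auto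
  qed (auto simp: bumper_tscale_def)
  \<comment> \<open>Apart from \<open>g\<close> the legs take 740, and the constant 284 in
    \<open>bs_delay\<close> completes this to two periods.\<close>
  have "t + 740 + g = 1 + (16 * of_rat (op_out p b) + of_rat (op_scale p) * z) + 512 * real (k + 2)"
    by (simp add: t_def g_def i_def bs_delay_def of_rat_add of_rat_diff of_rat_mult algebra_simps)
  then have e: "bal (t + 740 + g) (X + x) (Y + 512) 0 1
    = bal (1 + (16 * of_rat (op_out p b) + of_rat (op_scale p) * z) + 512 * real (k + 2)) (grid c + x) (grid (r + 1)) 0 1"
    by (simp add: X_def Y_def)
  have "run ?G (tile c r) 6 b0 (bal (t + 740 + g) (X + x) (Y + 512) 0 1)"
    using run_trans[OF A B] by (simp add: b0' t_def eval_nat_numeral)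
  then show ?thesis
    unfolding e by (rule ex_run) (rule beam_bal(1))
qed

subsection \<open>Reachability along a run\<close>

text \<open>Fixing the number of collisions allows them to be counted down along a run.\<close>

definition reaches_in :: "component set \<Rightarrow> nat \<Rightarrow> ball \<Rightarrow> real \<times> real \<Rightarrow> bool" where
  "reaches_in C n b p \<longleftrightarrow> (\<exists>b' s. travels C n b b' \<and> s \<ge> 0 \<and> undisturbed C b' s \<and> pos (fly s b') = p)"

lemma reaches_iff: "reaches C b p \<longleftrightarrow> (\<exists>n. reaches_in C n b p)"
  by (auto simp: reaches_def reaches_in_def)

lemma reaches_in_0D:
  assumes "reaches_in C 0 b p"
  shows "\<exists>s\<ge>0. undisturbed C b s \<and> pos (fly s b) = p"
proof -
  obtain b' s where b': "travels C 0 b b'" and s: "s \<ge> 0" "undisturbed C b' s" "pos (fly s b') = p"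
    using assms by (auto simp: reaches_in_def)
  from b' show ?thesis
  proof (cases rule: travels.cases)
    case start then show ?thesis using s by blast
  next
    case (flight s')
    then show ?thesis using s undisturbed_join[of C b s' s] by (intro exI[of _ "s' + s"]) auto
  qed
qed

lemma reaches_in_0I: "s \<ge> 0 \<Longrightarrow> undisturbed C b s \<Longrightarrow> reaches_in C 0 b (pos (fly s b))"
  unfolding reaches_in_def using travels.start by blast

lemma reaches_in_SucD:
  assumes "reaches_in C (Suc n) b p"
  shows "\<exists>b'. next_collision C b b' \<and> reaches_in C n b' p"
proof -
  obtain b' s where b': "travels C (Suc n) b b'" and s: "s \<ge> 0" "undisturbed C b' s" "pos (fly s b') = p"
    using assms by (auto simp: reaches_in_def)
  from b' show ?thesis
    by (cases rule: travels.cases) (use s in \<open>auto simp: reaches_in_def\<close>)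
qed

lemma reaches_in_SucI: "next_collision C b b' \<Longrightarrow> reaches_in C n b' p \<Longrightarrow> reaches_in C (Suc n) b p"
  unfolding reaches_in_def using travels.collision by blast

lemma undisturbed_drop:
  assumes "undisturbed C b s'" "0 \<le> s"
  shows "undisturbed C (fly s b) (s' - s)"
  using assms by (auto simp: undisturbed_def)

text \<open>Determinism: the next collision is unique, so a trajectory that reaches a point outside
  \<open>A\<close> must first follow the run to its end and spend all its collisions.\<close>

lemma run_reaches_in:
  assumes "run C A n b b'" "p \<notin> A" "reaches_in C m b p"
  shows "n \<le> m \<and> reaches_in C (m - n) b' p"
  using assms
proof (induction arbitrary: m rule: run.induct)
  case (stop b)
  then show ?case by simp
next
  case (flight s b)
  show ?case
  proof (cases m)
    case 0
    then obtain s' where s': "s' \<ge> 0" "undisturbed C b s'" "pos (fly s' b) = p"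
      using flight reaches_in_0D by blast
    then have "s < s'" using flight by (metis atLeastAtMost_iff not_le)
    then have "reaches_in C 0 (fly s b) (pos (fly (s' - s) (fly s b)))"
      using flight undisturbed_drop[OF s'(2), of s] by (intro reaches_in_0I) auto
    then show ?thesis using s' 0 by simp
  next
    case (Suc m')
    then obtain b1 where b1: "next_collision C b b1" "reaches_in C m' b1 p"
      using flight reaches_in_SucD by blast
    then obtain s' c where s': "s' > 0" "undisturbed C b s'" "{k \<in> C. collides k (fly s' b)} = {c}"
      "b1 = (fly s' b)\<lparr>vel := rebound c (fly s' b)\<rparr>"
      by (auto simp: next_collision_def)
    have c: "c \<in> C" "collides c (fly s' b)" using s'(3) by auto
    have "s < s'"
    proof (rule ccontr)
      assume "\<not> s < s'"
      then consider "s' = s" | "s' < s" by linarith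
      then show False
      proof cases
        case 1 then show False using flight(3) c by auto
      next
        case 2 then show False using flight(2) c s'(1) by (auto simp: undisturbed_def)
      qed
    qed
    then have "next_collision C (fly s b) b1"
      unfolding next_collision_def
      using s' undisturbed_drop[OF s'(2), of s] flight(1)
      by (intro exI[of _ "s' - s"] conjI exI[of _ c]) auto
    then show ?thesis using b1 Suc reaches_in_SucI by simp
  qed
next
  case (hit s b c n b'')
  have c: "c \<in> C" "collides c (fly s b)" using hit(3) by auto
  show ?case
  proof (cases m)
    case 0
    then obtain s' where s': "s' \<ge> 0" "undisturbed C b s'" "pos (fly s' b) = p"
      using hit reaches_in_0D by blast
    then have "s < s'" using hit(4) \<open>p \<notin> A\<close> by (metis atLeastAtMost_iff not_le)
    then show ?thesis using s'(2) c hit(1) by (auto simp: undisturbed_def)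
  next
    case (Suc m')
    then obtain b1 where b1: "next_collision C b b1" "reaches_in C m' b1 p"
      using hit.prems reaches_in_SucD by blast
    then obtain s' c' where s': "s' > 0" "undisturbed C b s'" "{k \<in> C. collides k (fly s' b)} = {c'}"
      "b1 = (fly s' b)\<lparr>vel := rebound c' (fly s' b)\<rparr>"
      by (auto simp: next_collision_def)
    have c': "c' \<in> C" "collides c' (fly s' b)" using s'(3) by auto
    have "s = s'"
    proof (rule ccontr)
      assume "s \<noteq> s'"
      then consider "s < s'" | "s' < s" by linarith
      then show False
      proof cases
        case 1 then show False using s'(2) c hit(1) by (auto simp: undisturbed_def)
      next
        case 2 then show False using hit(2) c' s'(1) by (auto simp: undisturbed_def)
      qed
    qed
    then have "c' = c" using s'(3) hit(3) by auto
    then have "n \<le> m' \<and> reaches_in C (m' - n) b'' p"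
      using hit.IH[of m'] b1 s'(4) \<open>s = s'\<close> hit.prems by auto
    then show ?thesis using Suc by simp
  qed
qed

lemma travels_imp_run: "travels C n b b' \<Longrightarrow> run C UNIV n b b'"
proof (induction rule: travels.induct)
  case (collision b b' n b'')
  then show ?case unfolding next_collision_def by (auto intro: run.hit)
qed (auto intro: run.stop run.flight)

lemma travels_reaches_in:
  assumes "run C A n b b'" "reaches_in C m b' p"
  shows "reaches C b p"
proof -
  obtain b'' s where b'': "travels C m b' b''" "s \<ge> 0" "undisturbed C b'' s" "pos (fly s b'') = p"
    using assms(2) unfolding reaches_in_def by blast
  have "run C UNIV (n + m) b b''"
    by (rule run_trans[OF run_mono[OF assms(1)] travels_imp_run[OF b''(1)]]) simp
  then show ?thesis unfolding reaches_def using b''(2-) run_imp_travels by blast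
qed

text \<open>Unlike \<open>run\<close>, the empty movement makes no demand on the position, so that
  composition has a unit.\<close>

definition goes :: "component set \<Rightarrow> (real \<times> real) set \<Rightarrow> nat \<Rightarrow> ball \<Rightarrow> ball \<Rightarrow> bool" where
  "goes C A n b b' \<longleftrightarrow> n = 0 \<and> b = b' \<or> run C A n b b'"

lemma goes_refl: "goes C A 0 b b"
  by (simp add: goes_def)

lemma goes_trans: "goes C A m b b' \<Longrightarrow> goes C A n b' b'' \<Longrightarrow> goes C A (m + n) b b''"
  using run_trans by (fastforce simp: goes_def)

lemma goes_travels: "goes C A n b b' \<Longrightarrow> travels C n b b'"
  by (auto simp: goes_def intro: run_imp_travels travels.start)

subsection \<open>Values of stacks\<close>

lemma stack_value_rat: "\<exists>r. stack_value xs = of_rat r"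
proof (induction xs)
  case Nil then show ?case by (auto intro: exI[of _ 0])
next
  case (Cons a xs)
  then obtain r where "stack_value xs = of_rat r" by blast
  then show ?case
    by (intro exI[of _ "(if a then 3/4 else 1/4) + r / 4"]) (simp add: of_rat_add of_rat_divide)
qed

lemma stack_value_top:
  "top_symbol xs = None \<Longrightarrow> stack_value xs = 0"
  "top_symbol xs = Some False \<Longrightarrow> 1/4 \<le> stack_value xs \<and> stack_value xs \<le> 1/2"
  "top_symbol xs = Some True \<Longrightarrow> 3/4 \<le> stack_value xs \<and> stack_value xs \<le> 1"
  using stack_value_bounds[of "tl xs"] by (cases xs; auto)+

text \<open>Popping acts on the offset differently for each symbol, and the symbol is known from the
  column. Keeping a stack and popping an empty one both amount to no operation.\<close>

definition stack_op :: "stack_action \<Rightarrow> bool option \<Rightarrow> (bool \<times> bool) option" where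
  "stack_op a x = (case a of Keep \<Rightarrow> None | Push b \<Rightarrow> Some (True, b) | Pop \<Rightarrow> map_option (Pair False) x)"

lemma stack_op_None: "stack_op a (top_symbol xs) = None \<Longrightarrow> perform a xs = xs"
  by (cases a; cases xs) (auto simp: stack_op_def)

lemma stack_op_Some:
  assumes "stack_op a (top_symbol xs) = Some (p, b)"
  obtains z where "0 \<le> z" "z \<le> of_rat (op_width p)"
    "stack_value xs = of_rat (op_in p b) + z"
    "stack_value (perform a xs) = of_rat (op_out p b) + of_rat (op_scale p) * z"
proof (cases a)
  case (Push b')
  then show ?thesis
    using that[of "stack_value xs"] assms stack_value_bounds[of xs]
    by (auto simp: stack_op_def op_defs of_rat_divide)
next
  case Pop
  then obtain ys where "xs = b # ys" "\<not> p" using assms by (cases xs) (auto simp: stack_op_def)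
  then show ?thesis
    using that[of "stack_value ys / 4"] Pop stack_value_bounds[of ys]
    by (auto simp: op_defs of_rat_divide)
qed (use assms in \<open>auto simp: stack_op_def\<close>)

subsection \<open>The machine\<close>

text \<open>The numbering follows the way the beam is split. If the second stack has top
  \<open>True\<close>, it passes both tests and stays in column 0; top \<open>False\<close> leads to
  column 3, the empty stack to column 6. Within each triple an empty first stack stays, top
  \<open>False\<close> moves by 1 and top \<open>True\<close> by 2.\<close>

definition cell_top1 :: "int \<Rightarrow> bool option" where
  "cell_top1 j = (if j mod 3 = 0 then None else Some (j mod 3 = 2))"
definition cell_top2 :: "int \<Rightarrow> bool option" where
  "cell_top2 j = (if j div 3 = 2 then None else Some (j div 3 = 0))"

fun cell_of :: "bool option \<Rightarrow> bool option \<Rightarrow> int" where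
  "cell_of x y = (case y of None \<Rightarrow> 6 | Some False \<Rightarrow> 3 | Some True \<Rightarrow> 0) +
     (case x of None \<Rightarrow> 0 | Some False \<Rightarrow> 1 | Some True \<Rightarrow> 2)"

lemma cell_of_bounds: "0 \<le> cell_of x y" "cell_of x y < 9"
  by (auto split: option.split bool.split)

lemma cell_top_of: "cell_top1 (cell_of x y) = x" "cell_top2 (cell_of x y) = y"
  by (cases x; cases y; auto simp: cell_top1_def cell_top2_def split: bool.split)+

text \<open>Columns \<open>9 i, \<dots>, 9 i + 8\<close> belong to the state with index \<open>i\<close>, one for every pair of top symbols;
  the row \<open>6 + i\<close> collects the beams that lead to this state.\<close>

locale machine =
  fixes test :: "nat \<Rightarrow> int \<Rightarrow> int \<Rightarrow> component set"
    and tscale :: "bool \<Rightarrow> bool \<Rightarrow> int \<Rightarrow> int \<Rightarrow> component set"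
    and kind :: "component \<Rightarrow> bool"
    and M :: "'q::finite two_stack_pda"
  assumes test_low: "\<lbrakk>beam_up c r x s b; 0 \<le> x; x \<le> 1; low j s\<rbrakk> \<Longrightarrow>
      \<exists>n b'. n \<le> 8 \<and> run (test j c r) (tile c r) n b b' \<and> beam_right (c + 1) r x s b'"
    and test_high: "\<lbrakk>beam_up c r x s b; 0 \<le> x; x \<le> 1; high j s\<rbrakk> \<Longrightarrow>
      \<exists>n b'. n \<le> 8 \<and> run (test j c r) (tile c r) n b b' \<and> beam_up c (r + 1) x s b'"
    and tscale_run: "\<lbrakk>beam_up c r x (16 * of_rat (op_in p a) + z) b; 0 \<le> x; x \<le> 1;
        0 \<le> z; z \<le> 16 * of_rat (op_width p)\<rbrakk> \<Longrightarrow>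
      \<exists>n b'. n \<le> 8 \<and> run (tscale p a c r) (tile c r) n b b' \<and>
        beam_up c (r + 1) x (16 * of_rat (op_out p a) + of_rat (op_scale p) * z) b'"
    and finite_gadgets: "finite (test j c r)" "finite (tscale p a c r)"
    and gadgets_ok: "k \<in> test j c r \<or> k \<in> tscale p a c r \<Longrightarrow>
      valid_component k \<and> confined k (inner_tile c r) \<and> kind k"
    and kind_static: "is_wall k \<or> is_gate k \<or> is_parabolic_wall k \<Longrightarrow> kind k"
begin

definition N :: int where "N = int CARD('q)"

definition idx :: "'q \<Rightarrow> int" where
  "idx = int \<circ> (SOME f. bij_betw f (UNIV :: 'q set) {0..<CARD('q)})"

definition state :: "int \<Rightarrow> 'q" where "state = inv idx"

lemma idx_bij: "bij_betw (SOME f. bij_betw f (UNIV :: 'q set) {0..<CARD('q)}) UNIV {0..<CARD('q)}"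
  using someI_ex[OF ex_bij_betw_finite_nat[of "UNIV :: 'q set"]] by simp

lemma inj_idx: "inj idx"
  using idx_bij unfolding idx_def bij_betw_def by (simp add: inj_compose)

lemma state_idx [simp]: "state (idx q) = q"
  by (simp add: state_def inj_idx)

lemma idx_bounds: "0 \<le> idx q" "idx q < N"
proof -
  have "(SOME f. bij_betw f (UNIV :: 'q set) {0..<CARD('q)}) q \<in> {0..<CARD('q)}"
    by (rule bij_betw_apply[OF idx_bij]) simp
  then show "0 \<le> idx q" "idx q < N" by (auto simp: idx_def N_def)
qed

definition ops :: "(bool \<Rightarrow> bool \<Rightarrow> int \<Rightarrow> int \<Rightarrow> component set) \<Rightarrow> (bool \<times> bool) option \<Rightarrow> int \<Rightarrow> int \<Rightarrow> component set" where
  "ops f p c r = (case p of None \<Rightarrow> {} | Some (p, b) \<Rightarrow> f p b c r)"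

text \<open>The gate in row \<open>6 + idx q'\<close> feeds the bus of the next state. Where the
  automaton halts, the column stays empty and the ball rises to the roof.\<close>

definition program :: "'q \<Rightarrow> int \<Rightarrow> int \<Rightarrow> int \<Rightarrow> component set" where
  "program q j c r =
    (case transition M q (cell_top1 j) (cell_top2 j) of None \<Rightarrow> {} | Some (q', d1, d2) \<Rightarrow>
      if r = 4 then ops xscale (stack_op d1 (cell_top1 j)) c r
      else if r = 5 then ops tscale (stack_op d2 (cell_top2 j)) c r
      else if r = 6 + idx q' then {tgate c r} else {})"

text \<open>The thresholds 5/8 and 1/8 lie in the gaps between the stack values with different top
  symbols. Row -1 stays free, so that the ball can enter there.\<close>

definition cell :: "'q \<Rightarrow> int \<Rightarrow> int \<Rightarrow> int \<Rightarrow> component set" where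
  "cell q j c r =
    (if r = 0 then if j = 0 then test 0 c r else if j = 6 then {tslash (-2) c r} else {}
     else if r = 1 then if j = 0 then test 1 c r else if j = 3 then {tslash (-2) c r} else {}
     else if r = 2 then if j mod 3 = 0 then {tslash (5/8) c r} else if j mod 3 = 2 then {tslash (-2) c r} else {}
     else if r = 3 then if j mod 3 = 0 then {tslash (1/8) c r} else if j mod 3 = 1 then {tslash (-2) c r} else {}
     else if r \<ge> 4 then program q j c r
     else if j = 0 \<and> r = - 2 - idx q then {tbslash c r} else {})"

text \<open>Column \<open>9 * N + i\<close> is a return channel: it leads the beam of bus row
  \<open>6 + i\<close> down to row \<open>- 2 - i\<close>, in which it passes below all cells on its
  way to column \<open>9 * i\<close>.\<close>

definition content :: "int \<Rightarrow> int \<Rightarrow> component set" where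
  "content c r =
    (if 0 \<le> c \<and> c < 9 * N then cell (state (c div 9)) (c mod 9) c r
     else if 9 * N \<le> c \<and> c < 10 * N then
       if r = 6 + (c - 9 * N) then {tbslash c r} else if r = - 2 - (c - 9 * N) then {tslash (-2) c r} else {}
     else {})"

definition ceiling_row :: int where "ceiling_row = 6 + N"

text \<open>Ten tiles per state exceed the nine columns from which halting balls come. The roof over
  the interval from 0 to \<open>focal\<close> therefore covers all of them, and every impact lies
  above the focus.\<close>

definition focal :: rat where "focal = 512 * 10 * of_int N"

definition roof :: component where
  "roof = parab 0 (col ceiling_row + 1) 1 focal 0 focal"

definition parts :: "component set" where
  "parts = insert roof (\<Union>c. \<Union>r. content c r)"

definition goal :: rat_point where "goal = (0, col ceiling_row + 1)"

text \<open>The simulation stays in this half-plane, whereas the target lies 1 above it.\<close>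

definition ground :: "(real \<times> real) set" where
  "ground = {p. snd p \<le> grid ceiling_row}"

section \<open>Location and validity of the components\<close>

lemma N_pos: "0 < N"
  by (simp add: N_def)

lemma content_cell:
  "0 \<le> j \<Longrightarrow> j < 9 \<Longrightarrow> content (9 * idx q + j) r = cell q j (9 * idx q + j) r"
proof -
  assume j: "0 \<le> j" "j < 9"
  then have "(9 * idx q + j) div 9 = idx q" "(9 * idx q + j) mod 9 = j"
    by (simp_all add: div_add1_eq)
  then show ?thesis using j idx_bounds[of q] by (auto simp: content_def)
qed

lemma test_ok: "k \<in> test j c r \<Longrightarrow> valid_component k \<and> confined k (inner_tile c r) \<and> kind k"
  and tscale_ok: "k \<in> tscale p a c r \<Longrightarrow> valid_component k \<and> confined k (inner_tile c r) \<and> kind k"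
  using gadgets_ok by blast+

lemma content_ok:
  assumes "k \<in> content c r"
  shows "valid_component k \<and> confined k (inner_tile c r) \<and> kind k"
proof -
  have s: "valid_component (tslash l c r) \<and> confined (tslash l c r) (inner_tile c r) \<and> kind (tslash l c r)"
    if "l \<in> {-2, 1/8, 5/8}" for l
    using that confined_tslash[of l c r] by (auto simp: tslash_def slash_def intro!: kind_static)
  have bs: "valid_component (tbslash c r) \<and> confined (tbslash c r) (inner_tile c r) \<and> kind (tbslash c r)"
    using confined_tbslash[of c r] by (auto simp: tbslash_def bslash_def intro!: kind_static)
  have g: "valid_component (tgate c r) \<and> confined (tgate c r) (inner_tile c r) \<and> kind (tgate c r)"
    using confined_tgate[of c r] by (auto simp: tgate_def intro!: kind_static)
  have x: "valid_component k \<and> confined k (inner_tile c r) \<and> kind k" if k: "k \<in> xscale p b c r" for p b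
  proof -
    have "valid_component k" "is_wall k \<or> is_parabolic_wall k"
      using k by (auto simp: xscale_def xscale_parabs_def xscale_slashes_def parab_def slash_def Let_def op_defs)
    moreover have "confined k (inner_tile c r)"
      using k unfolding xscale_def inner_tile_def
      by (elim UnE; intro confined_mono[OF xscale_parabs_confined[of k p b c r]]
          confined_mono[OF xscale_slashes_confined[of k p b c r]] rect_mono) auto
    ultimately show ?thesis using kind_static by blast
  qed
  have p: "valid_component k \<and> confined k (inner_tile c r) \<and> kind k" if "k \<in> program q j c r" for q j
  proof -
    from that consider p' b where "k \<in> xscale p' b c r" | p' b where "k \<in> tscale p' b c r" | "k = tgate c r"
      unfolding program_def ops_def by (auto split: option.splits if_splits)
    then show ?thesis using x tscale_ok g by cases blast+
  qed
  consider j where "k \<in> test j c r" | q j where "k \<in> program q j c r" | "k = tbslash c r"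
    | l where "k = tslash l c r" "l \<in> {-2, 1/8, 5/8}"
    using assms unfolding content_def cell_def by (simp split: if_splits)
  then show ?thesis using p test_ok s bs by cases blast+
qed

lemma program_rows:
  assumes "program q j c r \<noteq> {}"
  shows "r < ceiling_row"
proof (rule ccontr)
  assume r: "\<not> r < ceiling_row"
  then have "r \<noteq> 4" "r \<noteq> 5" "r \<noteq> 6 + idx q'" for q'
    using idx_bounds[of q'] N_pos by (simp_all add: ceiling_row_def)
  then have "program q j c r = {}"
    by (simp add: program_def split: option.split)
  then show False using assms by simp
qed

lemma cell_rows:
  assumes "cell q j c r \<noteq> {}"
  shows "- 2 - N \<le> r \<and> r < ceiling_row"
proof (cases "4 \<le> r")
  case True
  then have "cell q j c r = program q j c r" by (simp add: cell_def)
  then show ?thesis using program_rows[of q j c r] assms True N_pos by simp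
next
  case False
  then have "0 \<le> r \<or> r = - 2 - idx q" using assms by (auto simp: cell_def split: if_splits)
  then show ?thesis using False idx_bounds[of q] N_pos by (auto simp: ceiling_row_def)
qed

lemma content_rows:
  assumes "content c r \<noteq> {}"
  shows "0 \<le> c \<and> c < 10 * N \<and> - 2 - N \<le> r \<and> r < ceiling_row"
proof (cases "0 \<le> c \<and> c < 9 * N")
  case True
  then have "cell (state (c div 9)) (c mod 9) c r \<noteq> {}" using assms by (simp add: content_def)
  then show ?thesis using cell_rows True N_pos by fastforce
next
  case False
  then have "9 * N \<le> c \<and> c < 10 * N" "r = 6 + (c - 9 * N) \<or> r = - 2 - (c - 9 * N)"
    using assms by (simp_all add: content_def split: if_splits)
  then show ?thesis using N_pos by (auto simp: ceiling_row_def)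
qed

lemma finite_content: "finite (content c r)"
proof -
  have x: "finite (xscale p b c r)" for p b c r
    by (simp add: xscale_def xscale_parabs_def xscale_slashes_def Let_def)
  have "finite (ops xscale o' c r)" "finite (ops tscale o' c r)" for o' c r
    by (simp_all add: ops_def x finite_gadgets split: option.split)
  then have "finite (program q j c r)" for q j c r
    by (simp add: program_def split: option.split)
  then have "finite (cell q j c r)" for q j c r
    by (simp add: cell_def finite_gadgets)
  then show ?thesis by (simp add: content_def)
qed

lemma finite_parts: "finite parts"
proof -
  have "(\<Union>c. \<Union>r. content c r) \<subseteq> (\<Union>c\<in>{0..<10 * N}. \<Union>r\<in>{- 2 - N..<ceiling_row}. content c r)"
    using content_rows by fastforce
  then have "finite (\<Union>c. \<Union>r. content c r)"
    by (rule finite_subset) (auto simp: finite_content)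
  then show ?thesis by (simp add: parts_def)
qed

lemma focal_pos: "0 < focal"
  using N_pos by (simp add: focal_def)

lemma parts_ok: "k \<in> parts \<Longrightarrow> valid_component k \<and> kind k"
proof -
  have "valid_component roof \<and> kind roof"
    using focal_pos by (auto simp: roof_def parab_def intro!: kind_static)
  then show "k \<in> parts \<Longrightarrow> valid_component k \<and> kind k"
    using content_ok by (auto simp: parts_def)
qed

lemma roof_above: "collides roof b \<Longrightarrow> grid ceiling_row + 1 < snd (pos b)"
proof -
  assume c: "collides roof b"
  obtain t x y u v where b: "b = bal t x y u v" by (cases b) (metis prod.collapse)
  define F where "F = (of_rat focal :: real)"
  have F: "F > 0" using focal_pos by (simp add: F_def)
  have h: "0 \<le> x" "x \<le> F" "y - (grid ceiling_row + 1) = F - x\<^sup>2 / (4 * F)"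
    using c focal_pos unfolding b roof_def by (auto simp: collides_parab F_def of_rat_add)
  have "x\<^sup>2 \<le> F\<^sup>2" using h by (intro power_mono) auto
  also have "F\<^sup>2 < F * (4 * F)" using F by (simp add: power2_eq_square)
  finally have "x\<^sup>2 / (4 * F) < F" using F by (simp add: divide_less_eq)
  then show ?thesis using h b by simp
qed

lemma content_below: "k \<in> content c r \<Longrightarrow> collides k b \<Longrightarrow> snd (pos b) < grid ceiling_row"
proof -
  assume k: "k \<in> content c r" "collides k b"
  then have "r < ceiling_row" using content_rows by blast
  then have "real_of_int r + 1 \<le> of_int ceiling_row" by linarith
  then show ?thesis using content_ok[OF k(1)] k(2) by (auto simp: confined_def inner_tile_def rect_def)
qed

section \<open>Composing the passages through tiles\<close>

abbreviation "go \<equiv> goes parts ground"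

text \<open>The upper bound yields the constant number of reflections per step; the lower bound
  serves the automata that do not halt.\<close>

definition leads :: "nat \<Rightarrow> nat \<Rightarrow> (ball \<Rightarrow> bool) \<Rightarrow> (ball \<Rightarrow> bool) \<Rightarrow> bool" where
  "leads l n P Q \<longleftrightarrow> (\<forall>b. P b \<longrightarrow> (\<exists>m b'. l \<le> m \<and> m \<le> n \<and> go m b b' \<and> Q b'))"

lemma leadsE:
  assumes "leads l n P Q" "P b"
  obtains m b' where "l \<le> m" "m \<le> n" "go m b b'" "Q b'"
  using assms unfolding leads_def by blast

lemma leads_trans [trans]:
  assumes "leads l n P Q" "leads l' n' Q R"
  shows "leads (l + l') (n + n') P R"
  unfolding leads_def
proof (intro allI impI)
  fix b assume "P b"
  obtain m b' where 1: "l \<le> m" "m \<le> n" "go m b b'" "Q b'" by (rule leadsE[OF assms(1) \<open>P b\<close>])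
  obtain m' b'' where 2: "l' \<le> m'" "m' \<le> n'" "go m' b' b''" "R b''" by (rule leadsE[OF assms(2) 1(4)])
  show "\<exists>m b'. l + l' \<le> m \<and> m \<le> n + n' \<and> go m b b' \<and> R b'"
    using goes_trans[OF 1(3) 2(3)] 1 2 by (intro exI[of _ "m + m'"] exI[of _ b'']) simp
qed

lemma leads_mono: "leads l n P Q \<Longrightarrow> l' \<le> l \<Longrightarrow> n \<le> n' \<Longrightarrow> leads l' n' P Q"
  unfolding leads_def by (meson order_trans)

text \<open>Locality in use: components of other tiles stay in their own inner tiles and the roof
  lies above all tiles, so what holds for one tile alone holds in the whole construction.\<close>

lemma go_tile:
  assumes "run (content c r) (tile c r) n b b'" "r < ceiling_row"
  shows "go n b b'"
proof -
  have rr: "real_of_int r + 1 \<le> of_int ceiling_row" using assms(2) by linarith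
  have "run parts ground n b b'"
  proof (rule run_local_mono[OF assms(1)])
    show "content c r \<subseteq> parts" by (auto simp: parts_def)
    show "tile c r \<subseteq> ground" using rr by (auto simp: tile_def ground_def rect_def)
    fix k assume k: "k \<in> parts - content c r"
    show "avoids k (tile c r)"
    proof (cases "k = roof")
      case True
      show ?thesis unfolding avoids_def True
      proof (intro allI impI)
        fix b assume "collides roof b"
        then show "pos b \<notin> tile c r" using roof_above[of b] rr by (auto simp: tile_def rect_def)
      qed
    next
      case False
      then obtain c' r' where c': "k \<in> content c' r'" using k by (auto simp: parts_def)
      then have "(c', r') \<noteq> (c, r)" using k by auto
      then have "inner_tile c' r' \<inter> tile c r = {}" by (rule inner_tile_disjoint)
      then show ?thesis using content_ok[OF c'] by (intro confined_avoids[of k "inner_tile c' r'"]) simp_all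
    qed
  qed
  then show ?thesis by (simp add: goes_def)
qed

lemma leads_tile':
  assumes "\<And>b. P b \<Longrightarrow> \<exists>n b'. n \<le> m \<and> run S (tile c r) n b b' \<and> Q b'" "content c r = S" "r < ceiling_row"
  shows "leads 0 m P Q"
  unfolding leads_def
proof (intro allI impI)
  fix b assume "P b"
  then obtain n b' where b': "n \<le> m" "run S (tile c r) n b b'" "Q b'" using assms(1) by blast
  then have "go n b b'" using go_tile[of c r n b b'] assms(2,3) by simp
  then show "\<exists>n b'. 0 \<le> n \<and> n \<le> m \<and> go n b b' \<and> Q b'" using b' by auto
qed

lemma leads_tile:
  assumes "\<And>b. P b \<Longrightarrow> \<exists>b'. run S (tile c r) n b b' \<and> Q b'" "content c r = S" "r < ceiling_row"
  shows "leads n n P Q"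
  unfolding leads_def
proof (intro allI impI)
  fix b assume "P b"
  then obtain b' where b': "run S (tile c r) n b b'" "Q b'" using assms(1) by blast
  then have "go n b b'" using go_tile[of c r n b b'] assms(2,3) by simp
  then show "\<exists>m b'. n \<le> m \<and> m \<le> n \<and> go m b b' \<and> Q b'" using b' by auto
qed

lemma leads_iterate:
  assumes "i \<le> (j :: int)" "\<And>l b. i \<le> l \<Longrightarrow> l < j \<Longrightarrow> P l b \<Longrightarrow> \<exists>b'. go 0 b b' \<and> P (l + 1) b'"
  shows "leads 0 0 (P i) (P j)"
  using assms
proof (induction j rule: int_ge_induct)
  case base then show ?case using goes_refl by (auto simp: leads_def)
next
  case (step j)
  then have "leads 0 0 (P i) (P j)" "leads 0 0 (P j) (P (j + 1))" by (auto simp: leads_def)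
  then show ?case using leads_trans[of 0 0 "P i" "P j" 0 0] by simp
qed

lemma climb:
  assumes x: "0 \<le> x" "x \<le> 1" and r: "r \<le> r'" "r' \<le> ceiling_row"
    and e: "\<And>l. r \<le> l \<Longrightarrow> l < r' \<Longrightarrow> content c l = {}"
  shows "leads 0 0 (beam_up c r x s) (beam_up c r' x s)"
proof (rule leads_iterate[OF r(1)])
  fix l b assume l: "r \<le> l" "l < r'" "beam_up c l x s b"
  then obtain b' where "run (content c l) (tile c l) 0 b b'" "beam_up c (l + 1) x s b'"
    using up_pass[OF l(3) x] e by auto
  moreover have "l < ceiling_row" using l r by simp
  ultimately show "\<exists>b'. go 0 b b' \<and> beam_up c (l + 1) x s b'" using go_tile by blast
qed

text \<open>Gates may stand in the way because they reflect only balls with \<open>u < v\<close>;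
  this lets beams from different columns share one bus.\<close>

lemma move_right:
  assumes x: "0 \<le> x" "x \<le> 1" and "c \<le> c'" and r: "r < ceiling_row"
    and e: "\<And>l. c \<le> l \<Longrightarrow> l < c' \<Longrightarrow> content l r \<subseteq> {tgate l r}"
  shows "leads 0 0 (beam_right c r x s) (beam_right c' r x s)"
proof (rule leads_iterate[OF \<open>c \<le> c'\<close>])
  fix l b assume l: "c \<le> l" "l < c'" "beam_right l r x s b"
  obtain b' where "run (content l r) (tile l r) 0 b b'" "beam_right (l + 1) r x s b'"
    using right_pass[OF l(3) x e[OF l(1,2)]] by auto
  then show "\<exists>b'. go 0 b b' \<and> beam_right (l + 1) r x s b'" using go_tile r by blast
qed

lemma descend:
  assumes x: "0 \<le> x" "x \<le> 1" and r: "r' \<le> r" "r < ceiling_row"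
    and e: "\<And>l. r' < l \<Longrightarrow> l \<le> r \<Longrightarrow> content c l = {}"
  shows "leads 0 0 (beam_down c r x s) (beam_down c r' x s)"
proof -
  \<comment> \<open>Negated indices adapt the descent to the iteration, which runs upwards.\<close>
  have "leads 0 0 (beam_down c (- (- r)) x s) (beam_down c (- (- r')) x s)"
  proof (rule leads_iterate[where P = "\<lambda>l. beam_down c (- l) x s"])
    fix l b assume l: "- r \<le> l" "l < - r'" "beam_down c (- l) x s b"
    then have "content c (- l) = {}" "- l < ceiling_row" using e r by simp_all
    moreover obtain b' where "run {} (tile c (- l)) 0 b b'" "beam_down c (- (l + 1)) x s b'"
      using down_pass[OF l(3) x] by auto
    ultimately show "\<exists>b'. go 0 b b' \<and> beam_down c (- (l + 1)) x s b'" using go_tile[of c "- l" 0 b b'] by auto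
  qed (use r in simp)
  then show ?thesis by simp
qed

lemma move_left:
  assumes x: "0 \<le> x" "x \<le> 1" and "c' \<le> c" and r: "r < ceiling_row"
    and e: "\<And>l. c' < l \<Longrightarrow> l \<le> c \<Longrightarrow> content l r = {}"
  shows "leads 0 0 (beam_left c r x s) (beam_left c' r x s)"
proof -
  have "leads 0 0 (beam_left (- (- c)) r x s) (beam_left (- (- c')) r x s)"
  proof (rule leads_iterate[where P = "\<lambda>l. beam_left (- l) r x s"])
    fix l b assume l: "- c \<le> l" "l < - c'" "beam_left (- l) r x s b"
    then have "content (- l) r = {}" using e by simp
    moreover obtain b' where "run {} (tile (- l) r) 0 b b'" "beam_left (- (l + 1)) r x s b'"
      using left_pass[OF l(3) x] by auto
    ultimately show "\<exists>b'. go 0 b b' \<and> beam_left (- (l + 1)) r x s b'" using go_tile[of "- l" r 0 b b'] r by auto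
  qed (use \<open>c' \<le> c\<close> in simp)
  then show ?thesis by simp
qed

end

lemma bool_option_cases:
  obtains "y = None" | "y = Some False" | "y = Some True"
proof (cases y)
  case (Some b) then show ?thesis using that by (cases b) simp_all
qed (rule that)

context machine
begin

section \<open>Routes between the cells and one step of the automaton\<close>

lemma idx_state:
  assumes "0 \<le> i" "i < N"
  shows "idx (state i) = i"
proof -
  have "nat i \<in> {0..<CARD('q)}" using assms by (simp add: N_def nat_less_iff)
  then have "nat i \<in> range (SOME f. bij_betw f (UNIV :: 'q set) {0..<CARD('q)})"
    by (simp only: bij_betw_imp_surj_on[OF idx_bij])
  then obtain q where "nat i = (SOME f. bij_betw f (UNIV :: 'q set) {0..<CARD('q)}) q" by (rule rangeE)
  then have "idx q = int (nat i)" by (simp only: idx_def comp_apply)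
  then have "idx q = i" using assms by simp
  then show ?thesis by (metis state_idx)
qed

lemma content_return:
  assumes "0 \<le> k" "k < N"
  shows "content (9 * N + k) r =
    (if r = 6 + k then {tbslash (9 * N + k) r} else if r = - 2 - k then {tslash (-2) (9 * N + k) r} else {})"
proof -
  have "\<not> (0 \<le> 9 * N + k \<and> 9 * N + k < 9 * N)" "9 * N \<le> 9 * N + k \<and> 9 * N + k < 10 * N"
    "9 * N + k - 9 * N = k" using assms by linarith+
  then show ?thesis by (simp only: content_def if_True if_False simp_thms)
qed

lemma content_bus:
  assumes "6 \<le> r" "0 \<le> c" "c < 9 * N"
  shows "content c r \<subseteq> {tgate c r}"
proof -
  have "\<not> r < 6" "r \<noteq> 0" "r \<noteq> 1" "r \<noteq> 2" "r \<noteq> 3" "r \<noteq> 4" "r \<noteq> 5" "4 \<le> r" using assms by linarith+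
  then have "content c r = program (state (c div 9)) (c mod 9) c r"
    using assms(2,3) by (simp only: content_def cell_def if_True if_False simp_thms)
  moreover have "program q j c r \<subseteq> {tgate c r}" for q j
    using \<open>r \<noteq> 4\<close> \<open>r \<noteq> 5\<close> by (simp add: program_def split: option.split)
  ultimately show ?thesis by simp
qed

text \<open>Below row 0 the only obstacle in row \<open>- 2 - i\<close> is the corner in column
  \<open>9 * i\<close>, so that the returning beams do not interfere.\<close>

lemma content_basement:
  assumes "r < 0" "0 \<le> c" "c < 9 * N" "c \<noteq> 9 * (- 2 - r)"
  shows "content c r = {}"
proof -
  have c: "9 * (c div 9) + c mod 9 = c" "0 \<le> c mod 9" "c mod 9 < 9" by simp_all
  then have "0 \<le> c div 9" "c div 9 < N" using assms by linarith+
  then have i: "idx (state (c div 9)) = c div 9" by (rule idx_state)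
  have n: "\<not> (c mod 9 = 0 \<and> r = - 2 - c div 9)" using assms(4) c(1) by auto
  have "r \<noteq> 0" "r \<noteq> 1" "r \<noteq> 2" "r \<noteq> 3" "\<not> 4 \<le> r" using assms(1) by linarith+
  then show ?thesis using assms(2,3) n by (simp only: content_def cell_def i if_True if_False simp_thms)
qed

lemma climb_cell:
  assumes "0 \<le> x" "x \<le> 1" "0 \<le> j" "j < 9" "r \<le> r'" "r' \<le> ceiling_row"
    "\<And>l. r \<le> l \<Longrightarrow> l < r' \<Longrightarrow> cell q j (9 * idx q + j) l = {}"
  shows "leads 0 0 (beam_up (9 * idx q + j) r x s) (beam_up (9 * idx q + j) r' x s)"
  by (rule climb) (simp_all add: content_cell assms)

lemma turn_at:
  assumes x: "0 \<le> x" "x \<le> 1" and j: "0 \<le> j" "j \<le> j'" "j' < 9" and r: "r < ceiling_row"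
    and e: "\<And>l. j \<le> l \<Longrightarrow> l < j' \<Longrightarrow> cell q l (9 * idx q + l) r = {}"
    and t: "cell q j' (9 * idx q + j') r = {tslash (-2) (9 * idx q + j') r}"
  shows "leads 1 1 (beam_right (9 * idx q + j) r x s) (beam_up (9 * idx q + j') (r + 1) x s)"
proof -
  have "leads 0 0 (beam_right (9 * idx q + j) r x s) (beam_right (9 * idx q + j') r x s)"
  proof (rule move_right[OF x _ r])
    fix l assume l: "9 * idx q + j \<le> l" "l < 9 * idx q + j'"
    have "content (9 * idx q + (l - 9 * idx q)) r = {}"
      by (subst content_cell) (use j l in \<open>simp_all add: e[of "l - 9 * idx q", simplified]\<close>)
    then show "content l r \<subseteq> {tgate l r}" by simp
  qed (use j in simp)
  also have "leads 1 1 \<dots> (beam_up (9 * idx q + j') (r + 1) x s)"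
    by (rule leads_tile[OF right_turn_up[OF _ x] _ r]) (use j t in \<open>simp_all add: content_cell\<close>)
  finally show ?thesis by simp
qed

lemma rows: "r \<le> 6 \<Longrightarrow> r < ceiling_row"
  using N_pos by (simp add: ceiling_row_def)

text \<open>The worst case consists of two tests with at most 8 collisions each and one
  turn.\<close>

lemma time_split:
  assumes x: "0 \<le> x" "x \<le> 1" and s: "s = 16 * stack_value ys"
  shows "leads 0 17 (beam_up (9 * idx q) 0 x s) (beam_up (9 * idx q + cell_of None (top_symbol ys)) 2 x s)"
proof -
  have t: "content (9 * idx q) 0 = test 0 (9 * idx q) 0" "content (9 * idx q) 1 = test 1 (9 * idx q) 1"
    using content_cell[of 0 q 0] content_cell[of 0 q 1] by (simp_all add: cell_def)
  have r: "0 < ceiling_row" "1 < ceiling_row" "2 < ceiling_row" by (rule rows; simp)+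
  have "\<exists>k \<le> 17. leads 0 k (beam_up (9 * idx q) 0 x s) (beam_up (9 * idx q + cell_of None (top_symbol ys)) 2 x s)"
  proof (cases "top_symbol ys" rule: bool_option_cases)
    case 1
    then have l: "low 0 s" using stack_value_top(1)[of ys] s by (simp add: low_def)
    have "leads 0 8 (beam_up (9 * idx q) 0 x s) (beam_right (9 * idx q + 1) 0 x s)"
      by (rule leads_tile'[OF test_low[OF _ x l] t(1) r(1)])
    also have "leads 1 1 \<dots> (beam_up (9 * idx q + 6) (0 + 1) x s)"
      by (rule turn_at[OF x]) (simp_all add: cell_def r)
    also have "leads 0 0 \<dots> (beam_up (9 * idx q + 6) 2 x s)"
    proof (rule climb_cell[OF x])
      fix l :: int assume "0 + 1 \<le> l" "l < 2"
      then have "l = 1" by simp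
      then show "cell q 6 (9 * idx q + 6) l = {}" by (simp add: cell_def)
    qed (use r in simp_all)
    finally show ?thesis using 1 leads_mono[of _ _ _ _ 0 17] by (intro exI[of _ 17]) simp
  next
    case 2
    then have hl: "high 0 s" "low 1 s" using stack_value_top(2)[of ys] s by (auto simp: low_def high_def)
    have "leads 0 8 (beam_up (9 * idx q) 0 x s) (beam_up (9 * idx q) (0 + 1) x s)"
      by (rule leads_tile'[OF test_high[OF _ x hl(1)] t(1) r(1)])
    also have "leads 0 8 \<dots> (beam_right (9 * idx q + 1) 1 x s)"
      unfolding add_0 by (rule leads_tile'[OF test_low[OF _ x hl(2)] t(2) r(2)])
    also have "leads 1 1 \<dots> (beam_up (9 * idx q + 3) (1 + 1) x s)"
      by (rule turn_at[OF x]) (simp_all add: cell_def r)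
    finally show ?thesis using 2 leads_mono[of _ _ _ _ 0 17] by (intro exI[of _ 17]) simp
  next
    case 3
    then have h: "high 0 s" "high 1 s" using stack_value_top(3)[of ys] s by (auto simp: high_def)
    have "leads 0 8 (beam_up (9 * idx q) 0 x s) (beam_up (9 * idx q) (0 + 1) x s)"
      by (rule leads_tile'[OF test_high[OF _ x h(1)] t(1) r(1)])
    also have "leads 0 8 \<dots> (beam_up (9 * idx q) (1 + 1) x s)"
      unfolding add_0 by (rule leads_tile'[OF test_high[OF _ x h(2)] t(2) r(2)])
    finally show ?thesis using 3 by (intro exI[of _ 16]) simp
  qed
  then show ?thesis using leads_mono by blast
qed

text \<open>A beam that leaves in row 2 crosses column \<open>j + 1\<close> unharmed, because the
  turning wall of that column stands in row 3.\<close>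

lemma space_split:
  assumes x: "x = stack_value xs" and j: "j = 0 \<or> j = 3 \<or> j = 6"
  shows "leads 0 2 (beam_up (9 * idx q + j) 2 x s) (beam_up (9 * idx q + (j + cell_of (top_symbol xs) (Some True))) 4 x s)"
proof -
  have x01: "0 \<le> x" "x \<le> 1" using stack_value_bounds[of xs] x by simp_all
  have j9: "0 \<le> j" "j + 2 < 9" "j mod 3 = 0" "(j + 1) mod 3 = 1" "(j + 2) mod 3 = 2" using j by auto
  have t: "content (9 * idx q + j) 2 = {tslash (5/8) (9 * idx q + j) 2}"
    "content (9 * idx q + j) 3 = {tslash (1/8) (9 * idx q + j) 3}"
    using j content_cell[of j q 2] content_cell[of j q 3] by (auto simp: cell_def)
  have rt: "(of_rat (5/8) :: real) = 5/8" "(of_rat (1/8) :: real) = 1/8" by (simp_all add: of_rat_divide)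
  have r: "2 < ceiling_row" "3 < ceiling_row" "4 < ceiling_row" by (rule rows; simp)+
  show ?thesis
  proof (cases "top_symbol xs" rule: bool_option_cases)
    case 1
    then have x0: "x < of_rat (5/8)" "x < of_rat (1/8)" using stack_value_top(1)[of xs] x rt by auto
    have "leads 0 0 (beam_up (9 * idx q + j) 2 x s) (beam_up (9 * idx q + j) (2 + 1) x s)"
      by (rule leads_tile[OF up_miss[OF _ x0(1) x01] t(1) r(1)]) simp_all
    also have "leads 0 0 \<dots> (beam_up (9 * idx q + j) 4 x s)"
      using leads_tile[OF up_miss[OF _ x0(2) x01] t(2) r(2)] by simp
    finally show ?thesis using 1 leads_mono[of _ _ _ _ 0 2] by simp
  next
    case 2
    then have x0: "x < of_rat (5/8)" "of_rat (1/8) \<le> x" using stack_value_top(2)[of xs] x rt by auto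
    have "leads 0 0 (beam_up (9 * idx q + j) 2 x s) (beam_up (9 * idx q + j) (2 + 1) x s)"
      by (rule leads_tile[OF up_miss[OF _ x0(1) x01] t(1) r(1)]) simp_all
    also have "leads 1 1 \<dots> (beam_right (9 * idx q + (j + 1)) 3 x s)"
      using leads_tile[OF up_turn_right[OF _ x0(2) x01] t(2) r(2)] by (simp add: add.assoc)
    also have "leads 1 1 \<dots> (beam_up (9 * idx q + (j + 1)) (3 + 1) x s)"
      by (rule turn_at[OF x01]) (use j9 r in \<open>auto simp: cell_def\<close>)
    finally show ?thesis using 2 leads_mono[of _ _ _ _ 0 2] by simp
  next
    case 3
    then have x0: "of_rat (5/8) \<le> x" using stack_value_top(3)[of xs] x rt by auto
    have "leads 1 1 (beam_up (9 * idx q + j) 2 x s) (beam_right (9 * idx q + (j + 1)) 2 x s)"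
      using leads_tile[OF up_turn_right[OF _ x0 x01] t(1) r(1)] by (simp add: add.assoc)
    also have "leads 1 1 \<dots> (beam_up (9 * idx q + (j + 2)) (2 + 1) x s)"
    proof (rule turn_at[OF x01])
      fix l assume "j + 1 \<le> l" "l < j + 2"
      then have "l = j + 1" by simp
      then show "cell q l (9 * idx q + l) 2 = {}" using j9 by (simp add: cell_def)
    qed (use j9 r in \<open>auto simp: cell_def\<close>)
    also have "leads 0 0 \<dots> (beam_up (9 * idx q + (j + 2)) 4 x s)"
    proof (rule climb_cell[OF x01])
      fix l :: int assume "2 + 1 \<le> l" "l < 4"
      then have "l = 3" by simp
      then show "cell q (j + 2) (9 * idx q + (j + 2)) l = {}" using j9 by (simp add: cell_def)
    qed (use j9 r in auto)
    finally show ?thesis using 3 leads_mono[of _ _ _ _ 0 2] by simp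
  qed
qed

lemma read_tops:
  "leads 0 19 (beam_up (9 * idx q) 0 (stack_value xs) (16 * stack_value ys))
     (beam_up (9 * idx q + cell_of (top_symbol xs) (top_symbol ys)) 4 (stack_value xs) (16 * stack_value ys))"
proof -
  have x: "0 \<le> stack_value xs" "stack_value xs \<le> 1" using stack_value_bounds[of xs] by simp_all
  have j: "cell_of None y = 0 \<or> cell_of None y = 3 \<or> cell_of None y = 6" for y
    by (auto split: option.split bool.split)
  \<comment> \<open>The column number is a sum of one contribution per stack, and
    \<open>Some True\<close> for the second and \<open>None\<close> for the first stack contribute
    0; so the two splits add up.\<close>
  have e: "cell_of None y + cell_of z (Some True) = cell_of z y" for y z by simp
  show ?thesis
    using leads_trans[OF time_split[OF x refl, where q = q and ys = ys] space_split[OF refl j, where xs = xs]]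
    unfolding e by simp
qed

lemma apply_first:
  assumes c: "content c r = ops xscale (stack_op d (top_symbol xs)) c r" and r: "r < ceiling_row"
  shows "leads 0 8 (beam_up c r (stack_value xs) s) (beam_up c (r + 1) (stack_value (perform d xs)) s)"
proof (cases "stack_op d (top_symbol xs)")
  case None
  have "leads 0 0 (beam_up c r (stack_value xs) s) (beam_up c (r + 1) (stack_value xs) s)"
    by (rule leads_tile[OF up_pass _ r]) (use c None stack_value_bounds[of xs] in \<open>auto simp: ops_def\<close>)
  then show ?thesis unfolding stack_op_None[OF None] by (rule leads_mono) simp_all
next
  case (Some pb)
  then obtain p a where pb: "stack_op d (top_symbol xs) = Some (p, a)" by (cases pb) auto
  then obtain z where z: "0 \<le> z" "z \<le> of_rat (op_width p)" "stack_value xs = of_rat (op_in p a) + z"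
    "stack_value (perform d xs) = of_rat (op_out p a) + of_rat (op_scale p) * z"
    by (rule stack_op_Some)
  have "leads 4 4 (beam_up c r (of_rat (op_in p a) + z) s) (beam_up c (r + 1) (of_rat (op_out p a) + of_rat (op_scale p) * z) s)"
    by (rule leads_tile[OF xscale_run[OF _ z(1,2)] _ r]) (use c pb in \<open>auto simp: ops_def\<close>)
  then show ?thesis unfolding z(3,4) by (rule leads_mono) auto
qed

lemma apply_second:
  assumes x: "0 \<le> x" "x \<le> 1"
    and c: "content c r = ops tscale (stack_op d (top_symbol ys)) c r" and r: "r < ceiling_row"
  shows "leads 0 8 (beam_up c r x (16 * stack_value ys)) (beam_up c (r + 1) x (16 * stack_value (perform d ys)))"
proof (cases "stack_op d (top_symbol ys)")
  case None
  have "leads 0 0 (beam_up c r x (16 * stack_value ys)) (beam_up c (r + 1) x (16 * stack_value ys))"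
    by (rule leads_tile[OF up_pass[OF _ x] _ r]) (use c None in \<open>auto simp: ops_def\<close>)
  then show ?thesis unfolding stack_op_None[OF None] by (rule leads_mono) simp_all
next
  case (Some pb)
  then obtain p a where pb: "stack_op d (top_symbol ys) = Some (p, a)" by (cases pb) auto
  then obtain z where z: "0 \<le> z" "z \<le> of_rat (op_width p)" "stack_value ys = of_rat (op_in p a) + z"
    "stack_value (perform d ys) = of_rat (op_out p a) + of_rat (op_scale p) * z"
    by (rule stack_op_Some)
  have e: "16 * stack_value ys = 16 * of_rat (op_in p a) + 16 * z"
    "16 * stack_value (perform d ys) = 16 * of_rat (op_out p a) + of_rat (op_scale p) * (16 * z)"
    using z by (simp_all add: algebra_simps)
  show ?thesis
    unfolding e by (rule leads_tile'[OF tscale_run[OF _ x] _ r]) (use c pb z in \<open>auto simp: ops_def\<close>)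
qed

text \<open>Four corners: the gate, the two ends of the return channel and the wall below the first
  column of the next state. They alone already guarantee that every step contains a
  collision.\<close>

lemma bus:
  assumes x: "0 \<le> x" "x \<le> 1" and j: "0 \<le> j" "j < 9"
    and tr: "transition M q (cell_top1 j) (cell_top2 j) = Some (q', d1, d2)"
  shows "leads 4 4 (beam_up (9 * idx q + j) 6 x s) (beam_up (9 * idx q') 0 x s)"
proof -
  define c where "c = 9 * idx q + j"
  define i where "i = idx q'"
  have i: "0 \<le> i" "i < N" "6 + i < ceiling_row" "- 2 - i < ceiling_row" "0 \<le> ceiling_row"
    using idx_bounds[of q'] by (simp_all add: i_def ceiling_row_def)
  have c: "0 \<le> c" "c < 9 * N" using idx_bounds[of q] j by (simp_all add: c_def)
  have row: "content c l = (if l = 6 + i then {tgate c l} else {})" if "6 \<le> l" for l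
    using that j tr by (simp add: c_def content_cell cell_def program_def i_def)
  have "leads 0 0 (beam_up c 6 x s) (beam_up c (6 + i) x s)"
    by (rule climb[OF x]) (use i row in auto)
  also have "leads 1 1 \<dots> (beam_right (c + 1) (6 + i) x s)"
    by (rule leads_tile[OF up_join_right[OF _ x] _ i(3)])
       (use row[of "6 + i"] i in simp_all)
  also have "leads 0 0 \<dots> (beam_right (9 * N + i) (6 + i) x s)"
  proof (rule move_right[OF x])
    fix l assume l: "c + 1 \<le> l" "l < 9 * N + i"
    show "content l (6 + i) \<subseteq> {tgate l (6 + i)}"
    proof (cases "l < 9 * N")
      case True then show ?thesis using content_bus[of "6 + i" l] l c i by simp
    next
      case False then show ?thesis using content_return[of "l - 9 * N" "6 + i"] l i by simp
    qed
  qed (use c i in auto)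
  also have "leads 1 1 \<dots> (beam_down (9 * N + i) (6 + i - 1) x s)"
    by (rule leads_tile[OF right_turn_down[OF _ x]]) (use i content_return in auto)
  also have "leads 0 0 \<dots> (beam_down (9 * N + i) (- 2 - i) x s)"
    by (rule descend[OF x]) (use i content_return in auto)
  also have "leads 1 1 \<dots> (beam_left (9 * N + i - 1) (- 2 - i) x s)"
    by (rule leads_tile[OF down_turn_left[OF _ x]]) (use i content_return in auto)
  also have "leads 0 0 \<dots> (beam_left (9 * i) (- 2 - i) x s)"
  proof (rule move_left[OF x])
    fix l assume l: "9 * i < l" "l \<le> 9 * N + i - 1"
    show "content l (- 2 - i) = {}"
    proof (cases "l < 9 * N")
      case True then show ?thesis using content_basement[of "- 2 - i" l] l i by simp
    next
      case False then show ?thesis using content_return[of "l - 9 * N" "- 2 - i"] l i by simp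
    qed
  qed (use i in auto)
  also have "leads 1 1 \<dots> (beam_up (9 * i) (- 2 - i + 1) x s)"
  proof (rule leads_tile[OF left_turn_up[OF _ x]])
    show "content (9 * i) (- 2 - i) = {tbslash (9 * i) (- 2 - i)}"
      using content_cell[of 0 q' "- 2 - i"] i by (simp add: i_def cell_def)
  qed (use i in auto)
  also have "leads 0 0 \<dots> (beam_up (9 * i) 0 x s)"
    by (rule climb[OF x]) (use i content_basement[of _ "9 * i"] in auto)
  finally show ?thesis unfolding i_def c_def by (rule leads_mono) auto
qed

lemma machine_step:
  assumes tr: "transition M q (top_symbol xs) (top_symbol ys) = Some (q', d1, d2)"
  shows "leads 1 40 (beam_up (9 * idx q) 0 (stack_value xs) (16 * stack_value ys))
    (beam_up (9 * idx q') 0 (stack_value (perform d1 xs)) (16 * stack_value (perform d2 ys)))"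
proof -
  define j where "j = cell_of (top_symbol xs) (top_symbol ys)"
  have j: "0 \<le> j" "j < 9" using cell_of_bounds by (simp_all only: j_def)
  have tr': "transition M q (cell_top1 j) (cell_top2 j) = Some (q', d1, d2)"
    unfolding j_def cell_top_of by (rule tr)
  have x: "0 \<le> stack_value zs" "stack_value zs \<le> 1" for zs using stack_value_bounds[of zs] by simp_all
  have c: "content (9 * idx q + j) 4 = ops xscale (stack_op d1 (top_symbol xs)) (9 * idx q + j) 4"
    "content (9 * idx q + j) 5 = ops tscale (stack_op d2 (top_symbol ys)) (9 * idx q + j) 5"
    using j tr' cell_top_of[of "top_symbol xs" "top_symbol ys"] unfolding j_def[symmetric]
    by (simp_all add: content_cell cell_def program_def)
  have "leads 0 19 (beam_up (9 * idx q) 0 (stack_value xs) (16 * stack_value ys))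
      (beam_up (9 * idx q + j) 4 (stack_value xs) (16 * stack_value ys))"
    unfolding j_def by (rule read_tops)
  also have "leads 0 8 \<dots> (beam_up (9 * idx q + j) 5 (stack_value (perform d1 xs)) (16 * stack_value ys))"
    using apply_first[OF c(1)] rows[of 4] by simp
  also have "leads 0 8 \<dots> (beam_up (9 * idx q + j) 6 (stack_value (perform d1 xs)) (16 * stack_value (perform d2 ys)))"
    using apply_second[OF x c(2)] rows[of 5] by simp
  also have "leads 4 4 \<dots> (beam_up (9 * idx q') 0 (stack_value (perform d1 xs)) (16 * stack_value (perform d2 ys)))"
    by (rule bus[OF x j tr'])
  \<comment> \<open>The upper bounds add up to \<open>19 + 8 + 8 + 4 = 39\<close>.\<close>
  finally show ?thesis by (rule leads_mono) auto
qed

end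

section \<open>Halting, the target and the simulation\<close>

context machine
begin

lemma machine_halt:
  assumes tr: "transition M q (top_symbol xs) (top_symbol ys) = None"
  shows "leads 0 19 (beam_up (9 * idx q) 0 (stack_value xs) (16 * stack_value ys))
    (beam_up (9 * idx q + cell_of (top_symbol xs) (top_symbol ys)) ceiling_row (stack_value xs) (16 * stack_value ys))"
proof -
  define j where "j = cell_of (top_symbol xs) (top_symbol ys)"
  have j: "0 \<le> j" "j < 9" using cell_of_bounds by (simp_all only: j_def)
  have tr': "transition M q (cell_top1 j) (cell_top2 j) = None"
    unfolding j_def cell_top_of by (rule tr)
  have x: "0 \<le> stack_value xs" "stack_value xs \<le> 1" using stack_value_bounds[of xs] by simp_all
  have "leads 0 0 (beam_up (9 * idx q + j) 4 (stack_value xs) (16 * stack_value ys))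
      (beam_up (9 * idx q + j) ceiling_row (stack_value xs) (16 * stack_value ys))"
    by (rule climb_cell[OF x j]) (use rows[of 4] tr' in \<open>simp_all add: cell_def program_def\<close>)
  from leads_trans[OF read_tops this[unfolded j_def]] show ?thesis by simp
qed

lemma parts_above:
  assumes "k \<in> parts" "k \<noteq> roof" "grid ceiling_row \<le> snd (pos b)"
  shows "\<not> collides k b"
  using assms content_below by (fastforce simp: parts_def)

lemma real_goal: "real_point goal = (0, grid ceiling_row + 1)"
  by (simp add: goal_def of_rat_add)

text \<open>Parallel rays are focused: a halting ball reaches the target wherever it leaves the tiles.\<close>

lemma roof_reaches:
  assumes b: "beam_up c ceiling_row x s b" and x: "0 \<le> x" "x \<le> 1" and c: "0 \<le> c" "c < 9 * N"
  shows "reaches_in parts 1 b (real_point goal)"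
proof -
  obtain k :: nat where b: "b = bal (1 + s + 512 * real k) (grid c + x) (grid ceiling_row) 0 1"
    using b by (auto simp: beam_up_def)
  define t where "t = 1 + s + 512 * real k"
  define X where "X = grid c + x"
  define Y where "Y = grid ceiling_row"
  define F where "F = (of_rat focal :: real)"
  define W where "W = F + X\<^sup>2 / (4 * F)"
  define V where "V = F - X\<^sup>2 / (4 * F)"
  have F: "F = 5120 * of_int N" "F > 0" using N_pos by (simp_all add: F_def focal_def of_rat_mult)
  have "real_of_int c + 1 \<le> 9 * of_int N" "0 \<le> real_of_int c" using c by linarith+
  then have X: "0 \<le> X" "X \<le> F" using x by (simp_all add: X_def F)
  have "X\<^sup>2 \<le> F\<^sup>2" using X by (intro power_mono) auto
  also have "F\<^sup>2 < F * (4 * F)" using F(2) by (simp add: power2_eq_square)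
  finally have V: "V > 0" using F(2) by (simp add: V_def divide_less_eq)
  have W: "W > 0" using F(2) by (simp add: W_def add_pos_nonneg)
  have roof: "collides roof (bal t' x' y' u v) \<longleftrightarrow> 0 \<le> x' \<and> x' \<le> F \<and> y' - (Y + 1) = F - x'\<^sup>2 / (4 * F)" for t' x' y' u v
    unfolding roof_def using focal_pos by (subst collides_parab) (auto simp: F_def Y_def of_rat_add)
  define b1 where "b1 = bal (t + (1 + V)) X (Y + 1 + V) (- X / W) (- V / W)"
  have "rebound roof (bal (t + (1 + V)) X (Y + 1 + V) 0 1) = (- X / W, - V / W)"
    using rebound_parab_axial[of focal 1 W X V 0 "col ceiling_row + 1" 0 focal "t + (1 + V)" "Y + 1 + V" 1] focal_pos
    by (simp add: roof_def W_def V_def F_def)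
  then have b1: "b1 = (fly (1 + V) (bal t X Y 0 1))\<lparr>vel := rebound roof (fly (1 + V) (bal t X Y 0 1))\<rparr>"
    by (simp add: b1_def add.assoc)
  have "next_collision parts (bal t X Y 0 1) b1"
    unfolding next_collision_def b1
  proof (intro exI conjI)
    show "0 < 1 + V" using V by simp
    show "undisturbed parts (bal t X Y 0 1) (1 + V)"
      unfolding undisturbed_def
    proof (intro ballI)
      fix r k assume r: "r \<in> {0<..<1 + V}" and k: "k \<in> parts"
      show "\<not> collides k (fly r (bal t X Y 0 1))"
      proof (cases "k = roof")
        case True
        then show ?thesis using r by (auto simp: roof V_def)
      next
        case False
        then show ?thesis using parts_above[OF k] r by (auto simp: Y_def)
      qed
    qed
    have "collides roof (fly (1 + V) (bal t X Y 0 1))" using X by (simp add: roof V_def)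
    moreover have "\<not> collides k (fly (1 + V) (bal t X Y 0 1))" if "k \<in> parts" "k \<noteq> roof" for k
      using parts_above[OF that] V by (simp add: Y_def)
    ultimately show "{k \<in> parts. collides k (fly (1 + V) (bal t X Y 0 1))} = {roof}"
      by (auto simp: parts_def)
  qed (rule refl)
  moreover have "undisturbed parts b1 W"
    unfolding undisturbed_def
  proof (intro ballI)
    fix r k assume r: "r \<in> {0<..<W}" and k: "k \<in> parts"
    define m where "m = 1 - r / W"
    have m: "0 < m" "m < 1" using r W by (auto simp: m_def field_simps)
    have fl: "fly r b1 = bal (t + (1 + V) + r) (m * X) (Y + 1 + m * V) (- X / W) (- V / W)"
      by (simp add: b1_def m_def algebra_simps)
    show "\<not> collides k (fly r b1)"
    proof (cases "k = roof")
      case True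
      \<comment> \<open>The same factorization as for two confocal parabolas: on the ray to the
        focus, \<open>m = 1\<close> is the only contact with the roof for
        \<open>m > 0\<close>.\<close>
      have "F - (m * X)\<^sup>2 / (4 * F) - m * V = (1 - m) * (F + m * X\<^sup>2 / (4 * F))"
        using F(2) by (simp add: V_def field_simps power2_eq_square)
      moreover have "0 < F + m * X\<^sup>2 / (4 * F)" using F(2) m by (intro add_pos_nonneg) auto
      ultimately have "m * V \<noteq> F - (m * X)\<^sup>2 / (4 * F)" using m by auto
      then show ?thesis by (simp add: True fl roof)
    next
      case False
      then show ?thesis using parts_above[OF k] m V by (simp add: fl Y_def)
    qed
  qed
  then have "reaches_in parts 0 b1 (pos (fly W b1))" using W by (intro reaches_in_0I) auto
  \<comment> \<open>The reflected ball has unit speed, and \<open>W\<close> is its distance from the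
    focus.\<close>
  moreover have "pos (fly W b1) = real_point goal"
    using W by (simp add: b1_def real_goal Y_def)
  ultimately show ?thesis
    using reaches_in_SucI[of parts "bal t X Y 0 1" b1 0] by (simp add: b t_def X_def Y_def)
qed

definition crossings :: "'q \<Rightarrow> crossing" where
  "crossings q = \<lparr>base_point = (col (9 * idx q), 0), extent = (1, 0), crossing_velocity = (0, 1),
     base_time = 1, duration = 16\<rparr>"

lemma encodes_iff: "encodes crossings 512 b (q, xs, ys) \<longleftrightarrow> beam_up (9 * idx q) 0 (stack_value xs) (16 * stack_value ys) b"
  by (cases b) (auto simp: crossings_def beam_up_def mult.commute)

lemma valid_crossings: "valid_encoding crossings 512"
proof -
  have "crossing_segment (crossings q) \<inter> crossing_segment (crossings q') = {}" if "q \<noteq> q'" for q q'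
  proof (rule ccontr)
    assume "\<not> ?thesis"
    then obtain x y where "(x, y) \<in> crossing_segment (crossings q)" "(x, y) \<in> crossing_segment (crossings q')"
      by auto
    then have "grid (9 * idx q) \<le> x" "x \<le> grid (9 * idx q) + 1"
      "grid (9 * idx q') \<le> x" "x \<le> grid (9 * idx q') + 1"
      by (auto simp: crossing_segment_def crossings_def closed_segment_iff)
    then have "idx q = idx q'" by linarith
    then show False using that inj_idx by (auto dest: injD)
  qed
  then show ?thesis
    by (auto simp: valid_encoding_def crossings_def cross_def)
qed

lemma encodes_step:
  assumes "encodes crossings 512 b c" "successor M c = Some c'"
  obtains n b' where "1 \<le> n" "n \<le> 40" "go n b b'" "encodes crossings 512 b' c'"
proof -
  obtain q xs ys where c: "c = (q, xs, ys)" by (cases c) auto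
  obtain q' d1 d2 where tr: "transition M q (top_symbol xs) (top_symbol ys) = Some (q', d1, d2)"
    and c': "c' = (q', perform d1 xs, perform d2 ys)"
    using assms(2) by (auto simp: c)
  have "beam_up (9 * idx q) 0 (stack_value xs) (16 * stack_value ys) b"
    using assms(1) unfolding c encodes_iff .
  from leadsE[OF machine_step[OF tr] this] that show ?thesis
    unfolding c' encodes_iff by blast
qed

lemma encodes_halt:
  assumes "encodes crossings 512 b c" "successor M c = None"
  shows "\<exists>n b'. go n b b' \<and> reaches_in parts 1 b' (real_point goal)"
proof -
  obtain q xs ys where c: "c = (q, xs, ys)" by (cases c) auto
  have tr: "transition M q (top_symbol xs) (top_symbol ys) = None" using assms(2) by (simp add: c)
  obtain n b' where "go n b b'"
    and u: "beam_up (9 * idx q + cell_of (top_symbol xs) (top_symbol ys)) ceiling_row (stack_value xs) (16 * stack_value ys) b'"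
    using leadsE[OF machine_halt[OF tr] assms(1)[unfolded c encodes_iff]] by metis
  moreover have "reaches_in parts 1 b' (real_point goal)"
    using cell_of_bounds[of "top_symbol xs" "top_symbol ys"] idx_bounds[of q] stack_value_bounds[of xs]
    by (intro roof_reaches[OF u]) linarith+
  ultimately show ?thesis by blast
qed

lemma goes_reaches: "goes C A n b b' \<Longrightarrow> reaches_in C m b' p \<Longrightarrow> reaches C b p"
  unfolding goes_def using travels_reaches_in reaches_iff by blast

lemma encodes_steps:
  assumes "(c, c') \<in> {(x, y). successor M x = Some y}\<^sup>*" "encodes crossings 512 b c"
  shows "\<exists>n b'. go n b b' \<and> encodes crossings 512 b' c'"
  using assms
proof (induction rule: rtrancl_induct)
  case base then show ?case using goes_refl by blast
next
  case (step c' c'')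
  then obtain n b' where b': "go n b b'" "encodes crossings 512 b' c'" by blast
  moreover have "successor M c' = Some c''" using step.hyps by simp
  ultimately obtain m b'' where "go m b' b''" "encodes crossings 512 b'' c''"
    using encodes_step by metis
  then show ?case using goes_trans[OF b'(1)] by blast
qed

lemma reaches_goal_iff:
  assumes e: "encodes crossings 512 b c"
  shows "reaches parts b (real_point goal) \<longleftrightarrow> halts M c"
proof
  assume "halts M c"
  then obtain c' where c': "(c, c') \<in> {(x, y). successor M x = Some y}\<^sup>*" "successor M c' = None"
    by (auto simp: halts_def)
  then obtain n b' where b': "go n b b'" "encodes crossings 512 b' c'" using encodes_steps[OF _ e] by blast
  then obtain m b'' where b'': "go m b' b''" "reaches_in parts 1 b'' (real_point goal)"
    using encodes_halt c'(2) by blast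
  then show "reaches parts b (real_point goal)" using goes_reaches goes_trans b'(1) by blast
next
  assume "reaches parts b (real_point goal)"
  then obtain m where m: "reaches_in parts m b (real_point goal)" by (auto simp: reaches_iff)
  show "halts M c"
  proof (rule ccontr)
    assume nh: "\<not> halts M c"
    \<comment> \<open>Without halting there is always a further step, and each step costs at least
      one collision; so arbitrarily many collisions occur inside \<open>ground\<close>.\<close>
    have "\<exists>n c' b'. l \<le> n \<and> go n b b' \<and> encodes crossings 512 b' c' \<and> (c, c') \<in> {(x, y). successor M x = Some y}\<^sup>*" for l
    proof (induction l)
      case 0 then show ?case using e goes_refl by blast
    next
      case (Suc l)
      then obtain n c' b' where *: "l \<le> n" "go n b b'" "encodes crossings 512 b' c'"
        "(c, c') \<in> {(x, y). successor M x = Some y}\<^sup>*" by blast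
      have "successor M c' \<noteq> None"
      proof
        assume "successor M c' = None"
        with *(4) have "halts M c" unfolding halts_def by (intro exI[of _ c'] conjI)
        with nh show False ..
      qed
      then obtain c'' where c'': "successor M c' = Some c''" by blast
      obtain m b'' where b'': "1 \<le> m" "go m b' b''" "encodes crossings 512 b'' c''"
        using encodes_step[OF *(3) c''] by metis
      have "(c, c'') \<in> {(x, y). successor M x = Some y}\<^sup>*" using *(4) c'' by (auto intro: rtrancl_into_rtrancl)
      moreover have "go (n + m) b b''" using goes_trans *(2) b''(2) by blast
      moreover have "Suc l \<le> n + m" using *(1) b''(1) by simp
      ultimately show ?case using b''(3) by blast
    qed
    then obtain n b' where n: "Suc m \<le> n" "go n b b'" by blast
    \<comment> \<open>A positive number of collisions excludes the trivial alternative in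
      \<open>goes\<close>.\<close>
    then have "run parts ground n b b'" by (auto simp: goes_def)
    moreover have "real_point goal \<notin> ground" by (simp add: real_goal ground_def)
    ultimately have "n \<le> m" using run_reaches_in m by blast
    then show False using n by simp
  qed
qed

lemma simulates_machine: "simulates parts goal crossings 512 40 M"
  unfolding simulates_def
proof (intro conjI allI impI)
  show "valid_encoding crossings 512" by (rule valid_crossings)
next
  fix b c c' assume "encodes crossings 512 b c \<and> successor M c = Some c'"
  then obtain n b' where "n \<le> 40" "go n b b'" "encodes crossings 512 b' c'"
    using encodes_step by metis
  then show "\<exists>n\<le>40. \<exists>b'. travels parts n b b' \<and> encodes crossings 512 b' c'"
    using goes_travels by blast
next
  fix xs ys
  obtain r1 r2 where r: "stack_value xs = of_rat r1" "stack_value ys = of_rat r2"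
    using stack_value_rat by metis
  define c where "c = 9 * idx (initial M)"
  \<comment> \<open>The depth of the start below the crossing segment is the time at which the
    segment must be crossed. Stack values are rational, hence so are the data, and the base time 1
    makes the entering flight nonempty also for an empty second stack.\<close>
  define I where "I = \<lparr>start_position = (col c + r1, - (1 + 16 * r2)), start_velocity = (0, 1),
    components = parts, target = goal\<rparr>"
  define s where "s = 1 + 16 * stack_value ys"
  have x: "0 \<le> stack_value xs" "stack_value xs \<le> 1" and s: "0 < s" "s < 17"
    using stack_value_bounds[of xs] stack_value_bounds[of ys] by (simp_all add: s_def)
  define b where "b = bal s (grid c + stack_value xs) 0 0 1"
  have ent: "entering_ball I = bal 0 (grid c + stack_value xs) (- s) 0 1"
    by (simp add: entering_ball_def I_def r s_def of_rat_add of_rat_mult of_rat_minus of_rat_diff)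
  have "content c (- 1) = {}"
    by (rule content_basement) (use idx_bounds[of "initial M"] in \<open>simp_all add: c_def\<close>)
  moreover have "run {} (tile c (- 1)) 0 (entering_ball I) b"
    unfolding ent b_def by (rule run_strip[where s = s]) (use x s in \<open>auto simp: tile_def\<close>)
  ultimately have g: "go 0 (entering_ball I) b"
    using go_tile[of c "- 1"] rows[of "- 1"] by simp
  have e: "encodes crossings 512 b (initial M, xs, ys)"
    unfolding encodes_iff b_def c_def[symmetric] s_def
    using beam_bal(1)[of c 0 "stack_value xs" "16 * stack_value ys" 0] by simp
  show "\<exists>I. pinball_instance I \<and> components I = parts \<and> target I = goal \<and>
      (\<exists>n\<le>40. \<exists>b. travels parts n (entering_ball I) b \<and> encodes crossings 512 b (initial M, xs, ys)) \<and>
      (pinball_wizard I \<longleftrightarrow> halts M (initial M, xs, ys))"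
  proof (intro exI[of _ I] conjI)
    show "pinball_instance I" using finite_parts parts_ok by (auto simp: pinball_instance_def I_def)
    show "components I = parts" "target I = goal" by (simp_all add: I_def)
    show "\<exists>n\<le>40. \<exists>b. travels parts n (entering_ball I) b \<and> encodes crossings 512 b (initial M, xs, ys)"
      using goes_travels[OF g] e by blast
    \<comment> \<open>The entering flight stays in \<open>ground\<close> and cannot meet the target,
      so reachability is the same before and after it.\<close>
    have "reaches parts (entering_ball I) (real_point goal) \<longleftrightarrow> reaches parts b (real_point goal)"
    proof
      assume "reaches parts (entering_ball I) (real_point goal)"
      then obtain m where m: "reaches_in parts m (entering_ball I) (real_point goal)" by (auto simp: reaches_iff)
      have "real_point goal \<notin> ground" by (simp add: real_goal ground_def)
      then show "reaches parts b (real_point goal)"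
        using g m run_reaches_in unfolding goes_def reaches_iff by blast
    next
      assume "reaches parts b (real_point goal)"
      then show "reaches parts (entering_ball I) (real_point goal)"
        using goes_reaches[OF g] unfolding reaches_iff by blast
    qed
    then show "pinball_wizard I \<longleftrightarrow> halts M (initial M, xs, ys)"
      using reaches_goal_iff[OF e] by (simp add: pinball_wizard_def I_def)
  qed
qed

end

section \<open>The two instances of the machine\<close>

lemma moving_tscale_ok:
  assumes "k \<in> moving_tscale p b c r"
  shows "valid_component k" "confined k (inner_tile c r)" "is_wall k \<or> is_parabolic_wall k \<or> is_moving_wall k"
proof -
  have num: "0 \<le> 765 + ts_delay p b" "0 < ts_width p" "ts_width p \<le> 17" "- 59 \<le> (of_rat (ts_pos p b) :: real)"
    by (auto simp: ts_defs of_rat_simps)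
  have "valid_component (swap_wall1 e a b' w t0)" "valid_component (swap_wall2 e a b' w t0)"
    if "e = 1 \<or> e = -1" "0 < w" "w \<le> 17" "0 \<le> t0" for e a b' w t0
    using that unfolding swap_wall1_def swap_wall2_def diag_def
    by (auto simp: snd_ramp map_poly_pCons)
  then have "valid_component k" if "k \<in> ts_swap1 c r \<union> ts_swap2 p b c r"
    using that num by (auto simp: ts_swap1_def ts_swap2_def)
  moreover have "valid_component k" if "k \<in> ts_parabs p b c r \<union> ts_slashes p b c r"
    using that by (auto simp: ts_parabs_def ts_slashes_def Let_def parab_def slash_def op_scale_def)
  ultimately show "valid_component k" using assms by (auto simp: moving_tscale_def)
  show "confined k (inner_tile c r)"
    using assms num unfolding moving_tscale_def inner_tile_def
    by (elim UnE; intro confined_mono[OF ts_swap1_confined[of k c r]] confined_mono[OF ts_swap2_confined[of k p b c r]]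
        confined_mono[OF ts_parabs_confined[of k p b c r]] confined_mono[OF ts_slashes_confined[of k p b c r]] rect_mono) auto
  show "is_wall k \<or> is_parabolic_wall k \<or> is_moving_wall k"
    using assms by (auto simp: moving_tscale_def ts_swap1_def ts_swap2_def ts_parabs_def ts_slashes_def Let_def
        swap_wall1_def swap_wall2_def parab_def slash_def)
qed

theorem theorem1:
  fixes M :: "'q::finite two_stack_pda"
  shows "(\<exists>C p G T K. simulates C p G T K M \<and>
            (\<forall>c\<in>C. is_gate c \<or> is_wall c \<or> is_parabolic_wall c \<or> is_moving_wall c)) \<and>
         (\<exists>C p G T K. simulates C p G T K M \<and>
            (\<forall>c\<in>C. is_gate c \<or> is_wall c \<or> is_parabolic_wall c \<or> is_bumper c))"
proof
  interpret A: machine "\<lambda>j c r. {shutter j c r}" moving_tscale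
    "\<lambda>c. is_gate c \<or> is_wall c \<or> is_parabolic_wall c \<or> is_moving_wall c" M
  proof
    show "finite {shutter j c r}" "finite (moving_tscale p a c r)" for j c r p a
      by (simp_all add: moving_tscale_def ts_swap1_def ts_swap2_def ts_parabs_def ts_slashes_def Let_def)
    fix c r x s b j assume u: "beam_up c r x s b" "0 \<le> x" "x \<le> 1"
    show "\<exists>n b'. n \<le> 8 \<and> run {shutter j c r} (tile c r) n b b' \<and> beam_right (c + 1) r x s b'" if "low j s"
      using shutter_low[OF u that] by (intro exI[of _ 1]) auto
    show "\<exists>n b'. n \<le> 8 \<and> run {shutter j c r} (tile c r) n b b' \<and> beam_up c (r + 1) x s b'" if "high j s"
      using shutter_high[OF u that] by (intro exI[of _ 0]) auto
  next
    fix c r x p a z b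
    assume u: "beam_up c r x (16 * real_of_rat (op_in p a) + z) b" "0 \<le> x" "x \<le> 1" "0 \<le> z" "z \<le> 16 * real_of_rat (op_width p)"
    show "\<exists>n b'. n \<le> 8 \<and> run (moving_tscale p a c r) (tile c r) n b b' \<and>
        beam_up c (r + 1) x (16 * real_of_rat (op_out p a) + real_of_rat (op_scale p) * z) b'"
      using moving_tscale_run[OF u] by (intro exI[of _ 8]) auto
  next
    fix k j c r p a assume "k \<in> {shutter j c r} \<or> k \<in> moving_tscale p a c r"
    then show "valid_component k \<and> confined k (inner_tile c r) \<and>
        (is_gate k \<or> is_wall k \<or> is_parabolic_wall k \<or> is_moving_wall k)"
    proof
      assume "k \<in> {shutter j c r}"
      then show ?thesis using valid_shutter confined_shutter by (auto simp: shutter_def)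
    next
      assume "k \<in> moving_tscale p a c r"
      then show ?thesis using moving_tscale_ok by blast
    qed
  qed auto
  show "\<exists>C p G T K. simulates C p G T K M \<and>
      (\<forall>c\<in>C. is_gate c \<or> is_wall c \<or> is_parabolic_wall c \<or> is_moving_wall c)"
    using A.simulates_machine A.parts_ok by blast
next
  interpret B: machine bumper_test bumper_tscale
    "\<lambda>c. is_gate c \<or> is_wall c \<or> is_parabolic_wall c \<or> is_bumper c" M
  proof
    show "finite (bumper_test j c r)" "finite (bumper_tscale p a c r)" for j c r p a
      by (simp_all add: bumper_test_def bumper_tscale_def bs_core_def bs_slashes_def)
    fix c r x s b j assume u: "beam_up c r x s b" "0 \<le> x" "x \<le> 1"
    show "\<exists>n b'. n \<le> 8 \<and> run (bumper_test j c r) (tile c r) n b b' \<and> beam_right (c + 1) r x s b'" if "low j s"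
      using bumper_test_low[OF u that] by (intro exI[of _ 1]) auto
    show "\<exists>n b'. n \<le> 8 \<and> run (bumper_test j c r) (tile c r) n b b' \<and> beam_up c (r + 1) x s b'" if "high j s"
      using bumper_test_high[OF u that] by (intro exI[of _ 6]) auto
  next
    fix c r x p a z b
    assume u: "beam_up c r x (16 * real_of_rat (op_in p a) + z) b" "0 \<le> x" "x \<le> 1" "0 \<le> z" "z \<le> 16 * real_of_rat (op_width p)"
    show "\<exists>n b'. n \<le> 8 \<and> run (bumper_tscale p a c r) (tile c r) n b b' \<and>
        beam_up c (r + 1) x (16 * real_of_rat (op_out p a) + real_of_rat (op_scale p) * z) b'"
      using bumper_tscale_run[OF u] by (intro exI[of _ 6]) auto
  next
    fix k j c r p a assume "k \<in> bumper_test j c r \<or> k \<in> bumper_tscale p a c r"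
    then show "valid_component k \<and> confined k (inner_tile c r) \<and>
        (is_gate k \<or> is_wall k \<or> is_parabolic_wall k \<or> is_bumper k)"
    proof
      assume "k \<in> bumper_test j c r"
      from bumper_test_ok[OF this] show ?thesis by blast
    next
      assume "k \<in> bumper_tscale p a c r"
      from bumper_tscale_ok[OF this] show ?thesis by blast
    qed
  qed auto
  show "\<exists>C p G T K. simulates C p G T K M \<and>
      (\<forall>c\<in>C. is_gate c \<or> is_wall c \<or> is_parabolic_wall c \<or> is_bumper c)"
    using B.simulates_machine B.parts_ok by blast
qed

end
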